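(* Let $(\Lambda,\eta)$ be an isothermic $2$-torus in the $3$-sphere, i.e. an isothermic surface $\Lambda:\Sigma\to S^3$ where $\Sigma$ is a $2$-torus (compact Riemann surface of genus $1$), and let $r(t)=\sum_{i\le 0}r_it^i$ be a formal Laurent series with real coefficients and $r_0>0$. Then there is a globally defined (on all of $\Sigma$) formal conserved quantity $p(t)$ of $(\Lambda,\eta)$, unique up to sign, with $\bigl(p(t),p(t)\bigr)=r(t)$.
   Context: Everything is smooth. $\mathbb{R}^{4,1}$ is the Lorentzian vector space with inner product $(\cdot,\cdot)$ of signature $(4,1)$, $\mathcal{L}$ is its light-cone (non-zero null vectors), and $S^3$ is identified, as a conformal manifold, with $\mathbb{P}(\mathcal{L})$, whose conformal class consists of the metrics $g_\sigma(X,Y)=(\mathrm{d}\sigma(X),\mathrm{d}\sigma(Y))$ for $\sigma$ never-zero sections of $\mathcal{L}\to\mathbb{P}(\mathcal{L})$. $\Sigma$ is a (connected) Riemann surface and $\Lambda:\Sigma\to S^3\cong\mathbb{P}(\mathcal{L})$ is a conformal immersion, viewed as a null line subbundle of the trivial bundle $\underline{\mathbb{R}}^{4,1}=\Sigma\times\mathbb{R}^{4,1}$; $\mathrm{d}$ denotes flat differentiation. Identify $\bigwedge^2\mathbb{R}^{4,1}\cong o(\mathbb{R}^{4,1})$ via $(u\wedge v)w=(u,w)v-(v,w)u$. An isothermic surface $(\Lambda,\eta)$ is such a $\Lambda$ together with a non-zero (not identically zero) closed $1$-form $\eta\in\Omega^1\otimes o(\mathbb{R}^{4,1})$ on $\Sigma$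 taking values in $\Lambda\wedge\Lambda^\perp$. A formal conserved quantity of $(\Lambda,\eta)$ is a formal Laurent series $p(t)=\sum_{i\le 0}p_it^i$ with coefficients $p_i\in\Gamma(\underline{\mathbb{R}}^{4,1})$, $p_0\neq 0$, such that $(\mathrm{d}+t\eta)p(t)$ is the zero series (equivalently $\eta p_0=0$ and $\mathrm{d}p_i+\eta p_{i-1}=0$ for all $i\le 0$). The inner product of series is $\bigl(p(t),p(t)\bigr)=\sum_{k\le 0}\bigl(\sum_{i,j\le 0,\ i+j=k}(p_i,p_j)\bigr)t^k$. *)

theory Defs
  imports "HOL-Complex_Analysis.Complex_Analysis"
begin

section \<open>Smooth maps\<close>

text \<open>
  \<open>Ck_on\<close> and \<open>smooth_on\<close> are meant for open sets \<open>S\<close>.  On a finite-dimensional domain,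
  requiring every directional derivative to be \<open>C\<^sup>k\<close> amounts to the derivative being \<open>C\<^sup>k\<close>.
\<close>

primrec Ck_on :: "nat \<Rightarrow> ('a::euclidean_space \<Rightarrow> 'b::real_normed_vector) \<Rightarrow> 'a set \<Rightarrow> bool" where
  "Ck_on 0 f S \<longleftrightarrow> continuous_on S f"
| "Ck_on (Suc k) f S \<longleftrightarrow>
     (\<exists>f'. (\<forall>x\<in>S. (f has_derivative f' x) (at x)) \<and> (\<forall>v. Ck_on k (\<lambda>x. f' x v) S))"

definition smooth_on :: "('a::euclidean_space \<Rightarrow> 'b::real_normed_vector) \<Rightarrow> 'a set \<Rightarrow> bool" where
  "smooth_on f S \<longleftrightarrow> (\<forall>k. Ck_on k f S)"

section \<open>Riemann surfaces\<close>

text \<open>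
  The surface is the whole of a Hausdorff type.  A chart is a domain together with a
  coordinate map; values of the map outside the domain are irrelevant.
\<close>

type_synonym 'a chart = "'a set \<times> ('a \<Rightarrow> complex)"

abbreviation chart_dom :: "'a chart \<Rightarrow> 'a set" where
  "chart_dom \<equiv> fst"

abbreviation chart_map :: "'a chart \<Rightarrow> 'a \<Rightarrow> complex" where
  "chart_map \<equiv> snd"

definition chart_inv :: "'a chart \<Rightarrow> complex \<Rightarrow> 'a" where
  "chart_inv c = inv_into (chart_dom c) (chart_map c)"

definition transition :: "'a chart \<Rightarrow> 'a chart \<Rightarrow> complex \<Rightarrow> complex" where
  "transition c d = chart_map d \<circ> chart_inv c"

definition riemann_surface :: "'a::t2_space chart set \<Rightarrow> bool" where
  "riemann_surface A \<longleftrightarrow>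
     connected (UNIV :: 'a set) \<and>
     (\<Union>c\<in>A. chart_dom c) = UNIV \<and>
     (\<forall>c\<in>A. open (chart_dom c) \<and> open (chart_map c ` chart_dom c) \<and>
        homeomorphism (chart_dom c) (chart_map c ` chart_dom c) (chart_map c) (chart_inv c)) \<and>
     (\<forall>c\<in>A. \<forall>d\<in>A.
        transition c d holomorphic_on chart_map c ` (chart_dom c \<inter> chart_dom d))"

definition smooth_map_on ::
    "'a::t2_space chart set \<Rightarrow> 'a set \<Rightarrow> ('a \<Rightarrow> 'b::real_normed_vector) \<Rightarrow> bool" where
  "smooth_map_on A U f \<longleftrightarrow>
     (\<forall>c\<in>A. smooth_on (f \<circ> chart_inv c) (chart_map c ` (chart_dom c \<inter> U)))"

text \<open>
  A tangent vector at \<open>x\<close> is represented, relative to a chart \<open>c\<close> around \<open>x\<close>, by its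
  coordinate \<open>v :: complex\<close>; \<open>dif c f x v\<close> is \<open>(df)\<^sub>x\<close> applied to it.
\<close>

definition dif :: "'a chart \<Rightarrow> ('a \<Rightarrow> 'b::real_normed_vector) \<Rightarrow> 'a \<Rightarrow> complex \<Rightarrow> 'b" where
  "dif c f x = frechet_derivative (f \<circ> chart_inv c) (at (chart_map c x))"

text \<open>
  Being a 2-torus (compact of genus 1) means being diffeomorphic to \<open>\<real>\<^sup>2/\<int>\<^sup>2\<close>.  Such a
  diffeomorphism is given here by its composite \<open>\<pi>\<close> with the projection
  \<open>\<real>\<^sup>2 = \<complex> \<rightarrow> \<real>\<^sup>2/\<int>\<^sup>2\<close>: a surjective local diffeomorphism whose fibres are the cosets of
  \<open>\<int>\<^sup>2\<close>.  It is only real-smooth, so the conformal structure is not restricted.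
\<close>

definition two_torus :: "'a::t2_space chart set \<Rightarrow> bool" where
  "two_torus A \<longleftrightarrow>
     (\<exists>\<pi> :: complex \<Rightarrow> 'a.
        surj \<pi> \<and>
        (\<forall>z w. \<pi> z = \<pi> w \<longleftrightarrow> Re (z - w) \<in> \<int> \<and> Im (z - w) \<in> \<int>) \<and>
        continuous_on UNIV \<pi> \<and>
        (\<forall>c\<in>A. smooth_on (chart_map c \<circ> \<pi>) (\<pi> -` chart_dom c) \<and>
           (\<forall>z \<in> \<pi> -` chart_dom c. bij (frechet_derivative (chart_map c \<circ> \<pi>) (at z)))))"

section \<open>Lorentzian space and conformal immersions\<close>

type_synonym R41 = "(real ^ 4) \<times> real"

definition lor :: "R41 \<Rightarrow> R41 \<Rightarrow> real" where
  "lor u v = fst u \<bullet> fst v - snd u * snd v"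

definition light_cone :: "R41 set" where
  "light_cone = {v. v \<noteq> 0 \<and> lor v v = 0}"

definition proj_light_cone :: "R41 set set" where
  "proj_light_cone = (\<lambda>v. span {v}) ` light_cone"

definition lor_perp :: "R41 set \<Rightarrow> R41 set" where
  "lor_perp S = {w. \<forall>u\<in>S. lor u w = 0}"

definition wedge :: "R41 \<Rightarrow> R41 \<Rightarrow> (R41 \<Rightarrow>\<^sub>L R41)" where
  "wedge u v = Blinfun (\<lambda>w. lor u w *\<^sub>R v - lor v w *\<^sub>R u)"

definition wedge_space :: "R41 set \<Rightarrow> R41 set \<Rightarrow> (R41 \<Rightarrow>\<^sub>L R41) set" where
  "wedge_space S T = span {wedge u v | u v. u \<in> S \<and> v \<in> T}"

definition local_lift ::
    "'a::t2_space chart set \<Rightarrow> ('a \<Rightarrow> R41 set) \<Rightarrow> 'a set \<Rightarrow> ('a \<Rightarrow> R41) \<Rightarrow> bool" where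
  "local_lift A \<Lambda> U \<sigma> \<longleftrightarrow>
     open U \<and> smooth_map_on A U \<sigma> \<and> (\<forall>x\<in>U. \<sigma> x \<in> light_cone \<and> \<Lambda> x = span {\<sigma> x})"

text \<open>
  A map into the projective light cone is smooth iff it has smooth lifts to the light cone
  locally.  Lifts of \<open>\<Lambda>\<close> are the composites of \<open>\<Lambda>\<close> with sections of the light cone bundle, so
  \<open>(d\<sigma>, d\<sigma>)\<close> is the pull-back by \<open>\<Lambda>\<close> of a metric in the conformal class of \<open>S\<^sup>3\<close>; it must be a
  positive multiple of the Euclidean metric in each holomorphic coordinate.  Positivity of the
  factor makes \<open>\<Lambda>\<close> an immersion.
\<close>

definition conformal_immersion ::
    "'a::t2_space chart set \<Rightarrow> ('a \<Rightarrow> R41 set) \<Rightarrow> bool" where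
  "conformal_immersion A \<Lambda> \<longleftrightarrow>
     (\<forall>x. \<Lambda> x \<in> proj_light_cone) \<and>
     (\<forall>x. \<exists>U \<sigma>. x \<in> U \<and> local_lift A \<Lambda> U \<sigma>) \<and>
     (\<forall>U \<sigma>. local_lift A \<Lambda> U \<sigma> \<longrightarrow>
        (\<forall>c\<in>A. \<forall>x \<in> U \<inter> chart_dom c. \<exists>\<rho>>0. \<forall>v w.
           lor (dif c \<sigma> x v) (dif c \<sigma> x w) = \<rho> * (v \<bullet> w)))"

section \<open>Isothermic surfaces\<close>

text \<open>
  An endomorphism-valued 1-form is given by its coordinate expressions: \<open>\<eta> c x v\<close> is the value
  on the tangent vector at \<open>x\<close> with coordinate \<open>v\<close> in the chart \<open>c\<close>.  Only \<open>c \<in> A\<close> and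
  \<open>x \<in> chart_dom c\<close> matter.
\<close>

type_synonym 'a form = "'a chart \<Rightarrow> 'a \<Rightarrow> complex \<Rightarrow>\<^sub>L (R41 \<Rightarrow>\<^sub>L R41)"

definition one_form :: "'a::t2_space chart set \<Rightarrow> 'a form \<Rightarrow> bool" where
  "one_form A \<eta> \<longleftrightarrow>
     (\<forall>c\<in>A. smooth_on (\<eta> c \<circ> chart_inv c) (chart_map c ` chart_dom c)) \<and>
     (\<forall>c\<in>A. \<forall>d\<in>A. \<forall>x \<in> chart_dom c \<inter> chart_dom d. \<forall>v.
        blinfun_apply (\<eta> c x) v =
        blinfun_apply (\<eta> d x) (deriv (transition c d) (chart_map c x) * v))"

definition closed_form :: "'a::t2_space chart set \<Rightarrow> 'a form \<Rightarrow> bool" where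
  "closed_form A \<eta> \<longleftrightarrow>
     (\<forall>c\<in>A. \<forall>x \<in> chart_dom c. \<forall>u v.
        blinfun_apply (dif c (\<eta> c) x u) v - blinfun_apply (dif c (\<eta> c) x v) u = 0)"

text \<open>Elements of \<open>\<Lambda> \<and> \<Lambda>\<^sup>\<bottom>\<close> are automatically skew for \<open>lor\<close>.\<close>

definition isothermic ::
    "'a::t2_space chart set \<Rightarrow> ('a \<Rightarrow> R41 set) \<Rightarrow> 'a form \<Rightarrow> bool" where
  "isothermic A \<Lambda> \<eta> \<longleftrightarrow>
     conformal_immersion A \<Lambda> \<and>
     one_form A \<eta> \<and> closed_form A \<eta> \<and>
     (\<forall>c\<in>A. \<forall>x \<in> chart_dom c. \<forall>v.
        blinfun_apply (\<eta> c x) v \<in> wedge_space (\<Lambda> x) (lor_perp (\<Lambda> x))) \<and>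
     (\<exists>c\<in>A. \<exists>x \<in> chart_dom c. \<eta> c x \<noteq> 0)"

section \<open>Formal conserved quantities\<close>

text \<open>
  A series \<open>\<Sum>\<^bsub>i\<le>0\<^esub> p\<^sub>i t\<^sup>i\<close> is its family of coefficients indexed by \<open>int\<close>, vanishing for
  \<open>i > 0\<close>.  The \<open>t\<^sup>i\<close>-coefficient of \<open>(d + t\<eta>)p(t)\<close> is \<open>dp\<^sub>i + \<eta> p\<^bsub>i-1\<^esub>\<close>; for \<open>i = 1\<close> its
  vanishing says \<open>\<eta> p\<^sub>0 = 0\<close>.
\<close>

definition formal_conserved_quantity ::
    "'a::t2_space chart set \<Rightarrow> 'a form \<Rightarrow> (int \<Rightarrow> 'a \<Rightarrow> R41) \<Rightarrow> bool" where
  "formal_conserved_quantity A \<eta> p \<longleftrightarrow>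
     (\<forall>i>0. \<forall>x. p i x = 0) \<and>
     (\<forall>i. smooth_map_on A UNIV (p i)) \<and>
     (\<exists>x. p 0 x \<noteq> 0) \<and>
     (\<forall>i. \<forall>c\<in>A. \<forall>x \<in> chart_dom c. \<forall>v.
        dif c (p i) x v + blinfun_apply (blinfun_apply (\<eta> c x) v) (p (i - 1) x) = 0)"

definition series_inner :: "(int \<Rightarrow> 'a \<Rightarrow> R41) \<Rightarrow> (int \<Rightarrow> 'a \<Rightarrow> R41) \<Rightarrow> int \<Rightarrow> 'a \<Rightarrow> real" where
  "series_inner p q k x = (\<Sum>(i, j) \<in> {(i, j). i \<le> 0 \<and> j \<le> 0 \<and> i + j = k}. lor (p i x) (q j x))"

end

theory Submission
  imports Defs
begin

text \<open>
  Once the quadratic differential of \<open>\<eta>\<close> is known to have no zeros, a formal conserved quantity is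
  determined algebraically, coefficient by coefficient, and no integration takes place.

  In a chart let \<open>s\<close> be the lift of \<open>\<Lambda>\<close> with time component one, so that \<open>\<eta> = s \<and> (t1 dx + t2 dy)\<close>.
  Closedness says that \<open>t1\<close> and \<open>t2\<close> arise from \<open>ds\<close> by a symmetric trace-free endomorphism, and that
  the pairing of \<open>(t1, t2)\<close> with \<open>ds\<close> is the real part of a holomorphic quadratic differential
  \<open>q dz\<^sup>2\<close>.  Suppose that \<open>q\<close> does not vanish.  Then \<open>dp\<^sub>i = - \<eta> p\<^bsub>i-1\<^esub>\<close> prescribes the
  products of \<open>p\<^bsub>i-1\<^esub>\<close> with \<open>s\<close> and \<open>ds\<close>.  The derivative of \<open>p\<^bsub>i-1\<^esub>\<close> has to lie in
  the image of \<open>\<eta>\<close> as well; since \<open>\<eta>\<close> is trace-free, this prescribes the product with \<open>\<Delta>s\<close>.  What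
  is left free is the component along the conformal Gauss map, and that is given by the coefficient of
  the norm.  The leading coefficient satisfies the same conditions with zero data, so it is
  \<open>\<plusminus> \<surd>r\<^sub>0\<close> times the conformal Gauss map.  This proves uniqueness up to sign
  (\<open>conserved_unique\<close>).  For existence the coefficients defined by this recursion have to
  satisfy the equations (\<open>conserved_series_conserved\<close>).  There the equality of mixed partial
  derivatives makes the tangential second-order data of \<open>p\<^bsub>i-1\<^esub>\<close> proportional to \<open>q\<close>, and
  constancy of the norm, together with skewness of \<open>\<eta>\<close>, removes the component of \<open>dp\<^bsub>i-1\<^esub>\<close>
  along \<open>p\<^sub>0\<close>.

  The sign of \<open>p\<^sub>0\<close> is fixed in all charts at once by the unit normal of \<open>\<Lambda>\<close> in \<open>S\<^sup>3\<close>, which the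
  orientation of the surface determines.  By uniqueness the local series then agree on overlaps
  (\<open>exists_unique_conserved\<close>).

  It remains to see that \<open>q\<close> has no zeros on a torus (\<open>hopf_nonzero_on_torus\<close>).  By the
  identity theorem its zeros are isolated.  The value of \<open>q dz\<^sup>2\<close> on a vector field of the
  universal covering that is invariant under the lattice is a doubly periodic function \<open>H\<close>, and at each
  zero \<open>H\<close> has local degree of one and the same sign, because holomorphic maps preserve orientation.
  But a function from a torus to the plane has degree zero: the pull-back of a form with compact support
  is exact, so its integral vanishes by Stokes' theorem (\<open>periodic_jac_zero\<close>).
\<close>

section \<open>Calculus of smooth maps\<close>

lemma Ck_on_imp_continuous_on: "Ck_on k f S \<Longrightarrow> continuous_on S f"
proof (cases k)
  case (Suc n)
  moreover assume "Ck_on k f S"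
  ultimately obtain f' where "\<And>x. x \<in> S \<Longrightarrow> (f has_derivative f' x) (at x)" by auto
  then have "\<And>x. x \<in> S \<Longrightarrow> isCont f x" by (rule has_derivative_continuous)
  then show ?thesis by (simp add: continuous_at_imp_continuous_on)
qed auto

lemma Ck_on_SucD: "Ck_on (Suc k) f S \<Longrightarrow> Ck_on k f S"
proof (induction k arbitrary: f)
  case 0
  then show ?case using Ck_on_imp_continuous_on[of "Suc 0" f S] by simp
next
  case (Suc k)
  from Suc.prems obtain f' where "\<forall>x\<in>S. (f has_derivative f' x) (at x)"
      "\<forall>v. Ck_on (Suc k) (\<lambda>x. f' x v) S"
    unfolding Ck_on.simps(2)[of "Suc k"] by blast
  with Suc.IH show ?case unfolding Ck_on.simps(2)[of k] by blast
qed

lemma Ck_on_subset: "Ck_on k f S \<Longrightarrow> T \<subseteq> S \<Longrightarrow> Ck_on k f T"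
proof (induction k arbitrary: f)
  case 0
  then show ?case by (auto intro: continuous_on_subset)
next
  case (Suc k)
  then show ?case unfolding Ck_on.simps(2) by blast
qed

lemma Ck_on_cong:
  assumes "open S" "\<And>x. x \<in> S \<Longrightarrow> f x = g x" "Ck_on k f S"
  shows "Ck_on k g S"
proof (cases k)
  case 0
  then show ?thesis using assms by (metis Ck_on.simps(1) continuous_on_cong)
next
  case (Suc n)
  with assms obtain f' where f': "\<forall>x\<in>S. (f has_derivative f' x) (at x)" "\<forall>v. Ck_on n (\<lambda>x. f' x v) S"
    by auto
  then have "\<forall>x\<in>S. (g has_derivative f' x) (at x)"
    using has_derivative_transform_within_open[of f _ _ UNIV S g] assms(1,2) by blast
  with f' Suc show ?thesis by auto
qed

text \<open>On an open set the derivative is unique, so the existential witness in \<^const>\<open>Ck_on\<close> can be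
  taken to be \<^const>\<open>frechet_derivative\<close>; this is what makes the notion local.\<close>

lemma Ck_on_Suc_iff:
  assumes "open S"
  shows "Ck_on (Suc k) f S \<longleftrightarrow> (\<forall>x\<in>S. f differentiable (at x)) \<and>
           (\<forall>v. Ck_on k (\<lambda>x. frechet_derivative f (at x) v) S)"
proof
  assume "Ck_on (Suc k) f S"
  then obtain f' where f': "\<forall>x\<in>S. (f has_derivative f' x) (at x)" "\<forall>v. Ck_on k (\<lambda>x. f' x v) S"
    by auto
  have "\<forall>x\<in>S. f' x = frechet_derivative f (at x)"
    using f'(1) frechet_derivative_at by blast
  then have "Ck_on k (\<lambda>x. frechet_derivative f (at x) v) S" for v
    using f' by - (rule Ck_on_cong[OF assms, of "\<lambda>x. f' x v"]; simp)
  moreover have "\<forall>x\<in>S. f differentiable (at x)"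
    using f'(1) unfolding differentiable_def by blast
  ultimately show "(\<forall>x\<in>S. f differentiable (at x)) \<and>
           (\<forall>v. Ck_on k (\<lambda>x. frechet_derivative f (at x) v) S)" by blast
next
  assume *: "(\<forall>x\<in>S. f differentiable (at x)) \<and> (\<forall>v. Ck_on k (\<lambda>x. frechet_derivative f (at x) v) S)"
  show "Ck_on (Suc k) f S" unfolding Ck_on.simps
    by (rule exI[of _ "\<lambda>x. frechet_derivative f (at x)"])
       (use * frechet_derivative_works in blast)
qed

lemma Ck_on_local:
  assumes "\<And>x. x \<in> S \<Longrightarrow> \<exists>T. open T \<and> x \<in> T \<and> Ck_on k f T"
  shows "Ck_on k f S"
  using assms
proof (induction k arbitrary: f)
  case 0
  have "isCont f x" if "x \<in> S" for x
    using 0[OF that] continuous_on_eq_continuous_at by auto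
  then show ?case by (simp add: continuous_at_imp_continuous_on)
next
  case (Suc k)
  have D: "(f has_derivative frechet_derivative f (at x)) (at x)" if x: "x \<in> S" for x
  proof -
    obtain T where "open T" "x \<in> T" "Ck_on (Suc k) f T" using Suc.prems[OF x] by blast
    then have "f differentiable (at x)" using Ck_on_Suc_iff[of T k f] by blast
    then show ?thesis by (simp add: frechet_derivative_works)
  qed
  have "Ck_on k (\<lambda>x. frechet_derivative f (at x) v) S" for v
  proof (rule Suc.IH)
    fix x assume x: "x \<in> S"
    obtain T where "open T" "x \<in> T" "Ck_on (Suc k) f T" using Suc.prems[OF x] by blast
    then show "\<exists>T. open T \<and> x \<in> T \<and> Ck_on k (\<lambda>x. frechet_derivative f (at x) v) T"
      using Ck_on_Suc_iff[of T k f] by blast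
  qed
  then show ?case unfolding Ck_on.simps(2)
    using D by (intro exI[of _ "\<lambda>x. frechet_derivative f (at x)"]) auto
qed

lemma Ck_on_const: "Ck_on k (\<lambda>x. c) S"
proof (induction k arbitrary: c)
  case (Suc k)
  show ?case unfolding Ck_on.simps
    by (intro exI[of _ "\<lambda>x v. 0"] conjI ballI allI has_derivative_const Suc)
qed simp

lemma Ck_on_add:
  assumes "Ck_on k f S" "Ck_on k g S"
  shows "Ck_on k (\<lambda>x. f x + g x) S"
  using assms
proof (induction k arbitrary: f g)
  case (Suc k)
  obtain f' g' where *: "\<forall>x\<in>S. (f has_derivative f' x) (at x)" "\<forall>v. Ck_on k (\<lambda>x. f' x v) S"
    "\<forall>x\<in>S. (g has_derivative g' x) (at x)" "\<forall>v. Ck_on k (\<lambda>x. g' x v) S"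
    using Suc.prems by auto
  show ?case unfolding Ck_on.simps
    by (rule exI[of _ "\<lambda>x v. f' x v + g' x v"])
       (intro conjI ballI allI has_derivative_add Suc.IH; simp add: *)
qed (simp add: continuous_on_add)

lemma (in bounded_linear) Ck_on_compose:
  assumes "Ck_on k g S"
  shows "Ck_on k (\<lambda>x. f (g x)) S"
  using assms
proof (induction k arbitrary: g)
  case 0
  then show ?case by (auto intro: continuous_on)
next
  case (Suc k)
  obtain g' where *: "\<forall>x\<in>S. (g has_derivative g' x) (at x)" "\<forall>v. Ck_on k (\<lambda>x. g' x v) S"
    using Suc.prems by auto
  show ?case unfolding Ck_on.simps
    by (rule exI[of _ "\<lambda>x v. f (g' x v)"])
       (intro conjI ballI allI has_derivative Suc.IH; simp add: *)
qed

lemma (in bounded_bilinear) Ck_on_prod: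
  assumes "Ck_on k f S" "Ck_on k g S"
  shows "Ck_on k (\<lambda>x. prod (f x) (g x)) S"
  using assms
proof (induction k arbitrary: f g)
  case 0
  then show ?case by (auto intro: continuous_on)
next
  case (Suc k)
  obtain f' g' where *: "\<forall>x\<in>S. (f has_derivative f' x) (at x)" "\<forall>v. Ck_on k (\<lambda>x. f' x v) S"
    "\<forall>x\<in>S. (g has_derivative g' x) (at x)" "\<forall>v. Ck_on k (\<lambda>x. g' x v) S"
    using Suc.prems by auto
  have k: "Ck_on k f S" "Ck_on k g S" using Suc.prems Ck_on_SucD by blast+
  show ?case unfolding Ck_on.simps
    by (rule exI[of _ "\<lambda>x v. prod (f x) (g' x v) + prod (f' x v) (g x)"])
       (intro conjI ballI allI FDERIV Ck_on_add Suc.IH; simp add: * k)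
qed

lemma Ck_on_inverse:
  fixes f :: "'a::euclidean_space \<Rightarrow> real"
  assumes "Ck_on k f S" "\<And>x. x \<in> S \<Longrightarrow> f x \<noteq> 0"
  shows "Ck_on k (\<lambda>x. inverse (f x)) S"
  using assms
proof (induction k)
  case 0
  then show ?case by (auto intro: continuous_on_inverse)
next
  case (Suc k)
  obtain f' where *: "\<forall>x\<in>S. (f has_derivative f' x) (at x)" "\<forall>v. Ck_on k (\<lambda>x. f' x v) S"
    using Suc.prems by auto
  have k: "Ck_on k (\<lambda>x. inverse (f x)) S" using Suc Ck_on_SucD by blast
  show ?case unfolding Ck_on.simps
  proof (rule exI[of _ "\<lambda>x v. - (inverse (f x) * f' x v * inverse (f x))"], intro conjI ballI allI)
    fix x assume "x \<in> S"
    then show "((\<lambda>x. inverse (f x)) has_derivative (\<lambda>v. - (inverse (f x) * f' x v * inverse (f x)))) (at x)"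
      using * Suc.prems by (intro Deriv.has_derivative_inverse) auto
  next
    fix v
    show "Ck_on k (\<lambda>x. - (inverse (f x) * f' x v * inverse (f x))) S"
      using k * by (intro bounded_linear.Ck_on_compose[OF bounded_linear_minus[OF bounded_linear_ident]]
        bounded_bilinear.Ck_on_prod[OF bounded_bilinear_mult]) auto
  qed
qed

lemma smooth_on_subset: "smooth_on f S \<Longrightarrow> T \<subseteq> S \<Longrightarrow> smooth_on f T"
  unfolding smooth_on_def using Ck_on_subset by blast

lemma smooth_on_cong:
  "open S \<Longrightarrow> (\<And>x. x \<in> S \<Longrightarrow> f x = g x) \<Longrightarrow> smooth_on f S \<Longrightarrow> smooth_on g S"
  unfolding smooth_on_def using Ck_on_cong by blast

lemma smooth_on_local:
  "(\<And>x. x \<in> S \<Longrightarrow> \<exists>T. open T \<and> x \<in> T \<and> smooth_on f T) \<Longrightarrow> smooth_on f S"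
  unfolding smooth_on_def using Ck_on_local by metis

named_theorems smooth_intros

lemma smooth_on_const [smooth_intros]: "smooth_on (\<lambda>x. c) S"
  by (simp add: smooth_on_def Ck_on_const)

lemma smooth_on_add [smooth_intros]:
  "smooth_on f S \<Longrightarrow> smooth_on g S \<Longrightarrow> smooth_on (\<lambda>x. f x + g x) S"
  by (simp add: smooth_on_def Ck_on_add)

lemma (in bounded_linear) smooth_on_compose: "smooth_on g S \<Longrightarrow> smooth_on (\<lambda>x. f (g x)) S"
  by (simp add: smooth_on_def Ck_on_compose)

lemma (in bounded_bilinear) smooth_on_prod:
  "smooth_on f S \<Longrightarrow> smooth_on g S \<Longrightarrow> smooth_on (\<lambda>x. prod (f x) (g x)) S"
  by (simp add: smooth_on_def Ck_on_prod)

lemmas smooth_on_minus [smooth_intros] =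
  bounded_linear.smooth_on_compose[OF bounded_linear_minus[OF bounded_linear_ident]]
lemmas smooth_on_fst [smooth_intros] = bounded_linear.smooth_on_compose[OF bounded_linear_fst]
lemmas smooth_on_snd [smooth_intros] = bounded_linear.smooth_on_compose[OF bounded_linear_snd]
lemmas smooth_on_nth [smooth_intros] = bounded_linear.smooth_on_compose[OF bounded_linear_vec_nth]
lemmas smooth_on_Re [smooth_intros] = bounded_linear.smooth_on_compose[OF bounded_linear_Re]
lemmas smooth_on_Im [smooth_intros] = bounded_linear.smooth_on_compose[OF bounded_linear_Im]
lemmas smooth_on_mult [smooth_intros] = bounded_bilinear.smooth_on_prod[OF bounded_bilinear_mult]
lemmas smooth_on_scaleR [smooth_intros] = bounded_bilinear.smooth_on_prod[OF bounded_bilinear_scaleR]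
lemmas smooth_on_inner [smooth_intros] = bounded_bilinear.smooth_on_prod[OF bounded_bilinear_inner]
lemmas smooth_on_blinfun_apply [smooth_intros] =
  bounded_bilinear.smooth_on_prod[OF bounded_bilinear_blinfun_apply]

lemma smooth_on_diff [smooth_intros]:
  "smooth_on f S \<Longrightarrow> smooth_on g S \<Longrightarrow> smooth_on (\<lambda>x. f x - g x) S"
  using smooth_on_add[of f S "\<lambda>x. - g x"] smooth_on_minus[of g S] by simp

lemma smooth_on_sum [smooth_intros]:
  "(\<And>i. i \<in> I \<Longrightarrow> smooth_on (f i) S) \<Longrightarrow> smooth_on (\<lambda>x. \<Sum>i\<in>I. f i x) S"
  by (induction I rule: infinite_finite_induct) (auto intro: smooth_intros)

lemma smooth_on_divide [smooth_intros]:
  fixes f g :: "'a::euclidean_space \<Rightarrow> real"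
  assumes "smooth_on f S" "smooth_on g S" "\<And>x. x \<in> S \<Longrightarrow> g x \<noteq> 0"
  shows "smooth_on (\<lambda>x. f x / g x) S"
  unfolding divide_inverse
  using assms by (intro smooth_on_mult) (auto simp: smooth_on_def Ck_on_inverse)

lemma smooth_on_power [smooth_intros]:
  fixes f :: "'a::euclidean_space \<Rightarrow> 'b::real_normed_algebra_1"
  shows "smooth_on f S \<Longrightarrow> smooth_on (\<lambda>x. f x ^ n) S"
  by (induction n) (auto intro: smooth_intros)

lemma smooth_on_Pair [smooth_intros]:
  assumes "smooth_on f S" "smooth_on g S"
  shows "smooth_on (\<lambda>x. (f x, g x)) S"
proof -
  have l: "bounded_linear (\<lambda>a. (a, 0))" "bounded_linear (\<lambda>b. (0, b))"
    by (intro bounded_linear_Pair bounded_linear_ident bounded_linear_zero)+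
  have "smooth_on (\<lambda>x. (f x, 0) + (0, g x)) S"
    by (intro smooth_on_add l[THEN bounded_linear.smooth_on_compose] assms)
  then show ?thesis by simp
qed

lemma smooth_on_imp_differentiable:
  assumes "smooth_on f S" "open S" "x \<in> S"
  shows "f differentiable (at x)"
  using assms Ck_on_Suc_iff[of S 0 f] unfolding smooth_on_def by blast

lemma smooth_on_imp_continuous_on: "smooth_on f S \<Longrightarrow> continuous_on S f"
  unfolding smooth_on_def using Ck_on.simps(1) by blast

lemma smooth_on_frechet_derivative:
  assumes "smooth_on f S" "open S"
  shows "smooth_on (\<lambda>x. frechet_derivative f (at x) v) S"
  using assms Ck_on_Suc_iff[of S _ f] unfolding smooth_on_def by blast

subsection \<open>Partial derivatives on the plane\<close>

definition pdx :: "(complex \<Rightarrow> 'b::real_normed_vector) \<Rightarrow> complex \<Rightarrow> 'b" where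
  "pdx f z = frechet_derivative f (at z) 1"

definition pdy :: "(complex \<Rightarrow> 'b::real_normed_vector) \<Rightarrow> complex \<Rightarrow> 'b" where
  "pdy f z = frechet_derivative f (at z) \<i>"

lemma smooth_on_pdx [smooth_intros]: "smooth_on f S \<Longrightarrow> open S \<Longrightarrow> smooth_on (pdx f) S"
  unfolding pdx_def[abs_def] by (rule smooth_on_frechet_derivative)

lemma smooth_on_pdy [smooth_intros]: "smooth_on f S \<Longrightarrow> open S \<Longrightarrow> smooth_on (pdy f) S"
  unfolding pdy_def[abs_def] by (rule smooth_on_frechet_derivative)

lemma pd_eqI:
  assumes "(f has_derivative f') (at z)"
  shows "pdx f z = f' 1" "pdy f z = f' \<i>"
  using frechet_derivative_at[OF assms] by (auto simp: pdx_def pdy_def)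

lemma frechet_derivative_eq_pd:
  assumes "f differentiable (at z)"
  shows "frechet_derivative f (at z) v = Re v *\<^sub>R pdx f z + Im v *\<^sub>R pdy f z"
proof -
  interpret linear "frechet_derivative f (at z)"
    by (rule linear_frechet_derivative[OF assms])
  have "v = Re v *\<^sub>R 1 + Im v *\<^sub>R \<i>" by (simp add: complex_eq_iff)
  then have "frechet_derivative f (at z) v = frechet_derivative f (at z) (Re v *\<^sub>R 1 + Im v *\<^sub>R \<i>)"
    by simp
  then show ?thesis unfolding add scale pdx_def pdy_def by simp
qed

lemma has_derivative_pd:
  assumes "f differentiable (at z)"
  shows "(f has_derivative (\<lambda>v. Re v *\<^sub>R pdx f z + Im v *\<^sub>R pdy f z)) (at z)"
  using frechet_derivative_works[THEN iffD1, OF assms] frechet_derivative_eq_pd[OF assms]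
  by (simp add: has_derivative_eq_rhs fun_eq_iff)

lemma pd_cong:
  assumes "open S" "z \<in> S" "\<And>w. w \<in> S \<Longrightarrow> f w = g w" "f differentiable (at z)"
  shows "pdx f z = pdx g z" "pdy f z = pdy g z"
  using frechet_derivative_transform_within_open[OF assms(4,1,2,3)] by (auto simp: pdx_def pdy_def)

lemma pd_const [simp]: "pdx (\<lambda>x. c) z = 0" "pdy (\<lambda>x. c) z = 0"
  by (auto simp: pdx_def pdy_def)

lemma pd_diff:
  assumes "f differentiable (at z)" "g differentiable (at z)"
  shows "pdx (\<lambda>x. f x - g x) z = pdx f z - pdx g z" "pdy (\<lambda>x. f x - g x) z = pdy f z - pdy g z"
  using pd_eqI[OF has_derivative_diff[OF has_derivative_pd[OF assms(1)] has_derivative_pd[OF assms(2)]]]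
  by auto

lemma pd_minus:
  assumes "f differentiable (at z)"
  shows "pdx (\<lambda>x. - f x) z = - pdx f z" "pdy (\<lambda>x. - f x) z = - pdy f z"
  using pd_eqI[OF has_derivative_minus[OF has_derivative_pd[OF assms(1)]]] by auto

lemma pd_sum:
  assumes "\<And>i. i \<in> I \<Longrightarrow> f i differentiable (at z)"
  shows "pdx (\<lambda>x. \<Sum>i\<in>I. f i x) z = (\<Sum>i\<in>I. pdx (f i) z)"
        "pdy (\<lambda>x. \<Sum>i\<in>I. f i x) z = (\<Sum>i\<in>I. pdy (f i) z)"
  using pd_eqI[OF has_derivative_sum[OF has_derivative_pd[OF assms]]] by auto

lemma (in bounded_linear) pd_compose:
  assumes "g differentiable (at z)"
  shows "pdx (\<lambda>x. f (g x)) z = f (pdx g z)" "pdy (\<lambda>x. f (g x)) z = f (pdy g z)"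
  using pd_eqI[OF has_derivative[OF has_derivative_pd[OF assms]]] by auto

lemma (in bounded_bilinear) pd_prod:
  assumes "f differentiable (at z)" "g differentiable (at z)"
  shows "pdx (\<lambda>x. prod (f x) (g x)) z = prod (f z) (pdx g z) + prod (pdx f z) (g z)"
        "pdy (\<lambda>x. prod (f x) (g x)) z = prod (f z) (pdy g z) + prod (pdy f z) (g z)"
  using pd_eqI[OF FDERIV[OF has_derivative_pd[OF assms(1)] has_derivative_pd[OF assms(2)]]]
  by auto

lemma has_real_derivative_along_x:
  assumes "f differentiable (at (Complex t y))"
  shows "((\<lambda>x. f (Complex x y)) has_real_derivative pdx f (Complex t y)) (at t)"
proof -
  have "((\<lambda>x. Complex x y) has_derivative (\<lambda>h. of_real h)) (at t)"
  proof -
    have "((\<lambda>x. of_real x + \<i> * of_real y) has_derivative (\<lambda>h. complex_of_real h)) (at t)"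
      by (auto intro!: derivative_eq_intros)
    then show ?thesis by (simp add: Complex_eq)
  qed
  from has_derivative_compose[OF this has_derivative_pd[OF assms]]
  show ?thesis by (simp add: has_field_derivative_def mult.commute[of _ "pdx _ _"])
qed

lemma has_real_derivative_along_y:
  assumes "f differentiable (at (Complex x t))"
  shows "((\<lambda>y. f (Complex x y)) has_real_derivative pdy f (Complex x t)) (at t)"
proof -
  have "((\<lambda>y. Complex x y) has_derivative (\<lambda>h. \<i> * of_real h)) (at t)"
  proof -
    have "((\<lambda>y. of_real x + \<i> * of_real y) has_derivative (\<lambda>h. \<i> * complex_of_real h)) (at t)"
      by (auto intro!: derivative_eq_intros)
    then show ?thesis by (simp add: Complex_eq)
  qed
  from has_derivative_compose[OF this has_derivative_pd[OF assms]]
  show ?thesis by (simp add: has_field_derivative_def mult.commute[of _ "pdy _ _"])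
qed

text \<open>Both mixed partials near \<open>z\<close> are values of the same second difference quotient, by two
  applications of the mean value theorem in either order.\<close>

lemma mixed_partials_near:
  fixes f :: "complex \<Rightarrow> real"
  assumes "e > 0" "\<And>w. w \<in> ball z e \<Longrightarrow> f differentiable (at w)"
    "\<And>w. w \<in> ball z e \<Longrightarrow> pdx f differentiable (at w)"
    "\<And>w. w \<in> ball z e \<Longrightarrow> pdy f differentiable (at w)"
  shows "\<exists>w\<in>ball z e. \<exists>w'\<in>ball z e. pdy (pdx f) w = pdx (pdy f) w'"
proof -
  define h where "h = e / 3"
  have h: "h > 0" using assms by (simp add: h_def)
  define x y where "x = Re z" and "y = Im z"
  have z: "z = Complex x y" by (simp add: x_def y_def)
  have inb: "Complex a b \<in> ball z e" if "x \<le> a" "a \<le> x + h" "y \<le> b" "b \<le> y + h" for a b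
  proof -
    have "dist z (Complex a b) = norm (Complex (x - a) (y - b))" by (simp add: z dist_norm cmod_def)
    also have "\<dots> \<le> \<bar>x - a\<bar> + \<bar>y - b\<bar>" using cmod_le[of "Complex (x - a) (y - b)"] by simp
    also have "\<dots> \<le> h + h" using that by (intro add_mono) (auto simp: abs_if)
    also have "\<dots> < e" using assms(1) by (simp add: h_def)
    finally show ?thesis by simp
  qed
  have dx: "((\<lambda>t. f (Complex t b)) has_real_derivative pdx f (Complex a b)) (at a)"
    if "x \<le> a" "a \<le> x + h" "y \<le> b" "b \<le> y + h" for a b
    by (rule has_real_derivative_along_x[OF assms(2)[OF inb[OF that]]])
  have dy: "((\<lambda>t. f (Complex a t)) has_real_derivative pdy f (Complex a b)) (at b)"
    if "x \<le> a" "a \<le> x + h" "y \<le> b" "b \<le> y + h" for a b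
    by (rule has_real_derivative_along_y[OF assms(2)[OF inb[OF that]]])
  have dyx: "((\<lambda>t. pdx f (Complex a t)) has_real_derivative pdy (pdx f) (Complex a b)) (at b)"
    if "x \<le> a" "a \<le> x + h" "y \<le> b" "b \<le> y + h" for a b
    by (rule has_real_derivative_along_y[OF assms(3)[OF inb[OF that]]])
  have dxy: "((\<lambda>t. pdy f (Complex t b)) has_real_derivative pdx (pdy f) (Complex a b)) (at a)"
    if "x \<le> a" "a \<le> x + h" "y \<le> b" "b \<le> y + h" for a b
    by (rule has_real_derivative_along_x[OF assms(4)[OF inb[OF that]]])
  define D where "D = f (Complex (x+h) (y+h)) - f (Complex (x+h) y) - f (Complex x (y+h)) + f (Complex x y)"
  have "\<exists>a. x < a \<and> a < x + h \<and>
      (f (Complex (x+h) (y+h)) - f (Complex (x+h) y)) - (f (Complex x (y+h)) - f (Complex x y)) =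
      (x + h - x) * (pdx f (Complex a (y+h)) - pdx f (Complex a y))"
    by (rule MVT2[where f = "\<lambda>t. f (Complex t (y+h)) - f (Complex t y)"])
       (use h in \<open>auto intro!: DERIV_diff dx\<close>)
  then obtain a where a: "x < a" "a < x + h" "D = h * (pdx f (Complex a (y+h)) - pdx f (Complex a y))"
    unfolding D_def by (auto simp: algebra_simps)
  have "\<exists>b. y < b \<and> b < y + h \<and>
      pdx f (Complex a (y+h)) - pdx f (Complex a y) = (y + h - y) * pdy (pdx f) (Complex a b)"
    by (rule MVT2) (use h a in \<open>auto intro!: dyx\<close>)
  then obtain b where b: "y < b" "b < y + h" "D = h * h * pdy (pdx f) (Complex a b)"
    using a by auto
  have "\<exists>b. y < b \<and> b < y + h \<and>
      (f (Complex (x+h) (y+h)) - f (Complex x (y+h))) - (f (Complex (x+h) y) - f (Complex x y)) =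
      (y + h - y) * (pdy f (Complex (x+h) b) - pdy f (Complex x b))"
    by (rule MVT2[where f = "\<lambda>t. f (Complex (x+h) t) - f (Complex x t)"])
       (use h in \<open>auto intro!: DERIV_diff dy\<close>)
  then obtain b' where b': "y < b'" "b' < y + h" "D = h * (pdy f (Complex (x+h) b') - pdy f (Complex x b'))"
    unfolding D_def by (auto simp: algebra_simps)
  have "\<exists>a. x < a \<and> a < x + h \<and>
      pdy f (Complex (x+h) b') - pdy f (Complex x b') = (x + h - x) * pdx (pdy f) (Complex a b')"
    by (rule MVT2) (use h b' in \<open>auto intro!: dxy\<close>)
  then obtain a' where a': "x < a'" "a' < x + h" "D = h * h * pdx (pdy f) (Complex a' b')"
    using b' by auto
  have "pdy (pdx f) (Complex a b) = pdx (pdy f) (Complex a' b')" using b(3) a'(3) h by simp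
  moreover have "Complex a b \<in> ball z e" "Complex a' b' \<in> ball z e"
    using a b a' b' by (intro inb; simp)+
  ultimately show ?thesis by blast
qed

lemma mixed_partials_real:
  fixes f :: "complex \<Rightarrow> real"
  assumes "smooth_on f S" "open S" "z \<in> S"
  shows "pdy (pdx f) z = pdx (pdy f) z"
proof (rule ccontr)
  assume ne: "pdy (pdx f) z \<noteq> pdx (pdy f) z"
  define d where "d = dist (pdy (pdx f) z) (pdx (pdy f) z) / 2"
  have d: "d > 0" using ne by (simp add: d_def)
  have s: "smooth_on (pdx f) S" "smooth_on (pdy f) S" "smooth_on (pdx (pdy f)) S" "smooth_on (pdy (pdx f)) S"
    using assms by (auto intro!: smooth_intros)
  have "isCont (pdx (pdy f)) z" "isCont (pdy (pdx f)) z"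
    using s[THEN smooth_on_imp_continuous_on] assms(2,3) by (auto simp: continuous_on_eq_continuous_at)
  note c = this[unfolded continuous_at_eps_delta, rule_format, OF d]
  obtain e1 where e1: "e1 > 0" "\<And>w. dist w z < e1 \<Longrightarrow> dist (pdx (pdy f) w) (pdx (pdy f) z) < d"
    using c(1) by blast
  obtain e2 where e2: "e2 > 0" "\<And>w. dist w z < e2 \<Longrightarrow> dist (pdy (pdx f) w) (pdy (pdx f) z) < d"
    using c(2) by blast
  note e = e1 e2
  obtain e3 where e3: "e3 > 0" "ball z e3 \<subseteq> S" using assms open_contains_ball by blast
  define e where "e = min e1 (min e2 e3)"
  have "e > 0" "ball z e \<subseteq> S" using e e3 by (auto simp: e_def)
  then obtain w w' where w: "w \<in> ball z e" "w' \<in> ball z e" "pdy (pdx f) w = pdx (pdy f) w'"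
    using mixed_partials_near[of e z f] smooth_on_imp_differentiable[OF assms(1,2)]
      smooth_on_imp_differentiable[OF s(1) assms(2)] smooth_on_imp_differentiable[OF s(2) assms(2)]
    by (auto simp: subset_iff)
  have "dist (pdx (pdy f) w') (pdx (pdy f) z) < d" "dist (pdy (pdx f) w) (pdy (pdx f) z) < d"
    using e w(1,2) by (auto simp: e_def dist_commute)
  then have "dist (pdy (pdx f) z) (pdx (pdy f) z) < d + d" using w(3)
    using dist_triangle_less_add[of "pdy (pdx f) z" "pdy (pdx f) w" d "pdx (pdy f) z" d]
    by (simp add: dist_commute)
  then show False by (simp add: d_def)
qed

lemma mixed_partials:
  fixes f :: "complex \<Rightarrow> 'b::euclidean_space"
  assumes "smooth_on f S" "open S" "z \<in> S"
  shows "pdy (pdx f) z = pdx (pdy f) z"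
proof (rule euclidean_eqI)
  fix b :: 'b
  assume "b \<in> Basis"
  let ?g = "\<lambda>x. f x \<bullet> b"
  have d: "f differentiable (at w)" "pdx f differentiable (at w)" "pdy f differentiable (at w)" if "w \<in> S" for w
    using assms that by (auto intro!: smooth_on_imp_differentiable smooth_intros)
  note bl = bounded_linear_inner_left[of b]
  have g: "smooth_on ?g S" by (intro smooth_intros assms)
  have eqx: "pdx ?g w = pdx f w \<bullet> b" "pdy ?g w = pdy f w \<bullet> b" if "w \<in> S" for w
    using bounded_linear.pd_compose[OF bl d(1)[OF that]] by auto
  have gd: "pdx ?g differentiable (at z)" "pdy ?g differentiable (at z)"
    using assms g by (auto intro!: smooth_on_imp_differentiable[OF _ assms(2)] smooth_intros)
  have "pdy (pdx ?g) z = pdy (\<lambda>x. pdx f x \<bullet> b) z" "pdx (pdy ?g) z = pdx (\<lambda>x. pdy f x \<bullet> b) z"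
    by (rule pd_cong[OF assms(2,3) _ gd(1)] pd_cong[OF assms(2,3) _ gd(2)]; simp add: eqx)+
  then have "pdy (pdx ?g) z = pdy (pdx f) z \<bullet> b" "pdx (pdy ?g) z = pdx (pdy f) z \<bullet> b"
    using bounded_linear.pd_compose[OF bl d(2)[OF assms(3)]]
      bounded_linear.pd_compose[OF bl d(3)[OF assms(3)]] by auto
  with mixed_partials_real[OF g assms(2,3)]
  show "pdy (pdx f) z \<bullet> b = pdx (pdy f) z \<bullet> b" by simp
qed

section \<open>Lorentzian algebra\<close>

text \<open>This form exhibits the Lorentzian product as a bounded bilinear map.\<close>

lemma lor_eq_inner: "lor u v = u \<bullet> (fst v, - snd v)"
  by (simp add: lor_def inner_prod_def)

lemma bounded_bilinear_lor: "bounded_bilinear lor"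
proof -
  have "bounded_linear (\<lambda>v::R41. (fst v, - snd v))"
    by (intro bounded_linear_Pair bounded_linear_fst bounded_linear_minus bounded_linear_snd)
  then show ?thesis
    unfolding lor_eq_inner[abs_def]
    by (rule bounded_bilinear.comp[OF bounded_bilinear_inner bounded_linear_ident])
qed

lemmas smooth_on_lor [smooth_intros] = bounded_bilinear.smooth_on_prod[OF bounded_bilinear_lor]
lemmas pd_lor = bounded_bilinear.pd_prod[OF bounded_bilinear_lor]

lemma lor_commute: "lor u v = lor v u"
  by (simp add: lor_def inner_commute)

lemma lor_simps [simp]:
  "lor (u + v) w = lor u w + lor v w" "lor w (u + v) = lor w u + lor w v"
  "lor (u - v) w = lor u w - lor v w" "lor w (u - v) = lor w u - lor w v"
  "lor (- u) w = - lor u w" "lor w (- u) = - lor w u"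
  "lor (c *\<^sub>R u) w = c * lor u w" "lor w (c *\<^sub>R u) = c * lor w u"
  "lor 0 w = 0" "lor w 0 = 0"
  using bounded_bilinear_lor
  by (simp_all add: bounded_bilinear.add_left bounded_bilinear.add_right bounded_bilinear.diff_left
      bounded_bilinear.diff_right bounded_bilinear.minus_left bounded_bilinear.minus_right
      bounded_bilinear.scaleR_left bounded_bilinear.scaleR_right bounded_bilinear.zero_left
      bounded_bilinear.zero_right)

lemma differentiable_lor [derivative_intros]:
  "f differentiable (at z) \<Longrightarrow> g differentiable (at z) \<Longrightarrow> (\<lambda>x. lor (f x) (g x)) differentiable (at z)"
  unfolding differentiable_def using bounded_bilinear.FDERIV[OF bounded_bilinear_lor] by blast

definition minor3 :: "('i \<Rightarrow> real) \<Rightarrow> ('i \<Rightarrow> real) \<Rightarrow> ('i \<Rightarrow> real) \<Rightarrow> 'i \<Rightarrow> 'i \<Rightarrow> 'i \<Rightarrow> real" where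
  "minor3 a b c i j k = a i * (b j * c k - b k * c j) - a j * (b i * c k - b k * c i)
     + a k * (b i * c j - b j * c i)"

text \<open>The triple cross product of four-space: the entries are the signed maximal minors of the matrix
  with rows \<open>a\<close>, \<open>b\<close>, \<open>c\<close>.\<close>

definition cross4 :: "real^4 \<Rightarrow> real^4 \<Rightarrow> real^4 \<Rightarrow> real^4" where
  "cross4 a b c = minor3 (vec_nth a) (vec_nth b) (vec_nth c) 2 3 4 *\<^sub>R axis 1 1 - minor3 (vec_nth a) (vec_nth b) (vec_nth c) 1 3 4 *\<^sub>R axis 2 1
     + minor3 (vec_nth a) (vec_nth b) (vec_nth c) 1 2 4 *\<^sub>R axis 3 1 - minor3 (vec_nth a) (vec_nth b) (vec_nth c) 1 2 3 *\<^sub>R axis 4 1"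

lemma cross4_nth:
  "vec_nth (cross4 a b c) 1 = minor3 (vec_nth a) (vec_nth b) (vec_nth c) 2 3 4" "vec_nth (cross4 a b c) 2 = - minor3 (vec_nth a) (vec_nth b) (vec_nth c) 1 3 4"
  "vec_nth (cross4 a b c) 3 = minor3 (vec_nth a) (vec_nth b) (vec_nth c) 1 2 4" "vec_nth (cross4 a b c) 4 = - minor3 (vec_nth a) (vec_nth b) (vec_nth c) 1 2 3"
  by (auto simp: cross4_def axis_def)

lemma inner_4: "(x::real^4) \<bullet> y = vec_nth x 1 * vec_nth y 1 + vec_nth x 2 * vec_nth y 2 + vec_nth x 3 * vec_nth y 3 + vec_nth x 4 * vec_nth y 4"
  by (simp add: inner_vec_def sum_4)

lemma cross4_orthogonal: "cross4 a b c \<bullet> a = 0" "cross4 a b c \<bullet> b = 0" "cross4 a b c \<bullet> c = 0"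
  by (auto simp: inner_4 cross4_nth minor3_def algebra_simps)

text \<open>The right-hand side is the Gram determinant; for orthogonal arguments it is the product of their
  squared lengths.\<close>

lemma cross4_inner_self:
  "cross4 a b c \<bullet> cross4 a b c =
     (a \<bullet> a) * ((b \<bullet> b) * (c \<bullet> c) - (b \<bullet> c)\<^sup>2)
     - (a \<bullet> b) * ((a \<bullet> b) * (c \<bullet> c) - (b \<bullet> c) * (a \<bullet> c))
     + (a \<bullet> c) * ((a \<bullet> b) * (b \<bullet> c) - (b \<bullet> b) * (a \<bullet> c))"
  unfolding inner_4 cross4_nth minor3_def by algebra

text \<open>A holomorphic change of coordinates acts in this way on the tangent frame, so it preserves the
  direction and the sign of the normal.\<close>

lemma cross4_rotate:
  "cross4 a (u *\<^sub>R b + v *\<^sub>R c) (u *\<^sub>R c - v *\<^sub>R b) = (u\<^sup>2 + v\<^sup>2) *\<^sub>R cross4 a b c"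
  by (simp add: vec_eq_iff forall_4 cross4_nth minor3_def algebra_simps power2_eq_square)

lemma smooth_on_cross4 [smooth_intros]:
  assumes "smooth_on f S" "smooth_on g S" "smooth_on h S"
  shows "smooth_on (\<lambda>x. cross4 (f x) (g x) (h x)) S"
  unfolding cross4_def minor3_def by (intro smooth_intros assms)

text \<open>Otherwise five pairwise orthogonal non-zero vectors would be independent in four-space.\<close>

lemma orthogonal_complement_trivial_4:
  fixes a b c d y :: "real^4"
  assumes "a \<noteq> 0" "b \<noteq> 0" "c \<noteq> 0" "d \<noteq> 0" "a \<bullet> b = 0" "a \<bullet> c = 0" "a \<bullet> d = 0" "b \<bullet> c = 0" "b \<bullet> d = 0" "c \<bullet> d = 0"
    and y: "y \<bullet> a = 0" "y \<bullet> b = 0" "y \<bullet> c = 0" "y \<bullet> d = 0"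
  shows "y = 0"
proof (rule ccontr)
  assume y0: "y \<noteq> 0"
  have ne: "a \<noteq> b" "a \<noteq> c" "a \<noteq> d" "b \<noteq> c" "b \<noteq> d" "c \<noteq> d" "y \<noteq> a" "y \<noteq> b" "y \<noteq> c" "y \<noteq> d"
    using assms y0 by auto
  have "pairwise orthogonal {y, a, b, c, d}"
    using assms by (auto simp: pairwise_insert orthogonal_def inner_commute)
  then have "independent {y, a, b, c, d}"
    using assms(1-4) y0 by (intro pairwise_orthogonal_independent) auto
  then have "card {y, a, b, c, d} \<le> DIM(real^4)" using independent_bound by blast
  moreover have "card {y, a, b, c, d} = 5" using ne by simp
  ultimately show False by simp
qed

section \<open>Conformal null lifts\<close>

locale null_lift =
  fixes V :: "complex set" and s :: "complex \<Rightarrow> R41"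
  assumes openV: "open V" and smooth_s: "smooth_on s V"
    and null: "\<And>z. z \<in> V \<Longrightarrow> lor (s z) (s z) = 0"
    and snd_s: "\<And>z. z \<in> V \<Longrightarrow> snd (s z) = 1"
    and conf: "\<And>z. z \<in> V \<Longrightarrow> lor (pdy s z) (pdy s z) = lor (pdx s z) (pdx s z)"
      "\<And>z. z \<in> V \<Longrightarrow> lor (pdx s z) (pdy s z) = 0"
      "\<And>z. z \<in> V \<Longrightarrow> lor (pdx s z) (pdx s z) > 0"
begin

abbreviation "sx \<equiv> pdx s"
abbreviation "sy \<equiv> pdy s"
definition "rho z = lor (sx z) (sx z)"
definition "lap z = pdx sx z + pdy sy z"

lemma smooth_lift [smooth_intros]:
  "smooth_on s V" "smooth_on sx V" "smooth_on sy V" "smooth_on (pdx sx) V" "smooth_on (pdy sx) V"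
  "smooth_on (pdx sy) V" "smooth_on (pdy sy) V" "smooth_on rho V" "smooth_on lap V"
  using smooth_s openV unfolding rho_def[abs_def] lap_def[abs_def] by (auto intro!: smooth_intros)

lemma diffV: "smooth_on f V \<Longrightarrow> z \<in> V \<Longrightarrow> f differentiable (at z)"
  using smooth_on_imp_differentiable openV by blast

lemmas diff_lift = smooth_lift[THEN diffV]

lemma rho_pos: "z \<in> V \<Longrightarrow> rho z > 0"
  by (simp add: rho_def conf)

lemma sxy: "z \<in> V \<Longrightarrow> pdy sx z = pdx sy z"
  by (rule mixed_partials[OF smooth_s openV])

lemma pd_eq_0:
  assumes "z \<in> V" "\<And>w. w \<in> V \<Longrightarrow> f w = (c::'b::real_normed_vector)"
  shows "pdx f z = 0" "pdy f z = 0"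
  using pd_cong[OF openV assms(1), of "\<lambda>_. c" f] assms(2) by auto

lemma snd_sx: "z \<in> V \<Longrightarrow> snd (sx z) = 0" "z \<in> V \<Longrightarrow> snd (sy z) = 0"
  using pd_eq_0[of z "\<lambda>z. snd (s z)" 1] bounded_linear.pd_compose[OF bounded_linear_snd diff_lift(1)]
  by (auto simp: snd_s)

lemma lor_s_sx: "z \<in> V \<Longrightarrow> lor (s z) (sx z) = 0" "z \<in> V \<Longrightarrow> lor (s z) (sy z) = 0"
  using pd_eq_0[of z "\<lambda>z. lor (s z) (s z)" 0] null pd_lor[OF diff_lift(1) diff_lift(1), of z]
  by (auto simp: lor_commute)

lemma lor_sx_self: "z \<in> V \<Longrightarrow> lor (sx z) (sx z) = rho z" "z \<in> V \<Longrightarrow> lor (sy z) (sy z) = rho z"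
  "z \<in> V \<Longrightarrow> lor (sx z) (sy z) = 0" "z \<in> V \<Longrightarrow> lor (sy z) (sx z) = 0"
  using conf lor_commute[of "sy z" "sx z"] by (auto simp: rho_def)

lemma lor_s_second:
  assumes z: "z \<in> V"
  shows "lor (s z) (pdx sx z) = - rho z" (is ?A) "lor (s z) (pdx sy z) = 0" (is ?B) "lor (s z) (pdy sy z) = - rho z" (is ?C)
    "lor (s z) (lap z) = - 2 * rho z" (is ?D)
proof -
  have 1: "lor (s z) (pdx sx z) + lor (sx z) (sx z) = 0" "lor (s z) (pdy sy z) + lor (sy z) (sy z) = 0"
      "lor (s z) (pdx sy z) + lor (sx z) (sy z) = 0"
    using pd_eq_0[of z "\<lambda>z. lor (s z) (sx z)" 0, OF z] pd_eq_0[of z "\<lambda>z. lor (s z) (sy z)" 0, OF z]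
      pd_lor[OF diff_lift(1) diff_lift(2), of z, OF z z] pd_lor[OF diff_lift(1) diff_lift(3), of z, OF z z]
    by (auto simp: lor_s_sx)
  then show ?A ?B ?C
    using z by (auto simp: lor_sx_self)
  then show ?D by (simp add: lap_def)
qed

text \<open>Differentiating the conformality relations expresses the tangential components of the second
  derivatives by the derivatives of \<open>rho\<close>.  They cancel in the Laplacian, which is therefore normal.\<close>

lemma lor_sx_second:
  assumes z: "z \<in> V"
  shows "lor (sx z) (pdx sx z) = pdx rho z / 2" (is ?A) "lor (sy z) (pdx sy z) = pdx rho z / 2" (is ?B)
    "lor (sx z) (pdx sy z) = pdy rho z / 2" (is ?C) "lor (sy z) (pdy sy z) = pdy rho z / 2" (is ?D)
    "lor (sy z) (pdx sx z) = - pdy rho z / 2" (is ?E) "lor (sx z) (pdy sy z) = - pdx rho z / 2" (is ?F)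
    "lor (sx z) (lap z) = 0" (is ?G) "lor (sy z) (lap z) = 0" (is ?H)
proof -
  have r1: "pdx rho z = 2 * lor (sx z) (pdx sx z)" "pdy rho z = 2 * lor (sx z) (pdx sy z)"
    using pd_lor[OF diff_lift(2) diff_lift(2), of z, OF z z] z unfolding rho_def[abs_def]
    by (auto simp: lor_commute sxy)
  have dr: "(\<lambda>z. lor (sy z) (sy z)) differentiable at z"
    using z by (intro differentiable_lor diff_lift)
  have "pdx (\<lambda>z. lor (sy z) (sy z)) z = pdx rho z" "pdy (\<lambda>z. lor (sy z) (sy z)) z = pdy rho z"
    by (rule pd_cong[OF openV z _ dr], simp add: lor_sx_self)+
  then have r2: "pdx rho z = 2 * lor (sy z) (pdx sy z)" "pdy rho z = 2 * lor (sy z) (pdy sy z)"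
    using pd_lor[OF diff_lift(3) diff_lift(3), of z, OF z z] by (auto simp: lor_commute)
  have r3: "lor (sx z) (pdx sy z) + lor (sy z) (pdx sx z) = 0" "lor (sx z) (pdy sy z) + lor (sy z) (pdx sy z) = 0"
    using pd_eq_0[of z "\<lambda>z. lor (sx z) (sy z)" 0, OF z] pd_lor[OF diff_lift(2) diff_lift(3), of z, OF z z] z
    by (auto simp: lor_sx_self lor_commute sxy)
  from r1 r2 r3 show ?A ?B ?C ?D ?E ?F
    by auto
  then show ?G ?H by (auto simp: lap_def)
qed

text \<open>\<open>normal\<close> is the oriented unit normal of the surface in \<open>S\<^sup>3\<close>, and \<open>lam\<close> is its mean curvature.
  The translate \<open>gauss\<close> of the normal along the lift is orthogonal to the Laplacian; it is the
  conformal Gauss map, or mean curvature sphere congruence.\<close>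

definition "normal z = ((1 / rho z) *\<^sub>R cross4 (fst (s z)) (fst (sx z)) (fst (sy z)), 0::real)"
definition "lam z = lor (normal z) (lap z) / (2 * rho z)"
definition "gauss z = normal z + lam z *\<^sub>R s z"

lemma smooth_gauss [smooth_intros]: "smooth_on normal V" "smooth_on lam V" "smooth_on gauss V"
proof -
  show 1: "smooth_on normal V" unfolding normal_def[abs_def]
    by (intro smooth_intros) (use rho_pos in force)
  show 2: "smooth_on lam V" unfolding lam_def[abs_def]
    by (intro smooth_intros 1) (use rho_pos in force)
  show "smooth_on gauss V" unfolding gauss_def[abs_def]
    by (intro smooth_intros 1 2)
qed

lemma inner_fst:
  assumes z: "z \<in> V"
  shows "fst (s z) \<bullet> fst (s z) = 1" "fst (s z) \<bullet> fst (sx z) = 0" "fst (s z) \<bullet> fst (sy z) = 0"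
    "fst (sx z) \<bullet> fst (sy z) = 0" "fst (sx z) \<bullet> fst (sx z) = rho z" "fst (sy z) \<bullet> fst (sy z) = rho z"
  using null[OF z] lor_s_sx[OF z] lor_sx_self[OF z] snd_s[OF z] snd_sx[OF z]
  by (auto simp: lor_def)

lemma lor_normal:
  assumes z: "z \<in> V"
  shows "lor (normal z) (s z) = 0" "lor (normal z) (sx z) = 0" "lor (normal z) (sy z) = 0"
    "lor (normal z) (normal z) = 1"
  using rho_pos[OF z] by (auto simp: normal_def lor_def cross4_orthogonal cross4_inner_self inner_fst[OF z])

lemma lor_gauss:
  assumes z: "z \<in> V"
  shows "lor (gauss z) (s z) = 0" "lor (gauss z) (sx z) = 0" "lor (gauss z) (sy z) = 0"
    "lor (gauss z) (gauss z) = 1" "lor (gauss z) (lap z) = 0" "lor (gauss z) (normal z) = 1"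
proof -
  have "lam z * (2 * rho z) = lor (normal z) (lap z)" using rho_pos[OF z] by (simp add: lam_def)
  then show "lor (gauss z) (lap z) = 0"
    using lor_s_second(4)[OF z] by (simp add: gauss_def)
qed (use z in \<open>auto simp: gauss_def lor_normal lor_s_sx null lor_commute[of "s z" "normal z"]\<close>)

lemma frame_products:
  assumes z: "z \<in> V"
  shows "lor (s z) (s z) = 0" "lor (s z) (sx z) = 0" "lor (s z) (sy z) = 0" "lor (s z) (lap z) = - 2 * rho z"
    "lor (s z) (gauss z) = 0" "lor (sx z) (s z) = 0" "lor (sy z) (s z) = 0" "lor (lap z) (s z) = - 2 * rho z"
    "lor (gauss z) (s z) = 0" "lor (sx z) (sx z) = rho z" "lor (sy z) (sy z) = rho z"
    "lor (sx z) (sy z) = 0" "lor (sy z) (sx z) = 0" "lor (sx z) (lap z) = 0" "lor (lap z) (sx z) = 0"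
    "lor (sy z) (lap z) = 0" "lor (lap z) (sy z) = 0" "lor (sx z) (gauss z) = 0" "lor (gauss z) (sx z) = 0"
    "lor (sy z) (gauss z) = 0" "lor (gauss z) (sy z) = 0" "lor (lap z) (gauss z) = 0" "lor (gauss z) (lap z) = 0"
    "lor (gauss z) (gauss z) = 1" "lor (gauss z) (normal z) = 1" "lor (normal z) (gauss z) = 1"
proof -
  note facts = null[OF z] lor_s_sx[OF z] lor_s_second(4)[OF z] lor_sx_self[OF z] lor_sx_second(7,8)[OF z] lor_gauss[OF z]
  show "lor (s z) (s z) = 0" "lor (s z) (sx z) = 0" "lor (s z) (sy z) = 0" "lor (s z) (lap z) = - 2 * rho z"
    "lor (gauss z) (s z) = 0" "lor (sx z) (sx z) = rho z" "lor (sy z) (sy z) = rho z"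
    "lor (sx z) (sy z) = 0" "lor (sy z) (sx z) = 0" "lor (sx z) (lap z) = 0" "lor (sy z) (lap z) = 0"
    "lor (gauss z) (sx z) = 0" "lor (gauss z) (sy z) = 0" "lor (gauss z) (lap z) = 0"
    "lor (gauss z) (gauss z) = 1" "lor (gauss z) (normal z) = 1"
    by (rule facts)+
  show "lor (s z) (gauss z) = 0" "lor (sx z) (s z) = 0" "lor (sy z) (s z) = 0" "lor (lap z) (s z) = - 2 * rho z"
    "lor (lap z) (sx z) = 0" "lor (lap z) (sy z) = 0" "lor (sx z) (gauss z) = 0"
    "lor (sy z) (gauss z) = 0" "lor (lap z) (gauss z) = 0" "lor (normal z) (gauss z) = 1"
    by (subst lor_commute, rule facts)+
qed

text \<open>The spatial parts of \<open>s\<close>, \<open>s\<^sub>x\<close>, \<open>s\<^sub>y\<close> and the normal are an orthogonal basis of four-space, so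
  these conditions determine the spatial part of \<open>X\<close> from its time component.\<close>

lemma perp_tangent_normal:
  assumes z: "z \<in> V" and X: "lor (s z) X = 0" "lor (sx z) X = 0" "lor (sy z) X = 0" "lor (normal z) X = 0"
  shows "X = snd X *\<^sub>R s z"
proof -
  let ?f = "fst (s z)" and ?x = "fst (sx z)" and ?y = "fst (sy z)" and ?n = "fst (normal z)"
  have n: "?n \<bullet> ?f = 0" "?n \<bullet> ?x = 0" "?n \<bullet> ?y = 0" "?n \<bullet> ?n = 1"
    using lor_normal[OF z] by (auto simp: lor_def normal_def)
  define y where "y = fst X - snd X *\<^sub>R ?f"
  have "?f \<noteq> 0" "?x \<noteq> 0" "?y \<noteq> 0" "?n \<noteq> 0"
    using inner_fst[OF z] rho_pos[OF z] n by auto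
  moreover have n': "?f \<bullet> ?n = 0" "?x \<bullet> ?n = 0" "?y \<bullet> ?n = 0"
    using n inner_commute[of ?f ?n] inner_commute[of ?x ?n] inner_commute[of ?y ?n] by argo+
  moreover have n0: "snd (normal z) = 0" by (simp add: normal_def)
  have "?f \<bullet> fst X = snd X" "?x \<bullet> fst X = 0" "?y \<bullet> fst X = 0" "?n \<bullet> fst X = 0"
    using n0 X snd_s[OF z] snd_sx[OF z] by (simp_all add: lor_def)
  then have "?f \<bullet> y = 0" "?x \<bullet> y = 0" "?y \<bullet> y = 0" "?n \<bullet> y = 0"
    using inner_fst[OF z] n n' inner_commute[of ?x ?f] inner_commute[of ?y ?f]
    by (simp_all add: y_def inner_diff_right)
  then have "y \<bullet> ?f = 0" "y \<bullet> ?x = 0" "y \<bullet> ?y = 0" "y \<bullet> ?n = 0"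
    using inner_commute[of y ?f] inner_commute[of y ?x] inner_commute[of y ?y] inner_commute[of y ?n] by argo+
  ultimately have "y = 0"
    using inner_fst[OF z] orthogonal_complement_trivial_4[of ?f ?x ?y ?n y] by blast
  then show ?thesis using snd_s[OF z] by (simp add: y_def prod_eq_iff)
qed

lemma perp_frame:
  assumes z: "z \<in> V" and X: "lor (s z) X = 0" "lor (sx z) X = 0" "lor (sy z) X = 0" "lor (gauss z) X = 0"
  shows "X = snd X *\<^sub>R s z"
  using X by (intro perp_tangent_normal[OF z]) (auto simp: gauss_def)

text \<open>After subtracting its component along the Gauss map, \<open>X\<close> is a multiple of the lift, and the product
  of the lift with the Laplacian does not vanish.\<close>

lemma perp_frame_lap:
  assumes z: "z \<in> V" and X: "lor (s z) X = 0" "lor (sx z) X = 0" "lor (sy z) X = 0" "lor (lap z) X = 0"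
  shows "X = lor (gauss z) X *\<^sub>R gauss z"
proof -
  define Y where "Y = X - lor (gauss z) X *\<^sub>R gauss z"
  have Y: "Y = snd Y *\<^sub>R s z"
    by (rule perp_frame[OF z]) (simp_all add: X frame_products[OF z] Y_def)
  have "lor (lap z) Y = 0" by (simp add: X frame_products[OF z] Y_def)
  then have "snd Y * lor (lap z) (s z) = 0" using Y by (metis lor_simps(8))
  then have "snd Y = 0" using frame_products[OF z] rho_pos[OF z] by simp
  then have "Y = 0" using Y by simp
  then show ?thesis by (simp add: Y_def)
qed

text \<open>\<open>a\<close>, \<open>b\<close>, \<open>c\<close>, \<open>d\<close> are the prescribed products with \<open>s\<close>, \<open>s\<^sub>x\<close>, \<open>s\<^sub>y\<close>, \<open>\<Delta>s\<close>, and \<open>g\<close> is the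
  component along the conformal Gauss map.\<close>

definition frame_vec :: "(complex \<Rightarrow> real) \<Rightarrow> (complex \<Rightarrow> real) \<Rightarrow> (complex \<Rightarrow> real) \<Rightarrow> (complex \<Rightarrow> real) \<Rightarrow>
    (complex \<Rightarrow> real) \<Rightarrow> complex \<Rightarrow> R41" where
  "frame_vec a b c d g z =
     (- (lor (lap z) (lap z) * a z / (2 * rho z) + d z) / (2 * rho z)) *\<^sub>R s z
     - (a z / (2 * rho z)) *\<^sub>R lap z + (b z / rho z) *\<^sub>R sx z + (c z / rho z) *\<^sub>R sy z + g z *\<^sub>R gauss z"

lemma lor_frame_vec:
  assumes z: "z \<in> V"
  shows "lor (s z) (frame_vec a b c d g z) = a z" "lor (sx z) (frame_vec a b c d g z) = b z"
    "lor (sy z) (frame_vec a b c d g z) = c z" "lor (lap z) (frame_vec a b c d g z) = d z"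
    "lor (gauss z) (frame_vec a b c d g z) = g z"
  using rho_pos[OF z] by (auto simp: frame_vec_def frame_products[OF z] field_simps)

lemma smooth_frame_vec [smooth_intros]:
  assumes "smooth_on a V" "smooth_on b V" "smooth_on c V" "smooth_on d V" "smooth_on g V"
  shows "smooth_on (frame_vec a b c d g) V"
  unfolding frame_vec_def[abs_def] by (intro smooth_intros assms) (use rho_pos in force)+

end

section \<open>Isothermic patches\<close>

text \<open>In a chart the form \<open>\<eta>\<close> is given by \<open>\<eta>(1) = s \<and> t1\<close> and \<open>\<eta>(\<i>) = s \<and> t2\<close>, normalised so that
  \<open>t1\<close> and \<open>t2\<close> have no time component.  Evaluating \<open>d\<eta> = 0\<close> on the time direction gives \<open>closed\<close>, and
  what then remains of it is \<open>wedge_closed\<close>.\<close>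

locale isothermic_patch = null_lift +
  fixes t1 t2 :: "complex \<Rightarrow> R41"
  assumes smooth_t: "smooth_on t1 V" "smooth_on t2 V"
    and snd_t: "\<And>z. z \<in> V \<Longrightarrow> snd (t1 z) = 0" "\<And>z. z \<in> V \<Longrightarrow> snd (t2 z) = 0"
    and t_perp_s: "\<And>z. z \<in> V \<Longrightarrow> lor (t1 z) (s z) = 0" "\<And>z. z \<in> V \<Longrightarrow> lor (t2 z) (s z) = 0"
    and closed: "\<And>z. z \<in> V \<Longrightarrow> pdx t2 z = pdy t1 z"
    and wedge_closed: "\<And>z w. z \<in> V \<Longrightarrow>
        lor (sx z) w *\<^sub>R t2 z - lor (t2 z) w *\<^sub>R sx z = lor (sy z) w *\<^sub>R t1 z - lor (t1 z) w *\<^sub>R sy z"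
begin

definition "qre z = lor (t1 z) (sx z)"
definition "qim z = lor (t1 z) (sy z)"

lemma smooth_q [smooth_intros]: "smooth_on t1 V" "smooth_on t2 V" "smooth_on qre V" "smooth_on qim V"
  unfolding qre_def[abs_def] qim_def[abs_def] by (intro smooth_t smooth_intros)+

lemmas diff_t = smooth_q[THEN diffV]

text \<open>Differentiating \<open>(t1, s) = 0 = (t2, s)\<close> and comparing by \<open>closed\<close> gives symmetry; \<open>wedge_closed\<close>,
  evaluated on \<open>s\<^sub>x\<close> and paired with \<open>s\<^sub>y\<close>, gives that the trace vanishes.\<close>

lemma lor_t_tangent:
  assumes z: "z \<in> V"
  shows "lor (t1 z) (sx z) = qre z" "lor (t1 z) (sy z) = qim z"
    "lor (t2 z) (sx z) = qim z" "lor (t2 z) (sy z) = - qre z"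
proof -
  have "lor (pdy t1 z) (s z) + lor (t1 z) (sy z) = 0" "lor (pdx t2 z) (s z) + lor (t2 z) (sx z) = 0"
    using pd_eq_0[of z "\<lambda>z. lor (t1 z) (s z)" 0, OF z] pd_lor[OF diff_t(1) diff_lift(1), of z, OF z z]
      pd_eq_0[of z "\<lambda>z. lor (t2 z) (s z)" 0, OF z] pd_lor[OF diff_t(2) diff_lift(1), of z, OF z z]
    by (simp_all add: t_perp_s)
  then show "lor (t2 z) (sx z) = qim z" using closed[OF z] by (simp add: qim_def)
  have "lor (lor (sx z) (sx z) *\<^sub>R t2 z - lor (t2 z) (sx z) *\<^sub>R sx z) (sy z) =
      lor (lor (sy z) (sx z) *\<^sub>R t1 z - lor (t1 z) (sx z) *\<^sub>R sy z) (sy z)"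
    by (simp only: wedge_closed[OF z])
  then have "rho z * lor (t2 z) (sy z) = rho z * (- qre z)"
    by (simp add: frame_products[OF z] qre_def)
  moreover have "rho z \<noteq> 0" using rho_pos[OF z] by simp
  ultimately show "lor (t2 z) (sy z) = - qre z" using mult_left_cancel by blast
qed (auto simp: qre_def qim_def)

lemma t_eq:
  assumes z: "z \<in> V"
  shows "t1 z = (qre z / rho z) *\<^sub>R sx z + (qim z / rho z) *\<^sub>R sy z" (is ?A)
    "t2 z = (qim z / rho z) *\<^sub>R sx z - (qre z / rho z) *\<^sub>R sy z" (is ?B)
proof -
  have "rho z *\<^sub>R t2 z = qim z *\<^sub>R sx z - qre z *\<^sub>R sy z"
    using wedge_closed[OF z, of "sx z"] by (simp add: frame_products[OF z] lor_t_tangent[OF z] algebra_simps)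
  then have "(1 / rho z) *\<^sub>R rho z *\<^sub>R t2 z = (1 / rho z) *\<^sub>R (qim z *\<^sub>R sx z - qre z *\<^sub>R sy z)"
    by simp
  then show ?B
    using rho_pos[OF z] by (simp add: scaleR_diff_right)
  have "rho z *\<^sub>R t1 z = qre z *\<^sub>R sx z + qim z *\<^sub>R sy z"
    using wedge_closed[OF z, of "sy z"] by (simp add: frame_products[OF z] lor_t_tangent[OF z] algebra_simps)
  then have "(1 / rho z) *\<^sub>R rho z *\<^sub>R t1 z = (1 / rho z) *\<^sub>R (qre z *\<^sub>R sx z + qim z *\<^sub>R sy z)"
    by simp
  then show ?A
    using rho_pos[OF z] by (simp add: scaleR_add_right)
qed

lemma lor_t:
  assumes z: "z \<in> V"
  shows "lor (t1 z) w = (qre z * lor (sx z) w + qim z * lor (sy z) w) / rho z"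
    "lor (t2 z) w = (qim z * lor (sx z) w - qre z * lor (sy z) w) / rho z"
  by (subst t_eq[OF z], simp add: add_divide_distrib diff_divide_distrib)+

text \<open>Each equation compares a derivative computed through \<open>t1\<close> with one computed through \<open>t2\<close>.  The derivatives of \<open>t1\<close> and \<open>t2\<close> match by \<open>closed\<close>, and the second derivatives of the lift cancel
  because their tangential components are derivatives of the conformal factor.\<close>

lemma q_cauchy_riemann:
  assumes z: "z \<in> V"
  shows "pdx qre z = - pdy qim z" "pdy qre z = pdx qim z"
proof -
  have U1: "pdx qre z = lor (t1 z) (pdx sx z) + lor (pdx t1 z) (sx z)"
      "pdy qre z = lor (t1 z) (pdx sy z) + lor (pdy t1 z) (sx z)"
    unfolding qre_def[abs_def] using pd_lor[OF diff_t(1) diff_lift(2), of z, OF z z] by (simp_all add: sxy z)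
  have W1: "pdx qim z = lor (t1 z) (pdx sy z) + lor (pdx t1 z) (sy z)"
      "pdy qim z = lor (t1 z) (pdy sy z) + lor (pdy t1 z) (sy z)"
    unfolding qim_def[abs_def] using pd_lor[OF diff_t(1) diff_lift(3), of z, OF z z] by simp_all
  note d2 = differentiable_lor[OF diff_t(2)[OF z] diff_lift(2)[OF z]]
    differentiable_lor[OF diff_t(2)[OF z] diff_lift(3)[OF z]]
  have "pdx (\<lambda>z. lor (t2 z) (sx z)) z = pdx qim z"
    by (rule pd_cong[OF openV z _ d2(1)]) (simp add: lor_t_tangent)
  then have W2: "pdx qim z = lor (t2 z) (pdx sx z) + lor (pdx t2 z) (sx z)"
    using pd_lor[OF diff_t(2) diff_lift(2), of z, OF z z] by simp
  have "pdx (\<lambda>z. lor (t2 z) (sy z)) z = pdx (\<lambda>z. - qre z) z"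
    by (rule pd_cong[OF openV z _ d2(2)]) (simp add: lor_t_tangent)
  then have U2: "- pdx qre z = lor (t2 z) (pdx sy z) + lor (pdx t2 z) (sy z)"
    using pd_lor[OF diff_t(2) diff_lift(3), of z, OF z z] pd_minus[OF diff_t(3)[OF z]] by simp
  have r: "rho z \<noteq> 0" using rho_pos[OF z] by simp
  have "pdy qre z - pdx qim z = lor (t1 z) (pdx sy z) - lor (t2 z) (pdx sx z)"
    using U1 W2 closed[OF z] by simp
  also have "\<dots> = 0" using r by (simp add: lor_t[OF z] lor_sx_second[OF z] field_simps)
  finally show "pdy qre z = pdx qim z" by simp
  have "pdy qim z + pdx qre z = lor (t1 z) (pdy sy z) - lor (t2 z) (pdx sy z)"
    using W1 U2 closed[OF z] by simp
  also have "\<dots> = 0" using r by (simp add: lor_t[OF z] lor_sx_second[OF z] field_simps)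
  finally show "pdx qre z = - pdy qim z" by simp
qed

text \<open>The coefficient of the holomorphic quadratic differential whose real part is the pairing of
  \<open>(t1, t2)\<close> with \<open>ds\<close>.\<close>

definition "q z = Complex (qre z) (- qim z)"

lemma q_holomorphic: "q holomorphic_on V"
proof (rule holomorphic_onI)
  fix z assume z: "z \<in> V"
  have "((\<lambda>z. complex_of_real (qre z) - \<i> * of_real (qim z)) has_derivative
      (\<lambda>v. of_real (Re v *\<^sub>R pdx qre z + Im v *\<^sub>R pdy qre z)
        - \<i> * of_real (Re v *\<^sub>R pdx qim z + Im v *\<^sub>R pdy qim z))) (at z)"
    by (intro derivative_intros has_derivative_pd diff_t z)
  also have "(\<lambda>z. complex_of_real (qre z) - \<i> * of_real (qim z)) = q"
    by (auto simp: q_def complex_eq_iff)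
  also have "(\<lambda>v. of_real (Re v *\<^sub>R pdx qre z + Im v *\<^sub>R pdy qre z)
        - \<i> * of_real (Re v *\<^sub>R pdx qim z + Im v *\<^sub>R pdy qim z)) =
      (\<lambda>v. Complex (pdx qre z) (- pdx qim z) * v)"
    using q_cauchy_riemann[OF z] by (auto simp: complex_eq_iff algebra_simps)
  finally have "(q has_field_derivative Complex (pdx qre z) (- pdx qim z)) (at z)"
    by (simp add: has_field_derivative_def)
  then show "q field_differentiable at z within V"
    using field_differentiable_at_within field_differentiable_def by blast
qed

text \<open>The action of \<open>\<eta>\<close> along the two coordinate directions.\<close>

definition "E1 z w = lor (s z) w *\<^sub>R t1 z - lor (t1 z) w *\<^sub>R s z"
definition "E2 z w = lor (s z) w *\<^sub>R t2 z - lor (t2 z) w *\<^sub>R s z"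

lemma E_skew: "lor (E1 z v) w = - lor (E1 z w) v" "lor (E2 z v) w = - lor (E2 z w) v"
  by (simp_all add: E1_def E2_def lor_commute[of w "t1 z"] lor_commute[of w "s z"])

lemma E_diff: "E1 z (v - w) = E1 z v - E1 z w" "E2 z (v - w) = E2 z v - E2 z w"
  by (simp_all add: E1_def E2_def algebra_simps)

text \<open>A formal conserved quantity over \<open>T\<close>, in coordinates and with \<open>P k\<close> the coefficient of
  \<open>t\<close> to the power \<open>- k\<close>, whose norm is the series \<open>c\<close>.\<close>

definition conserved :: "complex set \<Rightarrow> (nat \<Rightarrow> real) \<Rightarrow> (nat \<Rightarrow> complex \<Rightarrow> R41) \<Rightarrow> bool" where
  "conserved T c P \<longleftrightarrow> (\<forall>z\<in>T. E1 z (P 0 z) = 0 \<and> E2 z (P 0 z) = 0 \<and>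
     (\<forall>k. P k differentiable (at z) \<and> pdx (P k) z = - E1 z (P (Suc k) z) \<and>
        pdy (P k) z = - E2 z (P (Suc k) z) \<and> (\<Sum>i\<le>k. lor (P i z) (P (k - i) z)) = c k))"

lemma conserved_mono: "conserved T c P \<Longrightarrow> T' \<subseteq> T \<Longrightarrow> conserved T' c P"
  unfolding conserved_def by blast

lemma conserved_minus:
  assumes "conserved T c P"
  shows "conserved T c (\<lambda>k z. - P k z)"
proof -
  have E: "E1 z (- v) = - E1 z v" "E2 z (- v) = - E2 z v" for z v
    by (simp_all add: E1_def E2_def)
  show ?thesis using assms unfolding conserved_def by (auto simp: E pd_minus intro!: differentiable_minus)
qed

end

section \<open>Conserved quantities away from zeros of the quadratic differential\<close>

locale regular_patch = isothermic_patch +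
  assumes q_nz: "\<And>z. z \<in> V \<Longrightarrow> q z \<noteq> 0"
begin

definition "qabs z = (qre z)\<^sup>2 + (qim z)\<^sup>2"

lemma qabs_pos: "z \<in> V \<Longrightarrow> qabs z > 0"
  using q_nz[of z] by (auto simp: qabs_def q_def complex_eq_iff sum_power2_gt_zero_iff)

lemma q_solve:
  assumes z: "z \<in> V" and "qre z * a + qim z * b = 0" "qim z * a - qre z * b = 0"
  shows "a = 0" "b = 0"
proof -
  have "qabs z * a = qre z * (qre z * a + qim z * b) + qim z * (qim z * a - qre z * b)"
    "qabs z * b = qim z * (qre z * a + qim z * b) - qre z * (qim z * a - qre z * b)"
    by (auto simp: qabs_def power2_eq_square algebra_simps)
  then show "a = 0" "b = 0" using qabs_pos[OF z] assms by auto
qed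

text \<open>The lift has time component one and \<open>t1\<close>, \<open>t2\<close> have none, so the time component of \<open>\<eta> w\<close> is, up
  to sign, the product of \<open>w\<close> with \<open>t1\<close> or \<open>t2\<close>.  These two vectors span the tangent plane as \<open>q\<close> does not vanish.\<close>

lemma E_kernel:
  assumes z: "z \<in> V" and E: "E1 z w = 0" "E2 z w = 0"
  shows "lor (s z) w = 0" (is ?A) "lor (sx z) w = 0" (is ?B) "lor (sy z) w = 0" (is ?C)
proof -
  have "snd (E1 z w) = 0" "snd (E2 z w) = 0" using E by auto
  then have t: "lor (t1 z) w = 0" "lor (t2 z) w = 0"
    by (simp_all add: E1_def E2_def snd_t z snd_s)
  then have "qre z * lor (sx z) w + qim z * lor (sy z) w = 0" "qim z * lor (sx z) w - qre z * lor (sy z) w = 0"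
    using rho_pos[OF z] by (auto simp: lor_t[OF z])
  then show ?B ?C using q_solve[OF z] by blast+
  have "lor (s z) w * qre z = lor (E1 z w) (sx z)" "lor (s z) w * qim z = lor (E1 z w) (sy z)"
    by (simp_all add: E1_def lor_t_tangent[OF z] frame_products[OF z])
  then have "lor (s z) w * qre z = 0" "lor (s z) w * qim z = 0" using E by auto
  then show ?A using qabs_pos[OF z] by (auto simp: qabs_def)
qed

text \<open>The kernel of \<open>\<eta>\<close> is spanned by the lift and a normal; a section of the kernel whose
  derivative lies in the image of \<open>\<eta>\<close> is also orthogonal to \<open>\<Delta>s\<close>, because \<open>\<eta>\<close> is trace-free, and
  so is a multiple of the conformal Gauss map.\<close>

lemma kernel_section:
  assumes T: "open T" "T \<subseteq> V" "z \<in> T"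
    and D: "D differentiable (at z)" "\<And>w. w \<in> T \<Longrightarrow> E1 w (D w) = 0" "\<And>w. w \<in> T \<Longrightarrow> E2 w (D w) = 0"
    and D': "pdx D z = - E1 z D'" "pdy D z = - E2 z D'"
  shows "D z = lor (gauss z) (D z) *\<^sub>R gauss z"
proof -
  have z: "z \<in> V" using T by auto
  have k: "lor (s w) (D w) = 0" "lor (sx w) (D w) = 0" "lor (sy w) (D w) = 0" if "w \<in> T" for w
    using E_kernel[of w "D w"] D T that by auto
  have "pdx (\<lambda>w. lor (sx w) (D w)) z = pdx (\<lambda>w. 0::real) z"
    by (rule pd_cong[OF T(1,3)]) (use k D z in \<open>auto intro!: differentiable_lor diff_lift\<close>)
  then have 1: "lor (sx z) (pdx D z) + lor (pdx sx z) (D z) = 0"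
    using pd_lor[OF diff_lift(2)[OF z] D(1)] by simp
  have "pdy (\<lambda>w. lor (sy w) (D w)) z = pdy (\<lambda>w. 0::real) z"
    by (rule pd_cong[OF T(1,3)]) (use k D z in \<open>auto intro!: differentiable_lor diff_lift\<close>)
  then have 2: "lor (sy z) (pdy D z) + lor (pdy sy z) (D z) = 0"
    using pd_lor[OF diff_lift(3)[OF z] D(1)] by simp
  have "lor (sx z) (pdx D z) + lor (sy z) (pdy D z) = 0"
    unfolding D' by (simp add: E1_def E2_def frame_products[OF z] lor_commute[of "sx z" "t1 z"]
      lor_commute[of "sy z" "t2 z"] lor_t_tangent[OF z])
  then have "lor (lap z) (D z) = 0" using 1 2 by (simp add: lap_def)
  then show ?thesis using k[OF T(3)] perp_frame_lap[OF z] by blast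
qed

text \<open>The leading coefficient lies in the kernel of \<open>\<eta>\<close> and its derivative in the image, so it is a
  multiple of the conformal Gauss map.\<close>

lemma conserved_leading:
  assumes T: "open T" "T \<subseteq> V" "z \<in> T" and P: "conserved T c P"
  shows "P 0 z = lor (P 0 z) (normal z) *\<^sub>R gauss z" "(lor (P 0 z) (normal z))\<^sup>2 = c 0"
proof -
  have z: "z \<in> V" using T by auto
  note cP = P[unfolded conserved_def, rule_format]
  define b where "b = lor (gauss z) (P 0 z)"
  have P0: "P 0 z = b *\<^sub>R gauss z" unfolding b_def
    by (rule kernel_section[OF T, where D' = "P (Suc 0) z"]) (use cP T in auto)
  then have b: "lor (P 0 z) (normal z) = b" by (simp add: frame_products[OF z])
  with P0 show "P 0 z = lor (P 0 z) (normal z) *\<^sub>R gauss z" by simp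
  have "(\<Sum>i\<le>0. lor (P i z) (P (0 - i) z)) = c 0" using cP[OF T(3)] by blast
  then show "(lor (P 0 z) (normal z))\<^sup>2 = c 0"
    by (simp add: b) (simp add: P0 frame_products[OF z] power2_eq_square)
qed

text \<open>If two series agree below order \<open>k\<close>, the difference of their coefficients of order \<open>k\<close> lies in the
  kernel of \<open>\<eta>\<close> with derivative in the image, so it is a multiple of the conformal Gauss map.  It is
  orthogonal to the leading coefficient because the norms agree at order \<open>k\<close>, hence it vanishes.\<close>

lemma conserved_unique:
  assumes T: "open T" "T \<subseteq> V" and P: "conserved T c P" and Q: "conserved T c Q"
    and sgn: "\<And>z. z \<in> T \<Longrightarrow> lor (P 0 z) (normal z) > 0" "\<And>z. z \<in> T \<Longrightarrow> lor (Q 0 z) (normal z) > 0"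
    and z: "z \<in> T"
  shows "P k z = Q k z"
proof -
  note c = P[unfolded conserved_def, rule_format] Q[unfolded conserved_def, rule_format]
  have lead: "R 0 w = sqrt (c 0) *\<^sub>R gauss w"
    if R: "conserved T c R" "lor (R 0 w) (normal w) > 0" and w: "w \<in> T" for R w
  proof -
    note l = conserved_leading[OF T w R(1)]
    have "lor (R 0 w) (normal w) = sqrt (c 0)" using l(2) R(2) by (simp add: real_sqrt_unique)
    then show ?thesis using l(1) by simp
  qed
  have c0: "sqrt (c 0) \<noteq> 0" using lead[OF P sgn(1)[OF z] z] sgn(1)[OF z] by auto
  show ?thesis using z
  proof (induction k arbitrary: z rule: less_induct)
    case (less k)
    show ?case
    proof (cases k)
      case 0
      then show ?thesis using lead[OF P sgn(1)] lead[OF Q sgn(2)] less.prems by metis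
    next
      case (Suc m)
      define D where "D = (\<lambda>z. P k z - Q k z)"
      have eq: "pdx (P m) w = pdx (Q m) w" "pdy (P m) w = pdy (Q m) w" if w: "w \<in> T" for w
        using pd_cong[OF T(1) w, of "P m" "Q m"] less.IH[of m] Suc c(1)[OF w] by auto
      have E: "E1 w (D w) = 0" "E2 w (D w) = 0" if w: "w \<in> T" for w
        using eq[OF w] c(1)[OF w] c(2)[OF w] Suc by (simp_all add: D_def E_diff)
      have d: "P k differentiable at z" "Q k differentiable at z"
        using c(1)[OF less.prems] c(2)[OF less.prems] by auto
      have "D z = lor (gauss z) (D z) *\<^sub>R gauss z"
      proof (rule kernel_section[OF T less.prems _ E, where D' = "P (Suc k) z - Q (Suc k) z"])
        show "D differentiable at z" unfolding D_def using d by (intro differentiable_diff)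
        show "pdx D z = - E1 z (P (Suc k) z - Q (Suc k) z)" "pdy D z = - E2 z (P (Suc k) z - Q (Suc k) z)"
          unfolding D_def using pd_diff[OF d] c(1)[OF less.prems] c(2)[OF less.prems]
          by (simp_all add: E_diff)
      qed
      moreover have "lor (gauss z) (D z) = 0"
      proof -
        have mid: "(\<Sum>i\<in>{1..m}. lor (P i z) (P (k - i) z)) = (\<Sum>i\<in>{1..m}. lor (Q i z) (Q (k - i) z))"
          using less.IH less.prems Suc by (intro sum.cong) auto
        have split: "(\<Sum>i\<le>k. lor (R i z) (R (k - i) z)) =
            2 * lor (R 0 z) (R k z) + (\<Sum>i\<in>{1..m}. lor (R i z) (R (k - i) z))" for R :: "nat \<Rightarrow> complex \<Rightarrow> R41"
        proof -
          have "{..k} = insert 0 (insert k {1..m})" using Suc by auto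
          then show ?thesis using Suc by (simp add: lor_commute[of "R (Suc m) z" "R 0 z"])
        qed
        have "lor (P 0 z) (P k z) = lor (Q 0 z) (Q k z)"
          using c(1)[OF less.prems] c(2)[OF less.prems] split[of P] split[of Q] mid by auto
        moreover have "P 0 z = sqrt (c 0) *\<^sub>R gauss z" "Q 0 z = sqrt (c 0) *\<^sub>R gauss z"
          using lead[OF P sgn(1)] lead[OF Q sgn(2)] less.prems by blast+
        ultimately show ?thesis using c0 by (simp add: D_def)
      qed
      ultimately have "D z = 0" by simp
      then show ?thesis by (simp add: D_def)
    qed
  qed
qed

subsection \<open>Existence\<close>

text \<open>A section \<open>P\<close> is solvable when \<open>dP = - \<eta> R\<close> can be solved for \<open>R\<close> pointwise; then \<open>(s, R)\<close> is
  \<open>coef P\<close>.\<close>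

definition "coef P z = - (qre z * lor (pdx P z) (sx z) + qim z * lor (pdx P z) (sy z)) / qabs z"

definition "solvable P \<longleftrightarrow> (\<forall>z\<in>V. pdx P z = snd (pdx P z) *\<^sub>R s z - coef P z *\<^sub>R t1 z \<and>
  pdy P z = snd (pdy P z) *\<^sub>R s z - coef P z *\<^sub>R t2 z)"

lemma smooth_coef [smooth_intros]: "smooth_on P V \<Longrightarrow> smooth_on (coef P) V"
  unfolding coef_def[abs_def] qabs_def
  by (intro smooth_intros openV) (use qabs_pos in \<open>force simp: qabs_def\<close>)+

text \<open>Equality of the mixed partials of \<open>P\<close> determines the \<open>s\<close>-components of \<open>dP\<close>.\<close>

lemma solvable_integrability:
  assumes P: "smooth_on P V" "solvable P" and z: "z \<in> V"
  shows "snd (pdx P z) = (qre z * pdx (coef P) z + qim z * pdy (coef P) z) / rho z"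
    "snd (pdy P z) = (qim z * pdx (coef P) z - qre z * pdy (coef P) z) / rho z"
proof -
  let ?a = "coef P"
  have sm: "smooth_on ?a V" "smooth_on (pdx P) V" "smooth_on (pdy P) V"
    using P openV by (auto intro!: smooth_intros)
  have d: "?a differentiable at z" "pdx P differentiable at z" "pdy P differentiable at z"
    using sm z by (auto intro: diffV)
  have d2: "(\<lambda>z. snd (pdx P z)) differentiable at z" "(\<lambda>z. snd (pdy P z)) differentiable at z"
    using sm z by (auto intro!: diffV smooth_intros)
  have ds: "(\<lambda>z. ?a z *\<^sub>R t1 z) differentiable at z" "(\<lambda>z. ?a z *\<^sub>R t2 z) differentiable at z"
    "(\<lambda>z. snd (pdx P z) *\<^sub>R s z) differentiable at z" "(\<lambda>z. snd (pdy P z) *\<^sub>R s z) differentiable at z"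
    using sm z by (auto intro!: diffV smooth_intros)
  have x: "pdy (pdx P) z = pdy (\<lambda>z. snd (pdx P z) *\<^sub>R s z - ?a z *\<^sub>R t1 z) z"
    by (rule pd_cong[OF openV z _ d(2)]) (use P(2) in \<open>auto simp: solvable_def\<close>)
  have y: "pdx (pdy P) z = pdx (\<lambda>z. snd (pdy P z) *\<^sub>R s z - ?a z *\<^sub>R t2 z) z"
    by (rule pd_cong[OF openV z _ d(3)]) (use P(2) in \<open>auto simp: solvable_def\<close>)
  note sc = bounded_bilinear.pd_prod[OF bounded_bilinear_scaleR]
  have mp: "pdy (pdx P) z = pdx (pdy P) z" by (rule mixed_partials[OF P(1) openV z])
  then have "snd (pdy (pdx P) z) = snd (pdx (pdy P) z)" by simp
  then have "pdy (\<lambda>z. snd (pdx P z)) z = pdx (\<lambda>z. snd (pdy P z)) z"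
    using bounded_linear.pd_compose[OF bounded_linear_snd d(2)]
      bounded_linear.pd_compose[OF bounded_linear_snd d(3)] by simp
  then have eq: "snd (pdx P z) *\<^sub>R sy z - pdy ?a z *\<^sub>R t1 z = snd (pdy P z) *\<^sub>R sx z - pdx ?a z *\<^sub>R t2 z"
    using mp unfolding x y pd_diff[OF ds(3,1)] pd_diff[OF ds(4,2)] sc[OF d2(1) diff_lift(1)[OF z]]
      sc[OF d2(2) diff_lift(1)[OF z]] sc[OF d(1) diff_t(1)[OF z]] sc[OF d(1) diff_t(2)[OF z]]
    by (simp add: closed[OF z])
  have r: "rho z \<noteq> 0" using rho_pos[OF z] by simp
  have "lor (snd (pdx P z) *\<^sub>R sy z - pdy ?a z *\<^sub>R t1 z) (sy z) = lor (snd (pdy P z) *\<^sub>R sx z - pdx ?a z *\<^sub>R t2 z) (sy z)"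
    "lor (snd (pdx P z) *\<^sub>R sy z - pdy ?a z *\<^sub>R t1 z) (sx z) = lor (snd (pdy P z) *\<^sub>R sx z - pdx ?a z *\<^sub>R t2 z) (sx z)"
    by (simp_all only: eq)
  then have "snd (pdx P z) * rho z = qre z * pdx ?a z + qim z * pdy ?a z"
    "snd (pdy P z) * rho z = qim z * pdx ?a z - qre z * pdy ?a z"
    by (simp_all add: frame_products[OF z] lor_t_tangent[OF z] algebra_simps)
  then show "snd (pdx P z) = (qre z * pdx ?a z + qim z * pdy ?a z) / rho z"
    "snd (pdy P z) = (qim z * pdx ?a z - qre z * pdy ?a z) / rho z"
    using r by (simp_all add: eq_divide_eq)
qed

text \<open>Solving \<open>dP = - \<eta> R\<close> prescribes the products of \<open>R\<close> with the lift and its derivative.\<close>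

lemma solvable_next:
  assumes P: "smooth_on P V" "solvable P" and z: "z \<in> V"
    and R: "lor (s z) R = coef P z" "lor (sx z) R = pdx (coef P) z" "lor (sy z) R = pdy (coef P) z"
  shows "pdx P z = - E1 z R" (is ?A) "pdy P z = - E2 z R" (is ?B) "lor (t1 z) R = snd (pdx P z)" "lor (t2 z) R = snd (pdy P z)"
proof -
  show t: "lor (t1 z) R = snd (pdx P z)" "lor (t2 z) R = snd (pdy P z)"
    by (simp_all add: lor_t[OF z] R solvable_integrability[OF P z])
  show ?A ?B
    using P(2) z by (simp_all add: solvable_def E1_def E2_def t R)
qed

text \<open>The form \<open>(dR, ds)\<close> is symmetric because mixed partials agree, and trace-free by the choice of
  \<open>(\<Delta>s, R)\<close>.  The equation between \<open>(t1, R)\<close> and \<open>(t2, R)\<close>, which will be the equality of mixed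
  partials for the time component of the previous coefficient, makes it proportional to the quadratic
  differential; this is what the image of \<open>\<eta>\<close> requires.\<close>

lemma solvableI:
  assumes R: "smooth_on R V" and a: "smooth_on a V"
    and "\<And>z. z \<in> V \<Longrightarrow> lor (s z) (R z) = a z"
    and "\<And>z. z \<in> V \<Longrightarrow> lor (sx z) (R z) = pdx a z" "\<And>z. z \<in> V \<Longrightarrow> lor (sy z) (R z) = pdy a z"
    and "\<And>z. z \<in> V \<Longrightarrow> lor (lap z) (R z) = pdx (pdx a) z + pdy (pdy a) z"
    and cl: "\<And>z. z \<in> V \<Longrightarrow> pdy (\<lambda>z. lor (t1 z) (R z)) z = pdx (\<lambda>z. lor (t2 z) (R z)) z"
    and g: "\<And>z. z \<in> V \<Longrightarrow> lor (gauss z) (pdx R z) = 0" "\<And>z. z \<in> V \<Longrightarrow> lor (gauss z) (pdy R z) = 0"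
  shows "solvable R"
  unfolding solvable_def
proof (intro ballI)
  fix z assume z: "z \<in> V"
  note pr = assms(3-6)
  have dR: "R differentiable at z" using diffV R z by blast
  have da: "a differentiable at z" "pdx a differentiable at z" "pdy a differentiable at z"
    using a z openV by (auto intro!: diffV smooth_intros)
  note c = pd_cong[OF openV z]
  have 0: "lor (s z) (pdx R z) = 0" "lor (s z) (pdy R z) = 0"
    using c[of a "\<lambda>z. lor (s z) (R z)"] pr(1) da(1) pd_lor[OF diff_lift(1)[OF z] dR] pr(2,3)[OF z] by auto
  have 1: "lor (sx z) (pdx R z) + lor (pdx sx z) (R z) = pdx (pdx a) z"
    "lor (sx z) (pdy R z) + lor (pdx sy z) (R z) = pdy (pdx a) z"
    using c[of "pdx a" "\<lambda>z. lor (sx z) (R z)"] pr(2) da(2) pd_lor[OF diff_lift(2)[OF z] dR] sxy[OF z] by auto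
  have 2: "lor (sy z) (pdx R z) + lor (pdx sy z) (R z) = pdx (pdy a) z"
    "lor (sy z) (pdy R z) + lor (pdy sy z) (R z) = pdy (pdy a) z"
    using c[of "pdy a" "\<lambda>z. lor (sy z) (R z)"] pr(3) da(3) pd_lor[OF diff_lift(3)[OF z] dR] by auto
  have am: "pdy (pdx a) z = pdx (pdy a) z" by (rule mixed_partials[OF a openV z])
  define B C where "B = lor (sx z) (pdx R z)" and "C = lor (sy z) (pdx R z)"
  have sym: "lor (sx z) (pdy R z) = C" using 1(2) 2(1) am by (simp add: C_def)
  have tr: "lor (sy z) (pdy R z) = - B"
    using 1(1) 2(2) pr(4)[OF z] by (simp add: B_def lap_def)
  have "lor (t1 z) (pdy R z) = lor (t2 z) (pdx R z)"
    using cl[OF z] pd_lor[OF diff_t(1)[OF z] dR] pd_lor[OF diff_t(2)[OF z] dR] closed[OF z] by simp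
  then have QC: "qre z * C = qim z * B"
    using rho_pos[OF z]
    by (simp add: lor_t[OF z] sym tr B_def[symmetric] C_def[symmetric]) (simp add: mult.commute)
  have ca: "coef R z * qabs z = - (qre z * B + qim z * C)"
    using qabs_pos[OF z] by (simp add: coef_def B_def C_def lor_commute)
  have "qabs z * (B + coef R z * qre z) = qabs z * B + qre z * (coef R z * qabs z)"
     "qabs z * (C + coef R z * qim z) = qabs z * C + qim z * (coef R z * qabs z)"
    by (simp_all add: algebra_simps)
  then have "qabs z * (B + coef R z * qre z) = qim z * (qim z * B - qre z * C)"
     "qabs z * (C + coef R z * qim z) = - qre z * (qim z * B - qre z * C)"
    unfolding ca by (simp_all add: qabs_def power2_eq_square algebra_simps)
  with QC have BC: "B + coef R z * qre z = 0" "C + coef R z * qim z = 0"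
    using qabs_pos[OF z] by auto
  have t: "lor (sx z) (t1 z) = qre z" "lor (sy z) (t1 z) = qim z" "lor (sx z) (t2 z) = qim z"
     "lor (sy z) (t2 z) = - qre z" "lor (s z) (t1 z) = 0" "lor (s z) (t2 z) = 0"
    using lor_t_tangent[OF z] t_perp_s[OF z] by (simp_all add: lor_commute)
  have gt: "lor (gauss z) (t1 z) = 0" "lor (gauss z) (t2 z) = 0"
    by (simp_all add: lor_commute[of "gauss z"] lor_t[OF z] frame_products[OF z])
  have "pdx R z + coef R z *\<^sub>R t1 z = snd (pdx R z + coef R z *\<^sub>R t1 z) *\<^sub>R s z"
    by (rule perp_frame[OF z]) (use BC in \<open>simp_all add: t gt g[OF z] 0 B_def C_def\<close>)
  moreover have "pdy R z + coef R z *\<^sub>R t2 z = snd (pdy R z + coef R z *\<^sub>R t2 z) *\<^sub>R s z"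
    by (rule perp_frame[OF z]) (use BC in \<open>simp_all add: t gt g[OF z] 0 sym tr\<close>)
  ultimately show "pdx R z = snd (pdx R z) *\<^sub>R s z - coef R z *\<^sub>R t1 z \<and>
      pdy R z = snd (pdy R z) *\<^sub>R s z - coef R z *\<^sub>R t2 z"
    by (simp add: snd_t[OF z] eq_diff_eq)
qed

text \<open>The last argument of \<open>frame_vec\<close> is the value that gives the norm its prescribed coefficient, since
  the new term enters the norm only through its product with the leading coefficient.\<close>

fun conserved_series :: "(nat \<Rightarrow> real) \<Rightarrow> nat \<Rightarrow> complex \<Rightarrow> R41" where
  "conserved_series c 0 = (\<lambda>z. sqrt (c 0) *\<^sub>R gauss z)"
| "conserved_series c (Suc k) =
     frame_vec (coef (conserved_series c k)) (pdx (coef (conserved_series c k)))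
       (pdy (coef (conserved_series c k)))
       (\<lambda>z. pdx (pdx (coef (conserved_series c k))) z + pdy (pdy (coef (conserved_series c k))) z)
       (\<lambda>z. (c (Suc k) - (\<Sum>i\<in>{1..k}. lor (conserved_series c i z) (conserved_series c (Suc k - i) z)))
            / (2 * sqrt (c 0)))"

text \<open>Reversing the order of summation changes the sign.\<close>

lemma skew_sum_zero:
  fixes F :: "R41 \<Rightarrow> R41"
  assumes skew: "\<And>v w. lor (F v) w = - lor (F w) v"
  shows "(\<Sum>i<k. lor (F (p (Suc i))) (p (k - i))) = 0"
proof -
  have "(\<Sum>i<k. lor (F (p (Suc i))) (p (k - i))) = (\<Sum>i<k. lor (F (p (Suc (k - Suc i)))) (p (k - (k - Suc i))))"
    by (rule sum.nat_diff_reindex[symmetric])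
  also have "\<dots> = (\<Sum>i<k. lor (F (p (k - i))) (p (Suc i)))"
    by (intro sum.cong) (auto simp: Suc_diff_Suc)
  also have "\<dots> = (\<Sum>i<k. - lor (F (p (Suc i))) (p (k - i)))"
    by (intro sum.cong refl) (rule skew)
  finally show ?thesis by (simp add: sum_negf)
qed

text \<open>In the derivative of the norm all terms except the two with the newest derivative cancel in pairs,
  because \<open>\<eta>\<close> is skew.\<close>

lemma norm_derivative:
  assumes z: "z \<in> V" and sm: "\<And>i. i \<le> k \<Longrightarrow> P i differentiable at z"
    and norm: "\<And>z. z \<in> V \<Longrightarrow> (\<Sum>i\<le>k. lor (P i z) (P (k - i) z)) = c"
    and dx: "\<And>i. i < k \<Longrightarrow> pdx (P i) z = - E1 z (P (Suc i) z)"
    and dy: "\<And>i. i < k \<Longrightarrow> pdy (P i) z = - E2 z (P (Suc i) z)"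
  shows "lor (pdx (P k) z) (P 0 z) = 0" "lor (pdy (P k) z) (P 0 z) = 0"
proof -
  have d: "(\<lambda>z. lor (P i z) (P (k - i) z)) differentiable at z" if "i \<in> {..k}" for i
    using that by (intro differentiable_lor sm) auto
  have twice: "(\<Sum>i\<le>k. lor (P i z) (D (k - i)) + lor (D i) (P (k - i) z)) =
      2 * ((\<Sum>i<k. lor (D i) (P (k - i) z)) + lor (D k) (P 0 z))" for D :: "nat \<Rightarrow> R41"
  proof -
    have "(\<Sum>i\<le>k. lor (P i z) (D (k - i))) = (\<Sum>i\<le>k. lor (D (k - i)) (P (k - (k - i)) z))"
      by (intro sum.cong) (auto simp: lor_commute)
    also have "\<dots> = (\<Sum>i\<le>k. lor (D i) (P (k - i) z))"
      using sum.atLeastAtMost_rev[of "\<lambda>i. lor (D i) (P (k - i) z)" 0 k] by (simp add: atMost_atLeast0)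
    finally show ?thesis by (simp add: sum.distrib lessThan_Suc_atMost[symmetric])
  qed
  have x: "(\<Sum>i\<le>k. lor (P i z) (pdx (P (k - i)) z) + lor (pdx (P i) z) (P (k - i) z)) = 0"
  proof -
    have "pdx (\<lambda>z. \<Sum>i\<le>k. lor (P i z) (P (k - i) z)) z = 0"
      by (rule pd_eq_0[OF z norm])
    moreover have "pdx (\<lambda>z. \<Sum>i\<le>k. lor (P i z) (P (k - i) z)) z =
        (\<Sum>i\<le>k. pdx (\<lambda>z. lor (P i z) (P (k - i) z)) z)"
      by (rule pd_sum(1)) (rule d)
    moreover have "\<dots> = (\<Sum>i\<le>k. lor (P i z) (pdx (P (k - i)) z) + lor (pdx (P i) z) (P (k - i) z))"
      by (intro sum.cong) (auto simp: pd_lor sm)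
    ultimately show ?thesis by simp
  qed
  have y: "(\<Sum>i\<le>k. lor (P i z) (pdy (P (k - i)) z) + lor (pdy (P i) z) (P (k - i) z)) = 0"
  proof -
    have "pdy (\<lambda>z. \<Sum>i\<le>k. lor (P i z) (P (k - i) z)) z = 0"
      by (rule pd_eq_0[OF z norm])
    moreover have "pdy (\<lambda>z. \<Sum>i\<le>k. lor (P i z) (P (k - i) z)) z =
        (\<Sum>i\<le>k. pdy (\<lambda>z. lor (P i z) (P (k - i) z)) z)"
      by (rule pd_sum(2)) (rule d)
    moreover have "\<dots> = (\<Sum>i\<le>k. lor (P i z) (pdy (P (k - i)) z) + lor (pdy (P i) z) (P (k - i) z))"
      by (intro sum.cong) (auto simp: pd_lor sm)
    ultimately show ?thesis by simp
  qed
  have "(\<Sum>i<k. lor (pdx (P i) z) (P (k - i) z)) = - (\<Sum>i<k. lor (E1 z (P (Suc i) z)) (P (k - i) z))"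
    unfolding sum_negf[symmetric] by (intro sum.cong) (auto simp: dx)
  also have "\<dots> = 0" using skew_sum_zero[where F = "E1 z" and p = "\<lambda>i. P i z", OF E_skew(1)] by simp
  finally show "lor (pdx (P k) z) (P 0 z) = 0" using x twice[of "\<lambda>i. pdx (P i) z"] by simp
  have "(\<Sum>i<k. lor (pdy (P i) z) (P (k - i) z)) = - (\<Sum>i<k. lor (E2 z (P (Suc i) z)) (P (k - i) z))"
    unfolding sum_negf[symmetric] by (intro sum.cong) (auto simp: dy)
  also have "\<dots> = 0" using skew_sum_zero[where F = "E2 z" and p = "\<lambda>i. P i z", OF E_skew(2)] by simp
  finally show "lor (pdy (P k) z) (P 0 z) = 0" using y twice[of "\<lambda>i. pdy (P i) z"] by simp
qed

context
  fixes c :: "nat \<Rightarrow> real"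
  assumes c0: "c 0 > 0"
begin

abbreviation "PS \<equiv> conserved_series c"

lemma smooth_conserved_series: "smooth_on (PS k) V"
proof (induction k rule: less_induct)
  case (less k)
  show ?case
  proof (cases k)
    case 0
    then show ?thesis by (auto intro!: smooth_intros)
  next
    case (Suc m)
    have "smooth_on (PS i) V" if "i \<le> m" for i using less.IH Suc that by auto
    moreover have "smooth_on (PS (Suc m - i)) V" if "i \<in> {1..m}" for i
      using less.IH Suc that by auto
    ultimately show ?thesis unfolding Suc conserved_series.simps
      using c0 by (intro smooth_intros openV) auto
  qed
qed

lemma norm_conserved_series:
  assumes z: "z \<in> V"
  shows "(\<Sum>i\<le>k. lor (PS i z) (PS (k - i) z)) = c k"
proof (cases k)
  case 0
  then show ?thesis using c0 by (simp add: frame_products[OF z])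
next
  case (Suc m)
  let ?S = "\<Sum>i\<in>{1..m}. lor (PS i z) (PS (k - i) z)"
  have "lor (gauss z) (PS k z) = (c k - ?S) / (2 * sqrt (c 0))"
    unfolding Suc conserved_series.simps lor_frame_vec[OF z] by simp
  then have g: "lor (PS 0 z) (PS k z) = (c k - ?S) / 2" using c0 by (simp add: field_simps)
  have "{..k} = insert 0 (insert k {1..m})" using Suc by auto
  then have "(\<Sum>i\<le>k. lor (PS i z) (PS (k - i) z)) =
     lor (PS 0 z) (PS k z) + (lor (PS k z) (PS 0 z) + ?S)"
    using Suc by (simp del: conserved_series.simps)
  then show ?thesis using g by (simp add: lor_commute[of "PS k z" "PS 0 z"] del: conserved_series.simps)
qed

text \<open>Solvability is carried along the recursion: \<open>norm_derivative\<close> provides the orthogonality to the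
  conformal Gauss map in \<open>solvableI\<close>, and the equality of mixed partials for the time component of the
  previous coefficient provides the remaining equation.\<close>

lemma solvable_conserved_series:
  "solvable (PS k) \<and> (\<forall>i<k. \<forall>z\<in>V. pdx (PS i) z = - E1 z (PS (Suc i) z) \<and> pdy (PS i) z = - E2 z (PS (Suc i) z))"
proof (induction k)
  case 0
  have P0: "lor (s z) (PS 0 z) = 0" "lor (sx z) (PS 0 z) = 0" "lor (sy z) (PS 0 z) = 0" "lor (lap z) (PS 0 z) = 0"
    if "z \<in> V" for z using that by (simp_all add: frame_products)
  have t0: "lor (t1 z) (PS 0 z) = 0" "lor (t2 z) (PS 0 z) = 0" if "z \<in> V" for z
    using that P0 by (simp_all add: lor_t del: conserved_series.simps)
  have "solvable (PS 0)"
  proof (rule solvableI[of _ "\<lambda>_. 0"])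
    fix z assume z: "z \<in> V"
    show "pdy (\<lambda>z. lor (t1 z) (PS 0 z)) z = pdx (\<lambda>z. lor (t2 z) (PS 0 z)) z"
      using pd_eq_0[of z "\<lambda>z. lor (t1 z) (PS 0 z)" 0] pd_eq_0[of z "\<lambda>z. lor (t2 z) (PS 0 z)" 0] t0 z
      by (simp del: conserved_series.simps)
    have "lor (pdx (PS 0) z) (PS 0 z) = 0" "lor (pdy (PS 0) z) (PS 0 z) = 0"
      using norm_derivative[of z 0 PS "c 0"] z norm_conserved_series[of _ 0] diffV[OF smooth_conserved_series]
      by (simp_all del: conserved_series.simps)
    then show "lor (gauss z) (pdx (PS 0) z) = 0" "lor (gauss z) (pdy (PS 0) z) = 0"
      using c0 by (simp_all add: lor_commute)
  qed (use P0 smooth_conserved_series in \<open>simp_all add: smooth_on_const pdx_def[abs_def] pdy_def[abs_def] del: conserved_series.simps\<close>)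
  then show ?case by simp
next
  case (Suc k)
  let ?a = "coef (PS k)"
  have a: "smooth_on ?a V" by (intro smooth_intros smooth_conserved_series)
  have pr: "lor (s z) (PS (Suc k) z) = ?a z" "lor (sx z) (PS (Suc k) z) = pdx ?a z"
    "lor (sy z) (PS (Suc k) z) = pdy ?a z" "lor (lap z) (PS (Suc k) z) = pdx (pdx ?a) z + pdy (pdy ?a) z"
    if "z \<in> V" for z
    unfolding conserved_series.simps using that by (simp_all add: lor_frame_vec)
  have nx: "pdx (PS k) z = - E1 z (PS (Suc k) z)" "pdy (PS k) z = - E2 z (PS (Suc k) z)"
    "lor (t1 z) (PS (Suc k) z) = snd (pdx (PS k) z)" "lor (t2 z) (PS (Suc k) z) = snd (pdy (PS k) z)"
    if "z \<in> V" for z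
    using solvable_next[OF smooth_conserved_series _ that pr(1-3)[OF that]] Suc.IH by blast+
  have eqs: "pdx (PS i) z = - E1 z (PS (Suc i) z)" "pdy (PS i) z = - E2 z (PS (Suc i) z)"
    if "i < Suc k" "z \<in> V" for i z
    using Suc.IH nx that by (auto simp: less_Suc_eq simp del: conserved_series.simps)
  have "solvable (PS (Suc k))"
  proof (rule solvableI[OF smooth_conserved_series a pr])
    fix z assume z: "z \<in> V"
    have sm: "smooth_on (\<lambda>z. lor (t1 z) (PS (Suc k) z)) V" "smooth_on (\<lambda>z. lor (t2 z) (PS (Suc k) z)) V"
      by (intro smooth_intros smooth_conserved_series)+
    have "pdy (\<lambda>z. lor (t1 z) (PS (Suc k) z)) z = pdy (\<lambda>z. snd (pdx (PS k) z)) z"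
      by (rule pd_cong[OF openV z nx(3) diffV[OF sm(1) z]])
    also have "\<dots> = snd (pdy (pdx (PS k)) z)"
      using z by (intro bounded_linear.pd_compose[OF bounded_linear_snd] diffV smooth_on_pdx smooth_conserved_series openV)
    also have "\<dots> = snd (pdx (pdy (PS k)) z)"
      using mixed_partials[OF smooth_conserved_series openV z] by simp
    also have "\<dots> = pdx (\<lambda>z. snd (pdy (PS k) z)) z"
      using z by (intro bounded_linear.pd_compose[OF bounded_linear_snd, symmetric] diffV smooth_on_pdy smooth_conserved_series openV)
    also have "\<dots> = pdx (\<lambda>z. lor (t2 z) (PS (Suc k) z)) z"
      by (rule pd_cong[OF openV z nx(4) diffV[OF sm(2) z], symmetric])
    finally show "pdy (\<lambda>z. lor (t1 z) (PS (Suc k) z)) z = pdx (\<lambda>z. lor (t2 z) (PS (Suc k) z)) z" .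
    have "lor (pdx (PS (Suc k)) z) (PS 0 z) = 0" "lor (pdy (PS (Suc k)) z) (PS 0 z) = 0"
      using norm_derivative[OF z, of "Suc k" PS "c (Suc k)"] norm_conserved_series[of _ "Suc k"]
        diffV[OF smooth_conserved_series z] eqs z by blast+
    then show "lor (gauss z) (pdx (PS (Suc k)) z) = 0" "lor (gauss z) (pdy (PS (Suc k)) z) = 0"
      using c0 by (simp_all add: lor_commute)
  qed
  then show ?case using eqs by blast
qed

theorem conserved_series_conserved: "conserved V c PS"
  unfolding conserved_def
proof (intro ballI conjI allI)
  fix z k assume z: "z \<in> V"
  show "E1 z (PS 0 z) = 0" "E2 z (PS 0 z) = 0"
    by (simp_all add: E1_def E2_def lor_t[OF z] frame_products[OF z])
  show "PS k differentiable at z" using diffV[OF smooth_conserved_series z] .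
  show "pdx (PS k) z = - E1 z (PS (Suc k) z)" "pdy (PS k) z = - E2 z (PS (Suc k) z)"
    using solvable_conserved_series[of "Suc k"] z by blast+
  show "(\<Sum>i\<le>k. lor (PS i z) (PS (k - i) z)) = c k" by (rule norm_conserved_series[OF z])
qed

lemma conserved_series_positive: "z \<in> V \<Longrightarrow> lor (PS 0 z) (normal z) > 0"
  using c0 by (simp add: frame_products)

end

end

section \<open>Zeros of doubly periodic functions\<close>

lemma Ck_on_holomorphic_compose:
  fixes f :: "complex \<Rightarrow> complex"
  assumes "g holomorphic_on W" "open W" "Ck_on k f S" "f ` S \<subseteq> W"
  shows "Ck_on k (\<lambda>x. g (f x)) S"
  using assms
proof (induction k arbitrary: g)
  case 0
  have "continuous_on S (g \<circ> f)"
    using 0 holomorphic_on_imp_continuous_on[THEN continuous_on_subset, of g W "f ` S"]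
    by (intro continuous_on_compose) auto
  then show ?case by (simp add: o_def)
next
  case (Suc k)
  obtain f' where f': "\<forall>x\<in>S. (f has_derivative f' x) (at x)" "\<forall>v. Ck_on k (\<lambda>x. f' x v) S"
    using Suc.prems by auto
  have fk: "Ck_on k f S" using Suc.prems Ck_on_SucD by blast
  show ?case unfolding Ck_on.simps
  proof (intro exI[of _ "\<lambda>x v. deriv g (f x) * f' x v"] conjI ballI allI)
    fix x assume x: "x \<in> S"
    then have "(g has_field_derivative deriv g (f x)) (at (f x))"
      using Suc.prems by (intro holomorphic_derivI[of g W]) auto
    then have "(g has_derivative (\<lambda>h. deriv g (f x) * h)) (at (f x))"
      by (simp add: has_field_derivative_def)
    from has_derivative_compose[OF bspec[OF f'(1) x] this]
    show "((\<lambda>x. g (f x)) has_derivative (\<lambda>v. deriv g (f x) * f' x v)) (at x)" .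
  next
    fix v
    have "Ck_on k (\<lambda>x. deriv g (f x)) S"
      using Suc.IH[of "deriv g"] Suc.prems fk holomorphic_deriv by blast
    then show "Ck_on k (\<lambda>x. deriv g (f x) * f' x v) S"
      using f' bounded_bilinear.Ck_on_prod[OF bounded_bilinear_mult] by blast
  qed
qed

lemma smooth_on_holomorphic_compose:
  assumes "g holomorphic_on W" "open W" "smooth_on f S" "f ` S \<subseteq> W"
  shows "smooth_on (\<lambda>x::complex. g (f x)) S"
  using assms Ck_on_holomorphic_compose unfolding smooth_on_def by blast

lemma pd_holomorphic_compose:
  assumes "g holomorphic_on W" "open W" "f z \<in> W" "f differentiable (at z)"
  shows "pdx (\<lambda>x. g (f x)) z = deriv g (f z) * pdx f z" "pdy (\<lambda>x. g (f x)) z = deriv g (f z) * pdy f z"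
proof -
  have "(g has_derivative (\<lambda>h. deriv g (f z) * h)) (at (f z))"
    using holomorphic_derivI[OF assms(1-3)] by (simp add: has_field_derivative_def)
  from pd_eqI[OF has_derivative_compose[OF has_derivative_pd[OF assms(4)] this]]
  show "pdx (\<lambda>x. g (f x)) z = deriv g (f z) * pdx f z" "pdy (\<lambda>x. g (f x)) z = deriv g (f z) * pdy f z"
    by auto
qed

lemma continuous_on_Complex: "continuous_on S (\<lambda>p. Complex (fst p) (snd p))"
  unfolding Complex_eq by (intro continuous_intros)

text \<open>Each term integrates to zero in the appropriate order of integration, by the fundamental theorem of
  calculus and periodicity.\<close>

lemma torus_stokes:
  fixes F G :: "complex \<Rightarrow> real"
  assumes F: "\<And>z. F differentiable (at z)" "continuous_on UNIV (pdx F)" "\<And>z. F (z + 1) = F z"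
    and G: "\<And>z. G differentiable (at z)" "continuous_on UNIV (pdy G)" "\<And>z. G (z + \<i>) = G z"
  shows "((\<lambda>p. pdx F (Complex (fst p) (snd p)) - pdy G (Complex (fst p) (snd p))) has_integral 0)
    (cbox (a, b) (a + 1, b + 1))"
proof -
  have cF: "continuous_on (cbox (a, b) (a + 1, b + 1)) (\<lambda>p. pdx F (Complex (fst p) (snd p)))"
    by (rule continuous_on_compose2[OF F(2) continuous_on_Complex]) simp
  have cG: "continuous_on (cbox (a, b) (a + 1, b + 1)) (\<lambda>p. pdy G (Complex (fst p) (snd p)))"
    by (rule continuous_on_compose2[OF G(2) continuous_on_Complex]) simp
  have Fx: "integral (cbox a (a + 1)) (\<lambda>x. pdx F (Complex x y)) = 0" for y
  proof -
    have "((\<lambda>x. pdx F (Complex x y)) has_integral F (Complex (a + 1) y) - F (Complex a y)) {a..a + 1}"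
      by (rule fundamental_theorem_of_calculus)
        (auto intro!: has_field_derivative_at_within has_real_derivative_along_x[OF F(1)]
          simp: has_real_derivative_iff_has_vector_derivative[symmetric])
    moreover have "Complex (a + 1) y = Complex a y + 1" by (simp add: complex_eq_iff)
    ultimately show ?thesis by (simp add: F(3) integral_unique)
  qed
  have Gy: "integral (cbox b (b + 1)) (\<lambda>y. pdy G (Complex x y)) = 0" for x
  proof -
    have "((\<lambda>y. pdy G (Complex x y)) has_integral G (Complex x (b + 1)) - G (Complex x b)) {b..b + 1}"
      by (rule fundamental_theorem_of_calculus)
        (auto intro!: has_field_derivative_at_within has_real_derivative_along_y[OF G(1)]
          simp: has_real_derivative_iff_has_vector_derivative[symmetric])
    moreover have "Complex x (b + 1) = Complex x b + \<i>" by (simp add: complex_eq_iff)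
    ultimately show ?thesis by (simp add: G(3) integral_unique)
  qed
  have "integral (cbox (a, b) (a + 1, b + 1)) (\<lambda>p. pdx F (Complex (fst p) (snd p))) =
      integral (cbox a (a + 1)) (\<lambda>x. integral (cbox b (b + 1)) (\<lambda>y. pdx F (Complex x y)))"
    using integral_prod_continuous[OF cF] by simp
  also have "\<dots> = integral (cbox b (b + 1)) (\<lambda>y. integral (cbox a (a + 1)) (\<lambda>x. pdx F (Complex x y)))"
    using integral_swap_continuous[of a b "a + 1" "b + 1" "\<lambda>x y. pdx F (Complex x y)"] cF
    by (simp add: case_prod_unfold)
  also have "\<dots> = 0" by (simp only: Fx integral_0)
  finally have IF: "integral (cbox (a, b) (a + 1, b + 1)) (\<lambda>p. pdx F (Complex (fst p) (snd p))) = 0" .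
  have "integral (cbox (a, b) (a + 1, b + 1)) (\<lambda>p. pdy G (Complex (fst p) (snd p))) =
      integral (cbox a (a + 1)) (\<lambda>x. integral (cbox b (b + 1)) (\<lambda>y. pdy G (Complex x y)))"
    using integral_prod_continuous[OF cG] by simp
  also have "\<dots> = 0" by (simp only: Gy integral_0)
  finally have IG: "integral (cbox (a, b) (a + 1, b + 1)) (\<lambda>p. pdy G (Complex (fst p) (snd p))) = 0" .
  have "((\<lambda>p. pdx F (Complex (fst p) (snd p))) has_integral 0) (cbox (a, b) (a + 1, b + 1))"
    "((\<lambda>p. pdy G (Complex (fst p) (snd p))) has_integral 0) (cbox (a, b) (a + 1, b + 1))"
    using integrable_integral[OF integrable_continuous[OF cF]] integrable_integral[OF integrable_continuous[OF cG]]
    by (simp_all only: IF IG)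
  from has_integral_diff[OF this] show ?thesis by simp
qed

text \<open>Squaring the positive part makes the function continuously differentiable.\<close>

lemma has_real_derivative_max0_square:
  "((\<lambda>t. (max 0 t)\<^sup>2) has_real_derivative 2 * max 0 t) (at (t::real))"
proof -
  consider "t < 0" | "t = 0" | "t > 0" by linarith
  then show ?thesis
  proof cases
    case 1
    have "((\<lambda>t. 0::real) has_real_derivative 2 * max 0 t) (at t)" using 1 by simp
    then show ?thesis
      by (rule has_field_derivative_transform_within_open[of _ _ _ "{..<0}"]) (use 1 in auto)
  next
    case 2
    have "isCont (\<lambda>z::real. max 0 z) 0" by (intro continuous_intros)
    then show ?thesis unfolding CARAT_DERIV 2
      by (intro exI[of _ "\<lambda>z. max 0 z"]) (auto simp: max_def power2_eq_square)
  next
    case 3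
    have "((\<lambda>t::real. t\<^sup>2) has_real_derivative 2 * max 0 t) (at t)"
      using 3 by (auto intro!: derivative_eq_intros)
    then show ?thesis
      by (rule has_field_derivative_transform_within_open[of _ _ _ "{0<..}"]) (use 3 in auto)
  qed
qed

definition bump :: "real \<Rightarrow> real \<Rightarrow> real" where
  "bump e t = (max 0 (e\<^sup>2 - t\<^sup>2))\<^sup>2"

lemma bump_nonneg: "bump e t \<ge> 0"
  by (simp add: bump_def)

lemma bump_pos: "\<bar>t\<bar> < e \<Longrightarrow> bump e t > 0"
  using abs_square_less_1[of "t / e"] power_strict_mono[of "\<bar>t\<bar>" e 2]
  by (simp add: bump_def max_def)

lemma bump_zero: "e > 0 \<Longrightarrow> \<bar>t\<bar> \<ge> e \<Longrightarrow> bump e t = 0"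
  using power_mono[of e "\<bar>t\<bar>" 2] by (simp add: bump_def max_def)

lemma bump_deriv: "(bump e has_real_derivative - 4 * t * max 0 (e\<^sup>2 - t\<^sup>2)) (at t)"
proof -
  have "((\<lambda>t. e\<^sup>2 - t\<^sup>2) has_real_derivative - 2 * t) (at t)"
    by (auto intro!: derivative_eq_intros)
  from DERIV_chain2[OF has_real_derivative_max0_square this] show ?thesis
    unfolding bump_def by (simp add: mult_ac)
qed

lemma continuous_bump: "continuous_on S (bump e)"
  unfolding bump_def by (intro continuous_intros)

text \<open>A bounded interval suffices since the function that is substituted for \<open>t\<close> is periodic, hence
  bounded.\<close>

lemma bump_antiderivative:
  "\<exists>K. \<forall>t. \<bar>t\<bar> < M \<longrightarrow> (K has_real_derivative bump e t) (at t)"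
proof -
  obtain K where K: "\<And>x. x \<in> {-M..M} \<Longrightarrow> (K has_vector_derivative bump e x) (at x within {-M..M})"
    using antiderivative_continuous[OF continuous_bump] by metis
  have "(K has_real_derivative bump e t) (at t)" if "\<bar>t\<bar> < M" for t
  proof -
    have "(K has_vector_derivative bump e t) (at t within {-M..M})" using K[of t] that by (simp add: abs_less_iff)
    moreover have "at t within {-M..M} = at t" using that by (intro at_within_Icc_at) auto
    ultimately show ?thesis by (simp add: has_real_derivative_iff_has_vector_derivative)
  qed
  then show ?thesis by blast
qed

lemma pd_chain_real:
  fixes u :: "complex \<Rightarrow> real"
  assumes "(K has_real_derivative k) (at (u z))" "u differentiable (at z)"
  shows "pdx (\<lambda>z. K (u z)) z = k * pdx u z" "pdy (\<lambda>z. K (u z)) z = k * pdy u z"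
    "(\<lambda>z. K (u z)) differentiable (at z)"
proof -
  have "(K has_derivative (\<lambda>h. k * h)) (at (u z))"
    using assms(1) by (simp add: has_field_derivative_def)
  note d = has_derivative_compose[OF has_derivative_pd[OF assms(2)] this]
  show "pdx (\<lambda>z. K (u z)) z = k * pdx u z" "pdy (\<lambda>z. K (u z)) z = k * pdy u z"
    using pd_eqI[OF d] by auto
  show "(\<lambda>z. K (u z)) differentiable (at z)" using d unfolding differentiable_def by blast
qed

subsection \<open>Doubly periodic functions\<close>

definition periodic :: "(complex \<Rightarrow> 'b) \<Rightarrow> bool" where
  "periodic f \<longleftrightarrow> (\<forall>z. f (z + 1) = f z \<and> f (z + \<i>) = f z)"

abbreviation "unit_square \<equiv> cbox 0 (Complex 1 1)"

text \<open>Subtracting the integer parts of the coordinates moves any point to the unit square.\<close>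

lemma periodic_reduce:
  assumes "periodic f"
  shows "\<exists>w\<in>unit_square. f w = f z"
proof -
  have n1: "f (z + of_nat n) = f z" for n z
  proof (induction n)
    case (Suc n)
    have "f (z + of_nat (Suc n)) = f ((z + of_nat n) + 1)" by (simp add: add_ac)
    then show ?case using assms Suc unfolding periodic_def by simp
  qed simp
  have ni: "f (z + of_nat n * \<i>) = f z" for n z
  proof (induction n)
    case (Suc n)
    have "f (z + of_nat (Suc n) * \<i>) = f ((z + of_nat n * \<i>) + \<i>)" by (simp add: algebra_simps)
    then show ?case using assms Suc unfolding periodic_def by simp
  qed simp
  have m1: "f (z + of_int m) = f z" for m z
  proof (cases "m \<ge> 0")
    case True
    then show ?thesis using n1[of z "nat m"] by simp
  next
    case False
    then show ?thesis using n1[of "z + of_int m" "nat (- m)"] by simp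
  qed
  have mi: "f (z + of_int m * \<i>) = f z" for m z
  proof (cases "m \<ge> 0")
    case True
    then show ?thesis using ni[of z "nat m"] by simp
  next
    case False
    then show ?thesis using ni[of "z + of_int m * \<i>" "nat (- m)"] by simp
  qed
  define w where "w = Complex (frac (Re z)) (frac (Im z))"
  have "z = w + of_int \<lfloor>Re z\<rfloor> + of_int \<lfloor>Im z\<rfloor> * \<i>"
    by (simp add: w_def frac_def complex_eq_iff)
  then have "f z = f w" using m1 mi by metis
  moreover have "w \<in> unit_square"
    by (simp add: w_def in_cbox_complex_iff less_imp_le[OF frac_lt_1])
  ultimately show ?thesis by metis
qed

lemma frechet_derivative_translate:
  assumes "\<And>z. f (z + a) = f z" "f differentiable (at (z + a))"
  shows "frechet_derivative f (at (z + a)) = frechet_derivative f (at z)"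
proof -
  have "(f has_derivative frechet_derivative f (at (z + a))) (at (z + a))"
    using assms(2) frechet_derivative_works by blast
  moreover have "((\<lambda>z. z + a) has_derivative (\<lambda>h. h)) (at z)"
    by (auto intro!: derivative_eq_intros)
  ultimately have "((\<lambda>z. f (z + a)) has_derivative frechet_derivative f (at (z + a))) (at z)"
    using has_derivative_compose[of "\<lambda>z. z + a" "\<lambda>h. h" z UNIV f] by simp
  moreover have "(\<lambda>z. f (z + a)) = f" using assms by auto
  ultimately have "(f has_derivative frechet_derivative f (at (z + a))) (at z)" by simp
  then show ?thesis by (rule frechet_derivative_at)
qed

lemma periodic_pd:
  assumes "periodic f" "\<And>z. f differentiable (at z)"
  shows "periodic (pdx f)" "periodic (pdy f)"
proof -
  have "frechet_derivative f (at (z + 1)) = frechet_derivative f (at z)"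
    "frechet_derivative f (at (z + \<i>)) = frechet_derivative f (at z)" for z
    using assms by (auto intro!: frechet_derivative_translate simp: periodic_def)
  then show "periodic (pdx f)" "periodic (pdy f)"
    by (simp_all add: periodic_def pdx_def pdy_def)
qed

definition jac :: "(complex \<Rightarrow> complex) \<Rightarrow> complex \<Rightarrow> real" where
  "jac H z = Im (cnj (pdx H z) * pdy H z)"

text \<open>If the Jacobian vanishes, the partial derivatives are linearly dependent over the reals, and a
  dependence is a kernel vector of the derivative.\<close>

lemma jac_nonzero:
  assumes "bij (frechet_derivative f (at z))" "f differentiable (at z)"
  shows "jac f z \<noteq> 0"
proof
  assume J: "jac f z = 0"
  let ?D = "frechet_derivative f (at z)"
  have inj: "v = 0" if "?D v = 0" for v
  proof -
    have "?D 0 = 0" using frechet_derivative_eq_pd[OF assms(2), of 0] by simp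
    then show ?thesis using assms(1) that by (metis bij_is_inj injD)
  qed
  have X0: "pdx f z \<noteq> 0" using inj[of 1] by (auto simp: pdx_def)
  define r where "r = Re (cnj (pdx f z) * pdy f z) / (norm (pdx f z))\<^sup>2"
  have "cnj (pdx f z) * pdy f z = of_real (Re (cnj (pdx f z) * pdy f z))"
    using J by (simp only: jac_def complex_eq_iff Re_complex_of_real Im_complex_of_real)
  then have "pdx f z * cnj (pdx f z) * pdy f z = pdx f z * of_real (Re (cnj (pdx f z) * pdy f z))"
    by (simp only: mult.assoc)
  then have "of_real ((norm (pdx f z))\<^sup>2) * pdy f z = pdx f z * of_real (Re (cnj (pdx f z) * pdy f z))"
    by (simp only: complex_norm_square)
  then have "pdy f z = of_real r * pdx f z"
    using X0 by (simp add: r_def field_simps)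
  then have "?D (Complex (- r) 1) = 0"
    by (simp add: frechet_derivative_eq_pd[OF assms(2)] scaleR_conv_of_real)
  then show False using inj[of "Complex (- r) 1"] by (simp add: complex_eq_iff)
qed

text \<open>The form \<open>bump u bump v du dv\<close> on the plane is the differential of \<open>K(u) bump v dv\<close> with \<open>K\<close> an
  antiderivative of the bump function.  Its pull-back is exact on the torus, so it integrates to zero.
  Where \<open>H\<close> is small the integrand has one sign, elsewhere it vanishes.\<close>

lemma periodic_jac_zero:
  assumes H: "smooth_on H UNIV" "periodic H" and e: "e > 0"
    and sg: "\<And>z. \<bar>Re (H z)\<bar> < e \<Longrightarrow> \<bar>Im (H z)\<bar> < e \<Longrightarrow> sg * jac H z \<ge> 0"
    and z: "\<bar>Re (H z)\<bar> < e" "\<bar>Im (H z)\<bar> < e"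
  shows "sg * jac H z = 0"
proof -
  define u v where "u = (\<lambda>z. Re (H z))" and "v = (\<lambda>z. Im (H z))"
  have sm: "smooth_on u UNIV" "smooth_on v UNIV" unfolding u_def v_def by (intro smooth_intros H)+
  have sp: "smooth_on (pdx u) UNIV" "smooth_on (pdy u) UNIV" "smooth_on (pdx v) UNIV" "smooth_on (pdy v) UNIV"
    "smooth_on (pdx (pdy v)) UNIV"
    using sm by (auto intro!: smooth_intros)
  note cont = sm[THEN smooth_on_imp_continuous_on] sp[THEN smooth_on_imp_continuous_on]
  have d: "H differentiable (at z)" "u differentiable (at z)" "v differentiable (at z)"
    "pdx v differentiable (at z)" "pdy v differentiable (at z)" for z
    using H sm sp by (auto intro: smooth_on_imp_differentiable)
  have per: "periodic u" "periodic v" using H(2) by (auto simp: periodic_def u_def v_def)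
  have perv: "periodic (pdx v)" "periodic (pdy v)" using periodic_pd[OF per(2) d(3)] by auto
  have "jac H z = pdx u z * pdy v z - pdy u z * pdx v z" for z
    unfolding jac_def u_def v_def
    using bounded_linear.pd_compose[OF bounded_linear_Re d(1)] bounded_linear.pd_compose[OF bounded_linear_Im d(1)]
    by simp
  then have jac: "jac H = (\<lambda>z. pdx u z * pdy v z - pdy u z * pdx v z)" by auto
  obtain M where M: "\<bar>u z\<bar> < M" for z
  proof -
    have "bounded (u ` unit_square)"
      by (intro compact_imp_bounded compact_continuous_image continuous_on_subset[OF cont(1)]) auto
    then obtain B where "\<forall>w\<in>unit_square. \<bar>u w\<bar> \<le> B" unfolding bounded_iff by auto
    then have "\<bar>u z\<bar> < B + 1" for z using periodic_reduce[OF per(1), of z] by force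
    then show ?thesis using that by blast
  qed
  obtain K where K: "\<And>t. \<bar>t\<bar> < M \<Longrightarrow> (K has_real_derivative bump e t) (at t)"
    using bump_antiderivative by blast
  define k' where "k' = (\<lambda>t. - 4 * t * max 0 (e\<^sup>2 - t\<^sup>2))"
  note Ku = pd_chain_real[OF K[OF M] d(2)]
  note kv = pd_chain_real[OF bump_deriv d(3), of e, folded k'_def]
  \<comment> \<open>The pulled-back potential is \<open>A dv\<close>.\<close>
  define A where "A = (\<lambda>z. K (u z) * bump e (v z))"
  note mpd = bounded_bilinear.pd_prod[OF bounded_bilinear_mult]
  have Ad: "A differentiable (at z)" for z unfolding A_def by (intro differentiable_mult Ku kv)
  have Ax: "pdx A z = K (u z) * (k' (v z) * pdx v z) + bump e (u z) * pdx u z * bump e (v z)"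
    "pdy A z = K (u z) * (k' (v z) * pdy v z) + bump e (u z) * pdy u z * bump e (v z)" for z
    unfolding A_def mpd[OF Ku(3) kv(3)] Ku kv k'_def by simp_all
  have perA: "periodic A" using per by (auto simp: periodic_def A_def)
  have cA: "continuous_on UNIV A" "continuous_on UNIV (\<lambda>z. K (u z))"
    by (intro continuous_at_imp_continuous_on ballI differentiable_imp_continuous_within Ad Ku(3))+
  have ck: "continuous_on UNIV k'" unfolding k'_def by (intro continuous_intros)
  have cb: "continuous_on UNIV (\<lambda>z. bump e (u z))" "continuous_on UNIV (\<lambda>z. bump e (v z))"
    "continuous_on UNIV (\<lambda>z. k' (v z))"
    using continuous_on_compose2[OF continuous_bump cont(1)] continuous_on_compose2[OF continuous_bump cont(2)]
     continuous_on_compose2[OF ck cont(2)] by auto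
  have F: "pdx (\<lambda>z. A z * pdy v z) = (\<lambda>z. A z * pdx (pdy v) z + pdx A z * pdy v z)"
    using mpd[OF Ad d(5)] by auto
  have G: "pdy (\<lambda>z. A z * pdx v z) = (\<lambda>z. A z * pdx (pdy v) z + pdy A z * pdx v z)"
    using mpd[OF Ad d(4)] mixed_partials[OF sm(2)] by auto
  define I where "I = (\<lambda>z. bump e (u z) * bump e (v z) * (sg * jac H z))"
  have I: "sg * (pdx (\<lambda>z. A z * pdy v z) z - pdy (\<lambda>z. A z * pdx v z) z) = I z" for z
    unfolding F G Ax jac I_def by (simp add: algebra_simps)
  define a b where "a = Re z" and "b = Im z"
  have "((\<lambda>p. pdx (\<lambda>z. A z * pdy v z) (Complex (fst p) (snd p)) - pdy (\<lambda>z. A z * pdx v z) (Complex (fst p) (snd p)))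
      has_integral 0) (cbox (a, b) (a + 1, b + 1))"
  proof (rule torus_stokes)
    show "continuous_on UNIV (pdx (\<lambda>z. A z * pdy v z))" "continuous_on UNIV (pdy (\<lambda>z. A z * pdx v z))"
      unfolding F G Ax by (intro continuous_intros cont cA cb)+
  qed (use perA perv Ad d in \<open>auto simp: periodic_def intro!: differentiable_mult\<close>)
  from has_integral_mult_right[OF this, of sg]
  have int: "((\<lambda>p. I (Complex (fst p) (snd p))) has_integral 0) (cbox (a, b) (a + 1, b + 1))"
    by (simp only: I mult_zero_right)
  have I0: "I z \<ge> 0" for z
    using sg[of z] bump_zero[OF e, of "u z"] bump_zero[OF e, of "v z"] bump_nonneg[of e "u z"] bump_nonneg[of e "v z"]
    by (cases "\<bar>u z\<bar> < e"; cases "\<bar>v z\<bar> < e") (auto simp: I_def u_def v_def)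
  have "continuous_on UNIV I" unfolding I_def jac by (intro continuous_intros cont cb)
  then have "continuous_on (cbox (a, b) (a + 1, b + 1)) (\<lambda>p. I (Complex (fst p) (snd p)))"
    by (rule continuous_on_compose2[OF _ continuous_on_Complex]) simp
  then have "I (Complex (fst (a, b)) (snd (a, b))) = 0"
    by (rule has_integral_0_cbox_imp_0[OF _ _ int]) (auto simp: I0 box_ne_empty Basis_prod_def)
  then have "I z = 0" by (simp add: a_def b_def)
  then show ?thesis using bump_pos[OF z(1)] bump_pos[OF z(2)] by (simp add: I_def u_def v_def)
qed

text \<open>By compactness of the unit square the sign condition near the zeros holds wherever \<open>H\<close> is small, so
  the Jacobian vanishes there.  Near an actual zero this contradicts the strict sign.\<close>

lemma periodic_zero_free:
  assumes H: "smooth_on H UNIV" "periodic H"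
    and sg: "\<And>z. H z = 0 \<Longrightarrow> eventually (\<lambda>w. sg * jac H w > 0) (at z)"
  shows "H z \<noteq> 0"
proof
  assume Hz: "H z = 0"
  have cH: "continuous_on UNIV H" using H smooth_on_imp_continuous_on by blast
  have d: "H differentiable (at z)" for z using H by (auto intro: smooth_on_imp_differentiable)
  have "continuous_on UNIV (pdx H)" "continuous_on UNIV (pdy H)"
    using H by (auto intro!: smooth_on_imp_continuous_on smooth_intros)
  then have cJ: "continuous_on UNIV (\<lambda>z. sg * jac H z)"
    unfolding jac_def by (intro continuous_intros)
  \<comment> \<open>No zero of \<open>H\<close> adheres to the points with the wrong sign, so \<open>H\<close> is bounded below on them.\<close>
  define N where "N = {w \<in> unit_square. sg * jac H w < 0}"
  have cK: "compact (closure N)"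
    unfolding compact_closure by (rule bounded_subset[OF bounded_cbox[of 0 "Complex 1 1"]]) (auto simp: N_def)
  have nz: "H w \<noteq> 0" if w: "w \<in> closure N" for w
  proof
    assume "H w = 0"
    note ev = sg[OF this]
    have lim: "((\<lambda>z. sg * jac H z) \<longlongrightarrow> sg * jac H w) (at w)"
      using cJ by (simp add: continuous_on_eq_continuous_at isCont_def)
    have "sg * jac H w \<ge> 0"
      by (rule tendsto_lowerbound[OF lim]) (use ev in \<open>auto elim: eventually_mono\<close>)
    with ev have "eventually (\<lambda>z. sg * jac H z \<ge> 0) (nhds w)"
      by (auto simp: eventually_nhds_conv_at elim: eventually_mono)
    then obtain T where T: "open T" "w \<in> T" "\<forall>z\<in>T. sg * jac H z \<ge> 0"
      unfolding eventually_nhds by blast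
    then have "T \<inter> N \<noteq> {}" using w closure_iff_nhds_not_empty by (metis Int_commute inf.idem open_Int_closure_eq_empty Int_iff empty_iff)
    then show False using T by (fastforce simp: N_def)
  qed
  obtain e where e: "e > 0" "\<And>w. w \<in> N \<Longrightarrow> norm (H w) \<ge> e"
  proof (cases "N = {}")
    case True
    then show ?thesis using that[of 1] by auto
  next
    case False
    then have "closure N \<noteq> {}" by simp
    moreover have "continuous_on (closure N) (\<lambda>w. norm (H w))"
      by (intro continuous_intros continuous_on_subset[OF cH]) auto
    ultimately obtain w0 where w0: "w0 \<in> closure N" "\<And>w. w \<in> closure N \<Longrightarrow> norm (H w0) \<le> norm (H w)"
      using continuous_attains_inf[OF cK] by blast
    show ?thesis
    proof (rule that)
      show "norm (H w0) > 0" using nz[OF w0(1)] by simp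
      show "norm (H w0) \<le> norm (H w)" if "w \<in> N" for w
        using w0(2) subsetD[OF closure_subset that] by blast
    qed
  qed
  have per: "periodic (\<lambda>z. (H z, jac H z))"
    using H(2) periodic_pd[OF H(2) d] by (auto simp: periodic_def jac_def)
  have small: "sg * jac H w \<ge> 0" if "\<bar>Re (H w)\<bar> < e / 2" "\<bar>Im (H w)\<bar> < e / 2" for w
  proof (rule ccontr)
    assume neg: "\<not> ?thesis"
    obtain w' where w': "w' \<in> unit_square" "(H w', jac H w') = (H w, jac H w)"
      using periodic_reduce[OF per, of w] by auto
    then have "w' \<in> N" using neg by (auto simp: N_def)
    then have "norm (H w') \<ge> e" by (rule e(2))
    then have "norm (H w) \<ge> e" using w'(2) by simp
    then show False using cmod_le[of "H w"] that by linarith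
  qed
  have "eventually (\<lambda>w. \<bar>Re (H w)\<bar> < e / 2 \<and> \<bar>Im (H w)\<bar> < e / 2) (at z)"
  proof -
    have "(H \<longlongrightarrow> H z) (at z)" using cH by (simp add: continuous_on_eq_continuous_at isCont_def)
    then have "(H \<longlongrightarrow> 0) (at z)" using Hz by simp
    then have "eventually (\<lambda>w. dist (H w) 0 < e / 2) (at z)" using e by (intro tendstoD) auto
    then show ?thesis
      by (rule eventually_mono) (metis abs_Im_le_cmod abs_Re_le_cmod dist_0_norm dist_commute le_less_trans)
  qed
  with sg[OF Hz] have "eventually (\<lambda>w. False) (at z)"
  proof eventually_elim
    case (elim w)
    have "sg * jac H w = 0"
      by (rule periodic_jac_zero[OF H, of "e / 2"]) (use e small elim in auto)
    then show ?case using elim(1) by linarith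
  qed
  then show False by simp
qed

text \<open>At a zero of order \<open>n\<close> the quotient is asymptotic to \<open>(w - w0) / n\<close>.\<close>

lemma holomorphic_log_derivative:
  assumes q: "q holomorphic_on W" "open W" "w0 \<in> W" "q w0 = 0"
    and nz: "\<not> eventually (\<lambda>w. q w = 0) (nhds w0)"
  shows "((\<lambda>w. q w / deriv q w) \<longlongrightarrow> 0) (at w0)" "eventually (\<lambda>w. deriv q w \<noteq> 0) (at w0)"
proof -
  obtain r0 where r0: "r0 > 0" "ball w0 r0 \<subseteq> W" using q open_contains_ball by blast
  have "\<not> q constant_on ball w0 r0"
  proof
    assume "q constant_on ball w0 r0"
    then have "\<forall>w\<in>ball w0 r0. q w = 0" using q r0 by (metis centre_in_ball constant_on_def)
    then have "eventually (\<lambda>w. q w = 0) (nhds w0)"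
      unfolding eventually_nhds using r0 by (intro exI[of _ "ball w0 r0"]) simp
    then show False using nz by simp
  qed
  then obtain g r n where g: "0 < n" "0 < r" "ball w0 r \<subseteq> ball w0 r0" "g holomorphic_on ball w0 r"
    "\<And>w. w \<in> ball w0 r \<Longrightarrow> q w = (w - w0) ^ n * g w" "\<And>w. w \<in> ball w0 r \<Longrightarrow> g w \<noteq> 0"
    using holomorphic_factor_zero_nonconstant[of q "ball w0 r0" w0] q r0 holomorphic_on_subset
    by (metis centre_in_ball connected_ball open_ball)
  have dq: "deriv q w = (w - w0) ^ (n - 1) * (of_nat n * g w + (w - w0) * deriv g w)" if w: "w \<in> ball w0 r" for w
  proof -
    have "(g has_field_derivative deriv g w) (at w)" using g(4) w by (intro holomorphic_derivI) auto
    moreover have "((\<lambda>w. (w - w0) ^ n) has_field_derivative of_nat n * (w - w0) ^ (n - 1)) (at w)"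
      by (auto intro!: derivative_eq_intros)
    ultimately have "((\<lambda>w. (w - w0) ^ n * g w) has_field_derivative
        of_nat n * (w - w0) ^ (n - 1) * g w + deriv g w * (w - w0) ^ n) (at w)"
      by (rule DERIV_mult[rotated])
    moreover have pw: "(w - w0) ^ n = (w - w0) ^ (n - 1) * (w - w0)"
      by (rule power_minus_mult[OF g(1), symmetric])
    have "of_nat n * (w - w0) ^ (n - 1) * g w + deriv g w * (w - w0) ^ n =
        (w - w0) ^ (n - 1) * (of_nat n * g w + (w - w0) * deriv g w)"
      unfolding pw by (simp add: algebra_simps)
    ultimately have "((\<lambda>w. (w - w0) ^ n * g w) has_field_derivative
       (w - w0) ^ (n - 1) * (of_nat n * g w + (w - w0) * deriv g w)) (at w)" by simp
    then have "(q has_field_derivative (w - w0) ^ (n - 1) * (of_nat n * g w + (w - w0) * deriv g w)) (at w)"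
      by (rule has_field_derivative_transform_within_open[of _ _ _ "ball w0 r"]) (use w g in auto)
    then show ?thesis by (rule DERIV_imp_deriv)
  qed
  define D where "D = (\<lambda>w. of_nat n * g w + (w - w0) * deriv g w)"
  have w0: "w0 \<in> ball w0 r" using g by simp
  have "continuous_on (ball w0 r) g" "continuous_on (ball w0 r) (deriv g)"
    using g(4) by (auto intro!: holomorphic_on_imp_continuous_on holomorphic_deriv)
  then have "isCont g w0" "isCont (deriv g) w0"
    using w0 by (auto simp: continuous_on_eq_continuous_at)
  then have lims: "(g \<longlongrightarrow> g w0) (at w0)" "(deriv g \<longlongrightarrow> deriv g w0) (at w0)"
    by (auto simp: isCont_def)
  have D: "(D \<longlongrightarrow> of_nat n * g w0 + (w0 - w0) * deriv g w0) (at w0)" unfolding D_def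
    by (intro tendsto_intros lims)
  have D0: "of_nat n * g w0 + (w0 - w0) * deriv g w0 \<noteq> 0" using g w0 by auto
  have evD: "eventually (\<lambda>w. D w \<noteq> 0) (at w0)" using D D0 by (rule tendsto_imp_eventually_ne)
  have evb: "eventually (\<lambda>w. w \<in> ball w0 r) (at w0)"
    using w0 by (intro eventually_at_in_open') auto
  have evn: "eventually (\<lambda>w. w \<noteq> w0) (at w0)" by (simp add: eventually_at_filter)
  show "eventually (\<lambda>w. deriv q w \<noteq> 0) (at w0)"
    using evD evb evn by eventually_elim (auto simp: dq D_def)
  have "((\<lambda>w. (w - w0) * g w / D w) \<longlongrightarrow> (w0 - w0) * g w0 / (of_nat n * g w0 + (w0 - w0) * deriv g w0)) (at w0)"
    by (intro tendsto_intros lims D D0)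
  then have lim: "((\<lambda>w. (w - w0) * g w / D w) \<longlongrightarrow> 0) (at w0)" by simp
  have "eventually (\<lambda>w. (w - w0) * g w / D w = q w / deriv q w) (at w0)"
    using evb evn
  proof eventually_elim
    case (elim w)
    have "q w = (w - w0) ^ (n - 1) * ((w - w0) * g w)" using g(5)[of w] elim
      unfolding mult.assoc[symmetric] power_minus_mult[OF g(1)] by blast
    then show ?case using elim dq[of w] by (simp add: D_def)
  qed
  then show "((\<lambda>w. q w / deriv q w) \<longlongrightarrow> 0) (at w0)"
    by (rule Lim_transform_eventually[OF lim])
qed

text \<open>Near a zero, \<open>H\<^sub>x\<close> and \<open>H\<^sub>y\<close> are a common factor times \<open>\<phi>\<^sub>x\<close> and \<open>\<phi>\<^sub>y\<close>, up to an error controlled by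
  the quotient of \<open>q\<close> and its derivative, which tends to zero.  So the sign is that of the Jacobian
  of \<open>\<phi>\<close>.\<close>

lemma pullback_jac_sign:
  assumes N: "open N" "z0 \<in> N" "smooth_on \<phi> N" and W: "open W" "\<phi> ` N \<subseteq> W" and q: "q holomorphic_on W"
    and inj: "inj_on \<phi> N"
    and H: "\<And>z. z \<in> N \<Longrightarrow> H z = q (\<phi> z) * (pdx \<phi> z)\<^sup>2"
    and sg: "sg * jac \<phi> z0 > 0"
    and nz: "\<not> eventually (\<lambda>w. q w = 0) (nhds (\<phi> z0))" and z0: "q (\<phi> z0) = 0"
  shows "eventually (\<lambda>w. sg * jac H w > 0) (at z0)"
proof -
  have Im_of_real_times: "Im (of_real c * x) = c * Im x" for c x by simp
  define p where "p = (\<lambda>z. (pdx \<phi> z)\<^sup>2)"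
  note sphi = N(3) smooth_on_pdx[OF N(3,1)] smooth_on_pdy[OF N(3,1)]
  have sp: "smooth_on p N" unfolding p_def by (intro smooth_on_power sphi)
  note sm = sphi sp smooth_on_pdx[OF sp N(1)] smooth_on_pdy[OF sp N(1)]
    smooth_on_holomorphic_compose[OF q W(1) N(3) W(2)]
  have d: "\<phi> differentiable (at z)" "p differentiable (at z)" "(\<lambda>z. q (\<phi> z)) differentiable (at z)"
     if "z \<in> N" for z
    using smooth_on_imp_differentiable[OF sm(1) N(1) that] smooth_on_imp_differentiable[OF sm(4) N(1) that]
      smooth_on_imp_differentiable[OF sm(7) N(1) that] by auto
  have lim: "(f \<longlongrightarrow> f z0) (at z0)" if "smooth_on f N" for f :: "complex \<Rightarrow> complex"
  proof -
    have "continuous_on N f" using that by (rule smooth_on_imp_continuous_on)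
    then have "isCont f z0" using N continuous_on_eq_continuous_at by blast
    then show ?thesis by (simp add: isCont_def)
  qed
  define R where "R = (\<lambda>z. q (\<phi> z) / deriv q (\<phi> z))"
  have evN: "eventually (\<lambda>z. z \<in> N) (at z0)" using N by (intro eventually_at_in_open') auto
  have fl: "filterlim \<phi> (at (\<phi> z0)) (at z0)"
    unfolding filterlim_at
  proof
    have "eventually (\<lambda>z. z \<noteq> z0) (at z0)" by (simp add: eventually_at_filter)
    with evN show "\<forall>\<^sub>F z in at z0. \<phi> z \<in> UNIV \<and> \<phi> z \<noteq> \<phi> z0"
      by eventually_elim (use inj N in \<open>auto dest: inj_onD\<close>)
  qed (use lim sm in auto)
  have w0: "\<phi> z0 \<in> W" using W N by auto
  note ld = holomorphic_log_derivative[OF q W(1) w0 z0 nz]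
  have R: "(R \<longlongrightarrow> 0) (at z0)" unfolding R_def by (rule filterlim_compose[OF ld(1) fl])
  have evq: "eventually (\<lambda>z. deriv q (\<phi> z) \<noteq> 0) (at z0)"
    by (rule eventually_compose_filterlim[OF ld(2) fl])
  \<comment> \<open>The Jacobian of \<open>H\<close>, divided by the square of the modulus of \<open>deriv q (\<phi> z)\<close>.\<close>
  define G where "G = (\<lambda>z. sg * Im (cnj (pdx \<phi> z * p z + R z * pdx p z) * (pdy \<phi> z * p z + R z * pdy p z)))"
  have lG: "(G \<longlongrightarrow> sg * Im (cnj (pdx \<phi> z0 * p z0 + 0 * pdx p z0) * (pdy \<phi> z0 * p z0 + 0 * pdy p z0))) (at z0)"
    unfolding G_def by (intro tendsto_intros lim sm R)
  have val: "sg * Im (cnj (pdx \<phi> z0 * p z0 + 0 * pdx p z0) * (pdy \<phi> z0 * p z0 + 0 * pdy p z0)) =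
      (norm (p z0))\<^sup>2 * (sg * jac \<phi> z0)"
  proof -
    have "cnj (pdx \<phi> z0 * p z0) * (pdy \<phi> z0 * p z0) = (p z0 * cnj (p z0)) * (cnj (pdx \<phi> z0) * pdy \<phi> z0)"
      by simp
    also have "p z0 * cnj (p z0) = of_real ((norm (p z0))\<^sup>2)" by (rule complex_norm_square[symmetric])
    finally have E: "cnj (pdx \<phi> z0 * p z0) * (pdy \<phi> z0 * p z0) =
        of_real ((norm (p z0))\<^sup>2) * (cnj (pdx \<phi> z0) * pdy \<phi> z0)" .
    show ?thesis
      unfolding mult_zero_left add_0_right E Im_of_real_times jac_def by (rule mult.left_commute)
  qed
  have "pdx \<phi> z0 \<noteq> 0" using sg by (auto simp: jac_def)
  then have pos: "(norm (p z0))\<^sup>2 * (sg * jac \<phi> z0) > 0" using sg by (simp add: p_def)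
  have "eventually (\<lambda>z. G z > 0) (at z0)" by (rule order_tendstoD(1)[OF lG[unfolded val] pos])
  with evN evq show ?thesis
  proof eventually_elim
    case (elim z)
    have z: "z \<in> N" by fact
    note pdq = pd_holomorphic_compose[OF q W(1) _ d(1)[OF z]]
    have "H z = q (\<phi> z) * p z" if "z \<in> N" for z using H that by (simp add: p_def)
    then have "pdx H z = pdx (\<lambda>z. q (\<phi> z) * p z) z" "pdy H z = pdy (\<lambda>z. q (\<phi> z) * p z) z"
      using pd_cong[OF N(1) z, of "\<lambda>z. q (\<phi> z) * p z" H] d z by (auto intro!: differentiable_mult)
    then have "pdx H z = q (\<phi> z) * pdx p z + deriv q (\<phi> z) * pdx \<phi> z * p z"
       "pdy H z = q (\<phi> z) * pdy p z + deriv q (\<phi> z) * pdy \<phi> z * p z"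
      using bounded_bilinear.pd_prod[OF bounded_bilinear_mult d(3)[OF z] d(2)[OF z]] pdq z W by auto
    then have "pdx H z = deriv q (\<phi> z) * (pdx \<phi> z * p z + R z * pdx p z)"
        "pdy H z = deriv q (\<phi> z) * (pdy \<phi> z * p z + R z * pdy p z)"
      using elim by (auto simp: R_def algebra_simps)
    then have "cnj (pdx H z) * pdy H z = (deriv q (\<phi> z) * cnj (deriv q (\<phi> z))) *
       (cnj (pdx \<phi> z * p z + R z * pdx p z) * (pdy \<phi> z * p z + R z * pdy p z))"
      by simp
    also have "deriv q (\<phi> z) * cnj (deriv q (\<phi> z)) = of_real ((norm (deriv q (\<phi> z)))\<^sup>2)"
      by (rule complex_norm_square[symmetric])
    finally have E: "cnj (pdx H z) * pdy H z = of_real ((norm (deriv q (\<phi> z)))\<^sup>2) *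
       (cnj (pdx \<phi> z * p z + R z * pdx p z) * (pdy \<phi> z * p z + R z * pdy p z))" .
    have "sg * jac H z = (norm (deriv q (\<phi> z)))\<^sup>2 * G z"
      unfolding E Im_of_real_times jac_def G_def by (rule mult.left_commute)
    then show ?case using elim by simp
  qed
qed

section \<open>Charts of a Riemann surface\<close>

locale charted_surface =
  fixes A :: "'a::t2_space chart set"
  assumes RS: "riemann_surface A"
begin

abbreviation "img c \<equiv> chart_map c ` chart_dom c"

lemma chart_at: "\<exists>c\<in>A. x \<in> chart_dom c"
  using RS unfolding riemann_surface_def by blast

lemma connected_UNIV_surface: "connected (UNIV :: 'a set)"
  using RS unfolding riemann_surface_def by blast

context
  fixes c assumes c: "c \<in> A"
begin

lemma open_dom: "open (chart_dom c)" and open_img: "open (img c)"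
  and hom: "homeomorphism (chart_dom c) (img c) (chart_map c) (chart_inv c)"
  using RS c unfolding riemann_surface_def by blast+

lemma inv_map: "x \<in> chart_dom c \<Longrightarrow> chart_inv c (chart_map c x) = x"
  using hom unfolding homeomorphism_def by blast

lemma map_inv: "z \<in> img c \<Longrightarrow> chart_map c (chart_inv c z) = z"
  using inv_map by auto

lemma inv_dom: "z \<in> img c \<Longrightarrow> chart_inv c z \<in> chart_dom c"
  using inv_map by auto

lemma continuous_map: "continuous_on (chart_dom c) (chart_map c)"
  and continuous_inv: "continuous_on (img c) (chart_inv c)"
  using hom unfolding homeomorphism_def by blast+

lemma open_image: "open U \<Longrightarrow> open (chart_map c ` (chart_dom c \<inter> U))"
proof -
  assume "open U"
  then have "open (img c \<inter> chart_inv c -` U)"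
    using continuous_inv open_img continuous_on_open_vimage by (metis Int_commute)
  moreover have "img c \<inter> chart_inv c -` U = chart_map c ` (chart_dom c \<inter> U)"
    using inv_map by auto
  ultimately show ?thesis by simp
qed

end

abbreviation "overlap c d \<equiv> chart_map c ` (chart_dom c \<inter> chart_dom d)"

definition "tder c d z = deriv (transition c d) z"

context
  fixes c d assumes c: "c \<in> A" and d: "d \<in> A"
begin

lemma open_overlap: "open (overlap c d)"
  using open_image[OF c open_dom[OF d]] .

lemma transition_map: "x \<in> chart_dom c \<Longrightarrow> transition c d (chart_map c x) = chart_map d x"
  by (simp add: transition_def inv_map[OF c])

lemma overlap_inv: "z \<in> overlap c d \<Longrightarrow> chart_inv c z \<in> chart_dom c \<inter> chart_dom d"
  using inv_map[OF c] by auto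

lemma transition_in: "z \<in> overlap c d \<Longrightarrow> transition c d z \<in> img d"
  by (auto simp: transition_map)

lemma inv_transition: "z \<in> overlap c d \<Longrightarrow> chart_inv d (transition c d z) = chart_inv c z"
  using overlap_inv inv_map[OF d] by (simp add: transition_def)

lemma transition_has_derivative:
  assumes z: "z \<in> overlap c d"
  shows "(transition c d has_derivative (\<lambda>v. tder c d z * v)) (at z)"
proof -
  have "transition c d holomorphic_on overlap c d"
    using RS c d unfolding riemann_surface_def by blast
  from holomorphic_derivI[OF this open_overlap z] show ?thesis
    by (simp add: has_field_derivative_def tder_def)
qed

lemma pd_transition:
  assumes z: "z \<in> overlap c d" and f: "f differentiable (at (transition c d z))"
  shows "(\<lambda>z. f (transition c d z)) differentiable (at z)" (is ?A)
    "pdx (\<lambda>z. f (transition c d z)) z =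
       Re (tder c d z) *\<^sub>R pdx f (transition c d z) + Im (tder c d z) *\<^sub>R pdy f (transition c d z)" (is ?B)
    "pdy (\<lambda>z. f (transition c d z)) z =
       Re (tder c d z) *\<^sub>R pdy f (transition c d z) - Im (tder c d z) *\<^sub>R pdx f (transition c d z)" (is ?C)
proof -
  note D = has_derivative_compose[OF transition_has_derivative[OF z] has_derivative_pd[OF f]]
  show ?A using D unfolding differentiable_def by blast
  show ?B ?C
    using pd_eqI[OF D] by simp_all
qed

lemma pd_chart_change:
  fixes f :: "'a \<Rightarrow> 'b::real_normed_vector"
  assumes z: "z \<in> overlap c d" and f: "(f \<circ> chart_inv d) differentiable (at (transition c d z))"
  shows "pdx (f \<circ> chart_inv c) z = Re (tder c d z) *\<^sub>R pdx (f \<circ> chart_inv d) (transition c d z)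
         + Im (tder c d z) *\<^sub>R pdy (f \<circ> chart_inv d) (transition c d z)" (is ?A)
    "pdy (f \<circ> chart_inv c) z = Re (tder c d z) *\<^sub>R pdy (f \<circ> chart_inv d) (transition c d z)
         - Im (tder c d z) *\<^sub>R pdx (f \<circ> chart_inv d) (transition c d z)" (is ?B)
proof -
  note t = pd_transition[OF z f]
  have eq: "(f \<circ> chart_inv d) (transition c d w) = (f \<circ> chart_inv c) w" if "w \<in> overlap c d" for w
    using inv_transition[OF that] by simp
  have "pdx (\<lambda>z. (f \<circ> chart_inv d) (transition c d z)) z = pdx (f \<circ> chart_inv c) z"
    "pdy (\<lambda>z. (f \<circ> chart_inv d) (transition c d z)) z = pdy (f \<circ> chart_inv c) z"
    by (rule pd_cong[OF open_overlap z _ t(1)], erule eq)+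
  with t(2,3) show ?A ?B
    by argo+
qed

end

end

section \<open>Isothermic surfaces in charts\<close>

lemma light_cone_snd: "v \<in> light_cone \<Longrightarrow> snd v \<noteq> 0"
  by (cases v) (auto simp: light_cone_def lor_def zero_prod_def)

lemma wedge_apply: "blinfun_apply (wedge u v) w = lor u w *\<^sub>R v - lor v w *\<^sub>R u"
proof -
  have "bounded_linear (\<lambda>w. lor u w *\<^sub>R v - lor v w *\<^sub>R u)"
    by (intro bounded_linear_sub bounded_linear_compose[OF bounded_linear_scaleR_left]
        bounded_bilinear.bounded_linear_right[OF bounded_bilinear_lor])
  then show ?thesis unfolding wedge_def by (simp add: bounded_linear_Blinfun_apply)
qed

text \<open>An element of \<open>\<Lambda> \<and> \<Lambda>\<^sup>\<bottom>\<close> has the form \<open>s \<and> t\<close> with \<open>t\<close> unique up to multiples of \<open>s\<close>.  Evaluation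
  in the time direction picks the representative without time component.\<close>

lemma wedge_space_form:
  assumes E: "E \<in> wedge_space (span {s}) (lor_perp (span {s}))" and s: "lor s s = 0" "snd s = 1"
    and t: "t = - blinfun_apply E (0, 1)"
  shows "blinfun_apply E w = lor s w *\<^sub>R t - lor t w *\<^sub>R s" (is ?A) "lor t s = 0" (is ?B) "snd t = 0" (is ?C)
proof -
  have "\<exists>t. lor t s = 0 \<and> (\<forall>w. blinfun_apply E w = lor s w *\<^sub>R t - lor t w *\<^sub>R s)"
    using E unfolding wedge_space_def
  proof (induction rule: span_induct_alt)
    case base
    show ?case by (intro exI[of _ 0]) simp
  next
    case (step k X Y)
    then obtain u v t where X: "X = wedge u v" "u \<in> span {s}" "v \<in> lor_perp (span {s})"
      and t: "lor t s = 0" "\<And>w. blinfun_apply Y w = lor s w *\<^sub>R t - lor t w *\<^sub>R s" by auto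
    obtain a where u: "u = a *\<^sub>R s" using X(2) by (auto simp: span_singleton)
    have "lor s v = 0" using X(3) span_base[of s "{s}"] by (auto simp: lor_perp_def)
    then have "lor v s = 0" by (simp add: lor_commute)
    then show ?case
      by (intro exI[of _ "(k * a) *\<^sub>R v + t"])
        (auto simp: X(1) u t plus_blinfun.rep_eq scaleR_blinfun.rep_eq wedge_apply algebra_simps)
  qed
  then obtain t' where t': "lor t' s = 0" "\<And>w. blinfun_apply E w = lor s w *\<^sub>R t' - lor t' w *\<^sub>R s" by blast
  have te: "t = t' - snd t' *\<^sub>R s" unfolding t t'(2) using s by (simp add: lor_def)
  then show ?A ?B ?C
    unfolding te using t' s by (simp_all add: algebra_simps)
qed

locale isothermic_surface = charted_surface A for A :: "'a::t2_space chart set" +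
  fixes \<Lambda> :: "'a \<Rightarrow> R41 set" and \<eta> :: "'a form"
  assumes iso: "isothermic A \<Lambda> \<eta>"
begin

text \<open>Null vectors have non-zero time component, so normalising it gives a lift on the whole surface.\<close>

definition "glift x = (THE v. v \<in> \<Lambda> x \<and> snd v = 1)"

lemma glift_local:
  assumes "local_lift A \<Lambda> U \<sigma>" "x \<in> U"
  shows "glift x = (1 / snd (\<sigma> x)) *\<^sub>R \<sigma> x" "snd (\<sigma> x) \<noteq> 0"
proof -
  have L: "\<Lambda> x = span {\<sigma> x}" "\<sigma> x \<in> light_cone" using assms by (auto simp: local_lift_def)
  show nz: "snd (\<sigma> x) \<noteq> 0" using light_cone_snd L by blast
  show "glift x = (1 / snd (\<sigma> x)) *\<^sub>R \<sigma> x" unfolding glift_def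
  proof (rule the_equality)
    show "(1 / snd (\<sigma> x)) *\<^sub>R \<sigma> x \<in> \<Lambda> x \<and> snd ((1 / snd (\<sigma> x)) *\<^sub>R \<sigma> x) = 1"
      using nz by (auto simp: L span_singleton)
    show "v = (1 / snd (\<sigma> x)) *\<^sub>R \<sigma> x" if "v \<in> \<Lambda> x \<and> snd v = 1" for v
      using that nz by (auto simp: L span_singleton divide_simps)
  qed
qed

lemma lift_at: "\<exists>U \<sigma>. x \<in> U \<and> local_lift A \<Lambda> U \<sigma>"
  using iso unfolding isothermic_def conformal_immersion_def by blast

lemma glift:
  "snd (glift x) = 1" "lor (glift x) (glift x) = 0" "\<Lambda> x = span {glift x}" "glift x \<in> light_cone"
proof -
  obtain U \<sigma> where U: "x \<in> U" "local_lift A \<Lambda> U \<sigma>" using lift_at by blast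
  note g = glift_local[OF U(2,1)]
  have L: "\<Lambda> x = span {\<sigma> x}" "\<sigma> x \<in> light_cone" using U by (auto simp: local_lift_def)
  show "snd (glift x) = 1" using g by simp
  show l: "lor (glift x) (glift x) = 0" using g L by (simp add: light_cone_def)
  show "glift x \<in> light_cone" using l g L by (auto simp: light_cone_def)
  have "span {glift x} = span {\<sigma> x}"
    unfolding g(1) using g(2) by (intro span_image_scale[of "{\<sigma> x}" "\<lambda>_. 1 / snd (\<sigma> x)", simplified]) auto
  then show "\<Lambda> x = span {glift x}" using L by simp
qed

lemma smooth_glift: "smooth_map_on A UNIV glift"
  unfolding smooth_map_on_def
proof
  fix c assume c: "c \<in> A"
  show "smooth_on (glift \<circ> chart_inv c) (chart_map c ` (chart_dom c \<inter> UNIV))"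
  proof (rule smooth_on_local)
    fix z assume "z \<in> chart_map c ` (chart_dom c \<inter> UNIV)"
    then have z: "z \<in> img c" by simp
    obtain U \<sigma> where U: "chart_inv c z \<in> U" "local_lift A \<Lambda> U \<sigma>" using lift_at by blast
    let ?T = "chart_map c ` (chart_dom c \<inter> U)"
    have T: "open ?T" using open_image[OF c] U by (auto simp: local_lift_def)
    have s: "smooth_on (\<sigma> \<circ> chart_inv c) ?T"
      using U c by (auto simp: local_lift_def smooth_map_on_def)
    have inU: "chart_inv c w \<in> U" if "w \<in> ?T" for w using that inv_map[OF c] by auto
    have "smooth_on (\<lambda>w. (1 / snd ((\<sigma> \<circ> chart_inv c) w)) *\<^sub>R (\<sigma> \<circ> chart_inv c) w) ?T"
      by (intro smooth_intros s) (use glift_local(2)[OF U(2)] inU in auto)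
    then have "smooth_on (glift \<circ> chart_inv c) ?T"
      by (rule smooth_on_cong[OF T, rotated]) (use glift_local(1)[OF U(2)] inU in auto)
    moreover have "z \<in> ?T" using z U(1) map_inv[OF c z] inv_dom[OF c z] by (metis IntI imageI)
    ultimately show "\<exists>T. open T \<and> z \<in> T \<and> smooth_on (glift \<circ> chart_inv c) T" using T by blast
  qed
qed

definition "lft c = glift \<circ> chart_inv c"
definition "tau1 c z = - blinfun_apply (blinfun_apply (\<eta> c (chart_inv c z)) 1) (0, 1)"
definition "tau2 c z = - blinfun_apply (blinfun_apply (\<eta> c (chart_inv c z)) \<i>) (0, 1)"

lemma eta_apply:
  "blinfun_apply (\<eta> c x) v = Re v *\<^sub>R blinfun_apply (\<eta> c x) 1 + Im v *\<^sub>R blinfun_apply (\<eta> c x) \<i>"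
proof -
  have v: "v = Re v *\<^sub>R 1 + Im v *\<^sub>R \<i>" by (simp add: complex_eq_iff)
  have "blinfun_apply (\<eta> c x) v = blinfun_apply (\<eta> c x) (Re v *\<^sub>R 1 + Im v *\<^sub>R \<i>)" using v by simp
  then show ?thesis by (simp only: blinfun.add_right blinfun.scaleR_right)
qed

context
  fixes c assumes c: "c \<in> A"
begin

lemma smooth_lft: "smooth_on (lft c) (img c)"
  using smooth_glift c by (auto simp: smooth_map_on_def lft_def)

lemma eta_form:
  assumes z: "z \<in> img c"
  shows "blinfun_apply (blinfun_apply (\<eta> c (chart_inv c z)) 1) w = lor (lft c z) w *\<^sub>R tau1 c z - lor (tau1 c z) w *\<^sub>R lft c z" (is ?A)
    "blinfun_apply (blinfun_apply (\<eta> c (chart_inv c z)) \<i>) w = lor (lft c z) w *\<^sub>R tau2 c z - lor (tau2 c z) w *\<^sub>R lft c z" (is ?B)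
    "lor (tau1 c z) (lft c z) = 0" (is ?C) "lor (tau2 c z) (lft c z) = 0" (is ?D) "snd (tau1 c z) = 0" (is ?E) "snd (tau2 c z) = 0" (is ?F)
proof -
  have "blinfun_apply (\<eta> c (chart_inv c z)) v \<in> wedge_space (\<Lambda> (chart_inv c z)) (lor_perp (\<Lambda> (chart_inv c z)))" for v
    using iso c inv_dom[OF c z] unfolding isothermic_def by blast
  moreover have "span {lft c z} = \<Lambda> (chart_inv c z)"
    by (simp only: lft_def o_apply glift(3)[symmetric])
  ultimately have E: "blinfun_apply (\<eta> c (chart_inv c z)) v \<in> wedge_space (span {lft c z}) (lor_perp (span {lft c z}))" for v
    by (simp only:)
  have s: "lor (lft c z) (lft c z) = 0" "snd (lft c z) = 1" by (simp_all add: lft_def glift)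
  note w = wedge_space_form[OF E s]
  show ?A ?B
    by (rule w(1), simp only: tau1_def tau2_def)+
  show ?C ?D
    by (rule w(2), simp only: tau1_def tau2_def)+
  show ?E ?F
    by (rule w(3), simp only: tau1_def tau2_def)+
qed

lemma null_lift_chart: "null_lift (img c) (lft c)"
proof
  fix z assume z: "z \<in> img c"
  have loc: "local_lift A \<Lambda> UNIV glift"
    using smooth_glift glift by (simp add: local_lift_def)
  have x: "chart_inv c z \<in> UNIV \<inter> chart_dom c" "chart_map c (chart_inv c z) = z"
    using inv_dom[OF c z] map_inv[OF c z] by auto
  have dif: "dif c glift (chart_inv c z) 1 = pdx (lft c) z" "dif c glift (chart_inv c z) \<i> = pdy (lft c) z"
    by (simp_all add: dif_def pdx_def pdy_def lft_def x(2))
  obtain \<rho> where r: "\<rho> > 0" "\<And>v w. lor (dif c glift (chart_inv c z) v) (dif c glift (chart_inv c z) w) = \<rho> * (v \<bullet> w)"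
    using iso loc c x(1) unfolding isothermic_def conformal_immersion_def by meson
  show "lor (lft c z) (lft c z) = 0" "snd (lft c z) = 1" by (simp_all add: lft_def glift)
  show "lor (pdy (lft c) z) (pdy (lft c) z) = lor (pdx (lft c) z) (pdx (lft c) z)"
    "lor (pdx (lft c) z) (pdy (lft c) z) = 0" "lor (pdx (lft c) z) (pdx (lft c) z) > 0"
    using r unfolding dif[symmetric] by (simp_all add: inner_complex_def)
qed (use open_img[OF c] smooth_lft in auto)

text \<open>The two conditions on \<open>t1\<close> and \<open>t2\<close> come from closedness of \<open>\<eta>\<close>, evaluated first on the time
  direction and then on an arbitrary vector.\<close>

lemma isothermic_patch_chart: "isothermic_patch (img c) (lft c) (tau1 c) (tau2 c)"
proof -
  interpret null_lift "img c" "lft c" by (rule null_lift_chart)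
  let ?E = "\<eta> c \<circ> chart_inv c"
  have sE: "smooth_on ?E (img c)" using iso c unfolding isothermic_def one_form_def by blast
  have t: "tau1 c = (\<lambda>z. - blinfun_apply (blinfun_apply (?E z) 1) (0, 1))"
    "tau2 c = (\<lambda>z. - blinfun_apply (blinfun_apply (?E z) \<i>) (0, 1))"
    by (auto simp: tau1_def tau2_def)
  have st: "smooth_on (tau1 c) (img c)" "smooth_on (tau2 c) (img c)"
    unfolding t by (intro smooth_intros sE)+
  have dE: "?E differentiable (at z)" if "z \<in> img c" for z using diffV[OF sE that] .
  have bl: "bounded_linear (\<lambda>E. blinfun_apply (blinfun_apply E v) w)" for v :: complex and w :: R41
    by (intro bounded_linear_compose[OF blinfun.bounded_linear_left blinfun.bounded_linear_left])
  have cl: "blinfun_apply (blinfun_apply (pdx ?E z) \<i>) w = blinfun_apply (blinfun_apply (pdy ?E z) 1) w"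
    if z: "z \<in> img c" for z w
  proof -
    have "blinfun_apply (dif c (\<eta> c) (chart_inv c z) 1) \<i> - blinfun_apply (dif c (\<eta> c) (chart_inv c z) \<i>) 1 = 0"
      using iso c inv_dom[OF c z] unfolding isothermic_def closed_form_def by blast
    then show ?thesis by (simp add: dif_def pdx_def pdy_def map_inv[OF c z])
  qed
  have clw: "pdx (\<lambda>z. blinfun_apply (blinfun_apply (?E z) \<i>) w) z = pdy (\<lambda>z. blinfun_apply (blinfun_apply (?E z) 1) w) z"
    if z: "z \<in> img c" for z w
    using bounded_linear.pd_compose[OF bl dE[OF z]] cl[OF z] by simp
  have closed: "pdx (tau2 c) z = pdy (tau1 c) z" if z: "z \<in> img c" for z
  proof -
    have d: "(\<lambda>z. blinfun_apply (blinfun_apply (?E z) v) w) differentiable (at z)" for v w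
      by (intro diffV[OF _ z] smooth_intros sE)
    show ?thesis unfolding t using pd_minus[OF d] clw[OF z] by simp
  qed
  show ?thesis
  proof
    fix z w assume z: "z \<in> img c"
    note F = eta_form[unfolded o_def]
    have dt: "tau1 c differentiable (at z)" "tau2 c differentiable (at z)" using diffV[OF st(1) z] diffV[OF st(2) z] .
    have d: "(\<lambda>z. blinfun_apply (blinfun_apply (?E z) v) w) differentiable (at z)" for v
      by (intro diffV[OF _ z] smooth_intros sE)
    have 1: "pdy (\<lambda>z. blinfun_apply (blinfun_apply (?E z) 1) w) z =
       pdy (\<lambda>z. lor (lft c z) w *\<^sub>R tau1 c z - lor (tau1 c z) w *\<^sub>R lft c z) z"
      by (rule pd_cong[OF openV z _ d]) (use eta_form(1) in simp)
    have 2: "pdx (\<lambda>z. blinfun_apply (blinfun_apply (?E z) \<i>) w) z =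
       pdx (\<lambda>z. lor (lft c z) w *\<^sub>R tau2 c z - lor (tau2 c z) w *\<^sub>R lft c z) z"
      by (rule pd_cong[OF openV z _ d]) (use eta_form(2) in simp)
    note bw = bounded_bilinear.bounded_linear_left[OF bounded_bilinear_lor]
    note pw = bounded_linear.pd_compose[OF bw]
    note sc = bounded_bilinear.pd_prod[OF bounded_bilinear_scaleR]
    have dl: "(\<lambda>z. lor (lft c z) w) differentiable (at z)" "(\<lambda>z. lor (tau1 c z) w) differentiable (at z)"
      "(\<lambda>z. lor (tau2 c z) w) differentiable (at z)"
      by (intro differentiable_lor diff_lift(1)[OF z] dt differentiable_const)+
    have ds: "(\<lambda>z. lor (lft c z) w *\<^sub>R tau1 c z) differentiable (at z)" "(\<lambda>z. lor (tau1 c z) w *\<^sub>R lft c z) differentiable (at z)"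
       "(\<lambda>z. lor (lft c z) w *\<^sub>R tau2 c z) differentiable (at z)" "(\<lambda>z. lor (tau2 c z) w *\<^sub>R lft c z) differentiable (at z)"
      by (intro differentiable_scaleR dl dt diff_lift(1)[OF z])+
    show "lor (pdx (lft c) z) w *\<^sub>R tau2 c z - lor (tau2 c z) w *\<^sub>R pdx (lft c) z =
      lor (pdy (lft c) z) w *\<^sub>R tau1 c z - lor (tau1 c z) w *\<^sub>R pdy (lft c) z"
      using clw[OF z, of w] unfolding 1 2 pd_diff[OF ds(1,2)] pd_diff[OF ds(3,4)] sc[OF dl(1) dt(1)] sc[OF dl(1) dt(2)]
        sc[OF dl(2) diff_lift(1)[OF z]] sc[OF dl(3) diff_lift(1)[OF z]] pw[OF diff_lift(1)[OF z]] pw[OF dt(1)] pw[OF dt(2)]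
        closed[OF z]
      by (simp add: algebra_simps)
  qed (use st eta_form closed in auto)
qed

end

end

section \<open>Change of charts\<close>

context isothermic_surface
begin

text \<open>The coefficient in the chart \<open>c\<close> of the holomorphic quadratic differential of \<open>\<eta>\<close>.\<close>

definition "hopf c z = Complex (lor (tau1 c z) (pdx (lft c) z)) (- lor (tau1 c z) (pdy (lft c) z))"

lemma hopf_holomorphic: "c \<in> A \<Longrightarrow> hopf c holomorphic_on img c"
proof -
  assume c: "c \<in> A"
  interpret C: isothermic_patch "img c" "lft c" "tau1 c" "tau2 c" by (rule isothermic_patch_chart[OF c])
  have "C.q = hopf c" by (auto simp: C.q_def C.qre_def C.qim_def hopf_def)
  then show ?thesis using C.q_holomorphic by simp
qed

context
  fixes c d assumes c: "c \<in> A" and d: "d \<in> A"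
begin

interpretation C: isothermic_patch "img c" "lft c" "tau1 c" "tau2 c" by (rule isothermic_patch_chart[OF c])
interpretation D: isothermic_patch "img d" "lft d" "tau1 d" "tau2 d" by (rule isothermic_patch_chart[OF d])

lemma frame_change:
  assumes z: "z \<in> overlap c d"
  shows "lft c z = lft d (transition c d z)" (is ?A)
    "pdx (lft c) z = Re (tder c d z) *\<^sub>R pdx (lft d) (transition c d z) + Im (tder c d z) *\<^sub>R pdy (lft d) (transition c d z)" (is ?B)
    "pdy (lft c) z = Re (tder c d z) *\<^sub>R pdy (lft d) (transition c d z) - Im (tder c d z) *\<^sub>R pdx (lft d) (transition c d z)" (is ?C)
    "tau1 c z = Re (tder c d z) *\<^sub>R tau1 d (transition c d z) + Im (tder c d z) *\<^sub>R tau2 d (transition c d z)" (is ?D)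
    "tau2 c z = Re (tder c d z) *\<^sub>R tau2 d (transition c d z) - Im (tder c d z) *\<^sub>R tau1 d (transition c d z)" (is ?E)
proof -
  have w: "transition c d z \<in> img d" by (rule transition_in[OF c d z])
  show ?A by (simp add: lft_def inv_transition[OF c d z])
  have "(glift \<circ> chart_inv d) differentiable (at (transition c d z))"
    using D.diff_lift(1)[OF w] unfolding lft_def .
  from pd_chart_change[OF c d z this]
  show ?B ?C
    unfolding lft_def .
  have x: "chart_inv c z \<in> chart_dom c \<inter> chart_dom d" by (rule overlap_inv[OF c d z])
  then have zc: "chart_map c (chart_inv c z) = z" using z map_inv[OF c] by blast
  have "\<forall>v. blinfun_apply (\<eta> c (chart_inv c z)) v =
      blinfun_apply (\<eta> d (chart_inv c z)) (deriv (transition c d) (chart_map c (chart_inv c z)) * v)"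
    using iso c d x unfolding isothermic_def one_form_def by blast
  then have e: "blinfun_apply (\<eta> c (chart_inv c z)) v = blinfun_apply (\<eta> d (chart_inv c z)) (tder c d z * v)" for v
    unfolding zc tder_def by blast
  have e1: "blinfun_apply (\<eta> c (chart_inv c z)) 1 = Re (tder c d z) *\<^sub>R blinfun_apply (\<eta> d (chart_inv c z)) 1
      + Im (tder c d z) *\<^sub>R blinfun_apply (\<eta> d (chart_inv c z)) \<i>"
    using e[of 1] eta_apply[of d "chart_inv c z" "tder c d z"] by simp
  have e2: "blinfun_apply (\<eta> c (chart_inv c z)) \<i> = (- Im (tder c d z)) *\<^sub>R blinfun_apply (\<eta> d (chart_inv c z)) 1
      + Re (tder c d z) *\<^sub>R blinfun_apply (\<eta> d (chart_inv c z)) \<i>"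
    using e[of \<i>] eta_apply[of d "chart_inv c z" "tder c d z * \<i>"] by simp
  have i: "chart_inv d (transition c d z) = chart_inv c z" by (rule inv_transition[OF c d z])
  show ?D
    unfolding tau1_def tau2_def i e1
    by (simp add: blinfun.add_left blinfun.scaleR_left)
  show ?E
    unfolding tau1_def tau2_def i e2
    by (simp add: blinfun.add_left blinfun.diff_left blinfun.scaleR_left)
qed

lemma rho_change:
  assumes z: "z \<in> overlap c d"
  shows "C.rho z = ((Re (tder c d z))\<^sup>2 + (Im (tder c d z))\<^sup>2) * D.rho (transition c d z)"
  unfolding C.rho_def frame_change(2)[OF z]
  by (simp add: D.frame_products[OF transition_in[OF c d z]] algebra_simps power2_eq_square)

lemma tder_nonzero:
  assumes z: "z \<in> overlap c d"
  shows "(Re (tder c d z))\<^sup>2 + (Im (tder c d z))\<^sup>2 > 0" "tder c d z \<noteq> 0"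
proof -
  have "z \<in> img c" using z by blast
  then have "C.rho z > 0" by (rule C.rho_pos)
  then show "(Re (tder c d z))\<^sup>2 + (Im (tder c d z))\<^sup>2 > 0"
    unfolding rho_change[OF z] using D.rho_pos[OF transition_in[OF c d z]] by (simp add: zero_less_mult_iff)
  then show "tder c d z \<noteq> 0" by auto
qed

text \<open>The change of charts multiplies the cross product and the conformal factor by the same positive
  number.\<close>

lemma normal_change:
  assumes z: "z \<in> overlap c d"
  shows "C.normal z = D.normal (transition c d z)"
  unfolding C.normal_def D.normal_def rho_change[OF z] unfolding frame_change(1-3)[OF z]
  using cross4_rotate tder_nonzero(1)[OF z] by auto

lemma hopf_change:
  assumes z: "z \<in> overlap c d"
  shows "hopf c z = (tder c d z)\<^sup>2 * hopf d (transition c d z)"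
proof -
  note lt = D.lor_t_tangent[OF transition_in[OF c d z]]
  have "lor (tau1 c z) (pdx (lft c) z) = ((Re (tder c d z))\<^sup>2 - (Im (tder c d z))\<^sup>2) * D.qre (transition c d z)
      + 2 * Re (tder c d z) * Im (tder c d z) * D.qim (transition c d z)"
    "lor (tau1 c z) (pdy (lft c) z) = ((Re (tder c d z))\<^sup>2 - (Im (tder c d z))\<^sup>2) * D.qim (transition c d z)
      - 2 * Re (tder c d z) * Im (tder c d z) * D.qre (transition c d z)"
    unfolding frame_change(2,3,4)[OF z] by (simp_all add: lt algebra_simps power2_eq_square)
  then show ?thesis
    unfolding hopf_def D.qre_def[symmetric] D.qim_def[symmetric]
    by (simp add: complex_eq_iff power2_eq_square algebra_simps)
qed

lemma conserved_change:
  assumes P: "D.conserved (img d) r P"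
  shows "C.conserved (overlap c d) r (\<lambda>k z. P k (transition c d z))"
  unfolding C.conserved_def
proof (intro ballI conjI allI)
  fix z k assume z: "z \<in> overlap c d"
  let ?w = "transition c d z"
  have w: "?w \<in> img d" by (rule transition_in[OF c d z])
  note cP = P[unfolded D.conserved_def, rule_format, OF w]
  have E: "C.E1 z v = Re (tder c d z) *\<^sub>R D.E1 ?w v + Im (tder c d z) *\<^sub>R D.E2 ?w v"
    "C.E2 z v = Re (tder c d z) *\<^sub>R D.E2 ?w v - Im (tder c d z) *\<^sub>R D.E1 ?w v" for v
    unfolding C.E1_def C.E2_def D.E1_def D.E2_def frame_change(1,4,5)[OF z]
    by (simp_all add: algebra_simps)
  show "C.E1 z (P 0 ?w) = 0" "C.E2 z (P 0 ?w) = 0" using cP by (simp_all add: E)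
  have dP: "P k differentiable (at ?w)" using cP by blast
  note t = pd_transition[OF c d z dP]
  show "(\<lambda>z. P k (transition c d z)) differentiable at z" by (rule t(1))
  show "pdx (\<lambda>z. P k (transition c d z)) z = - C.E1 z (P (Suc k) ?w)"
    "pdy (\<lambda>z. P k (transition c d z)) z = - C.E2 z (P (Suc k) ?w)"
    unfolding t E using cP by simp_all
  show "(\<Sum>i\<le>k. lor (P i ?w) (P (k - i) ?w)) = r k" using cP by blast
qed

end

section \<open>The quadratic differential has no zeros on a torus\<close>

lemma open_preimage: "c \<in> A \<Longrightarrow> open S \<Longrightarrow> open (chart_dom c \<inter> chart_map c -` S)"
  using continuous_open_preimage[OF continuous_map open_dom] by blast

definition "hopf_zero x \<longleftrightarrow> (\<exists>c\<in>A. x \<in> chart_dom c \<and> hopf c (chart_map c x) = 0)"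

lemma hopf_zero_iff:
  assumes c: "c \<in> A" "x \<in> chart_dom c"
  shows "hopf_zero x \<longleftrightarrow> hopf c (chart_map c x) = 0"
proof
  assume "hopf_zero x"
  then obtain d where d: "d \<in> A" "x \<in> chart_dom d" "hopf d (chart_map d x) = 0"
    unfolding hopf_zero_def by blast
  have "chart_map c x \<in> overlap c d" using c d by blast
  from hopf_change[OF c(1) d(1) this] show "hopf c (chart_map c x) = 0"
    using d(3) transition_map[OF c(1) d(1) c(2)] by simp
qed (use c in \<open>auto simp: hopf_zero_def\<close>)

text \<open>The interior of the zero set is also closed, by the identity theorem in connected coordinate
  neighbourhoods.  If it were not empty it would be the whole surface, and then \<open>\<eta>\<close> would vanish.\<close>

lemma hopf_not_locally_zero:
  assumes c: "c \<in> A" and w0: "w0 \<in> img c"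
  shows "\<not> eventually (\<lambda>w. hopf c w = 0) (nhds w0)"
proof
  assume ev: "eventually (\<lambda>w. hopf c w = 0) (nhds w0)"
  define I where "I = interior {x. hopf_zero x}"
  have "closure I \<subseteq> I"
  proof
    fix x assume x: "x \<in> closure I"
    obtain d where d: "d \<in> A" "x \<in> chart_dom d" using chart_at by blast
    obtain r where r: "r > 0" "ball (chart_map d x) r \<subseteq> img d"
      using open_img[OF d(1)] d(2) open_contains_ball by blast
    define T where "T = chart_dom d \<inter> chart_map d -` ball (chart_map d x) r"
    have T: "open T" "x \<in> T" unfolding T_def using open_preimage[OF d(1)] d r by auto
    have "T \<inter> I \<noteq> {}" using open_Int_closure_eq_empty[OF T(1), of I] T(2) x by blast
    have oI: "open (T \<inter> I)" using T(1) by (intro open_Int) (simp_all add: I_def)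
    let ?S = "chart_map d ` (chart_dom d \<inter> (T \<inter> I))"
    have S: "open ?S" "?S \<noteq> {}" "?S \<subseteq> ball (chart_map d x) r"
      using open_image[OF d(1) oI] \<open>T \<inter> I \<noteq> {}\<close> by (auto simp: T_def)
    have zS: "hopf d w = 0" if "w \<in> ?S" for w
      using that hopf_zero_iff[OF d(1)] interior_subset[of "{x. hopf_zero x}"] by (auto simp: I_def)
    have zB: "hopf d w = 0" if "w \<in> ball (chart_map d x) r" for w
      by (rule analytic_continuation_open[OF S(1) open_ball S(2) _ S(3), where g = "\<lambda>_. 0"])
        (use zS that hopf_holomorphic[OF d(1)] r holomorphic_on_subset in auto)
    have "T \<subseteq> {x. hopf_zero x}" using zB hopf_zero_iff[OF d(1)] by (auto simp: T_def)
    then show "x \<in> I" unfolding I_def using T interior_maximal by blast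
  qed
  then have "closed I" using closure_subset closure_eq by blast
  moreover have "open I" by (simp add: I_def)
  ultimately have "I = {} \<or> I = UNIV"
    using connected_UNIV_surface unfolding connected_clopen by (simp add: open_openin[symmetric] closed_closedin[symmetric])
  moreover have "I \<noteq> {}"
  proof -
    obtain S where S: "open S" "w0 \<in> S" "\<forall>w\<in>S. hopf c w = 0"
      using ev unfolding eventually_nhds by blast
    have "chart_dom c \<inter> chart_map c -` S \<subseteq> {x. hopf_zero x}"
      using S hopf_zero_iff[OF c] by auto
    then have "chart_dom c \<inter> chart_map c -` S \<subseteq> I"
      unfolding I_def using open_preimage[OF c S(1)] interior_maximal by blast
    moreover have "chart_inv c w0 \<in> chart_dom c \<inter> chart_map c -` S"
      using inv_dom[OF c w0] map_inv[OF c w0] S by simp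
    ultimately show ?thesis by blast
  qed
  ultimately have all: "hopf_zero x" for x using interior_subset[of "{x. hopf_zero x}"] by (auto simp: I_def)
  obtain d x where d: "d \<in> A" "x \<in> chart_dom d" "\<eta> d x \<noteq> 0" using iso unfolding isothermic_def by blast
  interpret D: isothermic_patch "img d" "lft d" "tau1 d" "tau2 d" by (rule isothermic_patch_chart[OF d(1)])
  have z: "chart_map d x \<in> img d" "chart_inv d (chart_map d x) = x" using d inv_map by auto
  have "hopf d (chart_map d x) = 0" using all hopf_zero_iff[OF d(1,2)] by blast
  then have "D.qre (chart_map d x) = 0" "D.qim (chart_map d x) = 0"
    by (auto simp: hopf_def D.qre_def D.qim_def complex_eq_iff)
  then have t: "tau1 d (chart_map d x) = 0" "tau2 d (chart_map d x) = 0"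
    using D.t_eq[OF z(1)] by simp_all
  have e: "blinfun_apply (\<eta> d x) 1 = 0" "blinfun_apply (\<eta> d x) \<i> = 0"
    using eta_form(1,2)[OF d(1) z(1)] unfolding z(2) t by (auto intro!: blinfun_eqI)
  have "blinfun_apply (\<eta> d x) v = 0" for v by (subst eta_apply) (simp add: e)
  then have "\<eta> d x = 0" by (intro blinfun_eqI) simp
  then show False using d by simp
qed

text \<open>\<open>H\<close> is the value of the quadratic differential on the image of the coordinate field \<open>\<partial>\<^sub>x\<close> under the
  covering map.  It is doubly periodic, its zeros are those of the quadratic differential, and near
  each of them its Jacobian has the sign of that of the covering map.\<close>

theorem hopf_nonzero_on_torus:
  assumes torus: "two_torus A" and c: "c \<in> A" "w \<in> img c"
  shows "hopf c w \<noteq> 0"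
proof -
  obtain \<pi> :: "complex \<Rightarrow> 'a" where pi: "surj \<pi>"
    and fib: "\<And>z w. \<pi> z = \<pi> w \<longleftrightarrow> Re (z - w) \<in> \<int> \<and> Im (z - w) \<in> \<int>"
    and cont: "continuous_on UNIV \<pi>"
    and sm: "\<And>c. c \<in> A \<Longrightarrow> smooth_on (chart_map c \<circ> \<pi>) (\<pi> -` chart_dom c)"
    and bij: "\<And>c z. c \<in> A \<Longrightarrow> z \<in> \<pi> -` chart_dom c \<Longrightarrow> bij (frechet_derivative (chart_map c \<circ> \<pi>) (at z))"
    using torus unfolding two_torus_def by blast
  define \<phi> where "\<phi> c = chart_map c \<circ> \<pi>" for c
  have oN: "open (\<pi> -` chart_dom c)" if "c \<in> A" for c
    using open_vimage[OF open_dom[OF that] cont] .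
  have smp: "smooth_on (\<phi> c) (\<pi> -` chart_dom c)" if "c \<in> A" for c using sm[OF that] by (simp add: \<phi>_def)
  have dp: "\<phi> c differentiable (at z)" if "c \<in> A" "\<pi> z \<in> chart_dom c" for c z
    using smooth_on_imp_differentiable[OF smp[OF that(1)] oN[OF that(1)]] that by auto
  have jnz: "jac (\<phi> c) z \<noteq> 0" if "c \<in> A" "\<pi> z \<in> chart_dom c" for c z
    by (rule jac_nonzero) (use bij dp that in \<open>auto simp: \<phi>_def\<close>)
  have im: "\<phi> c ` (\<pi> -` chart_dom c) \<subseteq> img c" for c by (auto simp: \<phi>_def)
  \<comment> \<open>Both partial derivatives are multiplied by the same complex number, so the sign of the Jacobian
    does not depend on the chart.\<close>
  have change: "pdx (\<phi> d) z = tder c d (\<phi> c z) * pdx (\<phi> c) z" "pdy (\<phi> d) z = tder c d (\<phi> c z) * pdy (\<phi> c) z"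
    and ov: "\<phi> c z \<in> overlap c d" and tr: "transition c d (\<phi> c z) = \<phi> d z"
    if cd: "c \<in> A" "d \<in> A" and z: "\<pi> z \<in> chart_dom c" "\<pi> z \<in> chart_dom d" for c d z
  proof -
    show ov: "\<phi> c z \<in> overlap c d" using z by (auto simp: \<phi>_def)
    show "transition c d (\<phi> c z) = \<phi> d z" using transition_map[OF cd z(1)] by (simp add: \<phi>_def)
    let ?N = "\<pi> -` chart_dom c \<inter> \<pi> -` chart_dom d"
    have N: "open ?N" "z \<in> ?N" using open_Int[OF oN[OF cd(1)] oN[OF cd(2)]] z by auto
    have eq: "\<phi> d w = transition c d (\<phi> c w)" if "w \<in> ?N" for w
      using transition_map[OF cd] that by (simp add: \<phi>_def)
    note D = has_derivative_compose[OF has_derivative_pd[OF dp[OF cd(1) z(1)]] transition_has_derivative[OF cd ov]]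
    have "pdx (\<phi> d) z = pdx (\<lambda>w. transition c d (\<phi> c w)) z" "pdy (\<phi> d) z = pdy (\<lambda>w. transition c d (\<phi> c w)) z"
      using pd_cong[OF N eq dp[OF cd(2) z(2)]] by auto
    then show "pdx (\<phi> d) z = tder c d (\<phi> c z) * pdx (\<phi> c) z" "pdy (\<phi> d) z = tder c d (\<phi> c z) * pdy (\<phi> c) z"
      using pd_eqI[OF D] by simp_all
  qed
  have jch: "jac (\<phi> d) z = (norm (tder c d (\<phi> c z)))\<^sup>2 * jac (\<phi> c) z"
    if cd: "c \<in> A" "d \<in> A" and z: "\<pi> z \<in> chart_dom c" "\<pi> z \<in> chart_dom d" for c d z
  proof -
    let ?t = "tder c d (\<phi> c z)"
    have "cnj (pdx (\<phi> d) z) * pdy (\<phi> d) z = (?t * cnj ?t) * (cnj (pdx (\<phi> c) z) * pdy (\<phi> c) z)"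
      unfolding change[OF that] by (simp add: mult_ac)
    also have "?t * cnj ?t = of_real ((norm ?t)\<^sup>2)" by (rule complex_norm_square[symmetric])
    finally show ?thesis unfolding jac_def by (simp only: Im_complex_of_real times_complex.sel Re_complex_of_real mult_zero_left add_0_right)
  qed
  \<comment> \<open>The plane is connected, so the sign is the same everywhere.\<close>
  obtain sg :: real where sg: "\<And>c z. c \<in> A \<Longrightarrow> \<pi> z \<in> chart_dom c \<Longrightarrow> sg * jac (\<phi> c) z > 0"
  proof -
    define S where "S sg = {z. \<exists>c\<in>A. \<pi> z \<in> chart_dom c \<and> sg * jac (\<phi> c) z > 0}" for sg :: real
    have oS: "open (S sg)" for sg
    proof -
      have "S sg = (\<Union>c\<in>A. {z \<in> \<pi> -` chart_dom c. sg * jac (\<phi> c) z > 0})" by (auto simp: S_def)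
      moreover have "open {z \<in> \<pi> -` chart_dom c. sg * jac (\<phi> c) z > 0}" if c: "c \<in> A" for c
      proof -
        have "continuous_on (\<pi> -` chart_dom c) (pdx (\<phi> c))" "continuous_on (\<pi> -` chart_dom c) (pdy (\<phi> c))"
          using smooth_on_pdx[OF smp[OF c] oN[OF c]] smooth_on_pdy[OF smp[OF c] oN[OF c]]
          by (auto intro: smooth_on_imp_continuous_on)
        then have "continuous_on (\<pi> -` chart_dom c) (\<lambda>z. sg * jac (\<phi> c) z)"
          unfolding jac_def by (intro continuous_intros)
        from continuous_open_preimage[OF this oN[OF c] open_greaterThan[of 0]]
        show ?thesis by (simp add: vimage_def Int_def)
      qed
      ultimately show ?thesis by auto
    qed
    have all: "sg * jac (\<phi> d) z > 0" if z: "z \<in> S sg" and d: "d \<in> A" "\<pi> z \<in> chart_dom d" for z d sg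
    proof -
      obtain c where c: "c \<in> A" "\<pi> z \<in> chart_dom c" "sg * jac (\<phi> c) z > 0" using z by (auto simp: S_def)
      have "(norm (tder c d (\<phi> c z)))\<^sup>2 > 0"
        using tder_nonzero(2)[OF c(1) d(1) ov[OF c(1) d(1) c(2) d(2)]] by simp
      then have "(norm (tder c d (\<phi> c z)))\<^sup>2 * (sg * jac (\<phi> c) z) > 0" using c(3) by simp
      then show ?thesis unfolding jch[OF c(1) d(1) c(2) d(2)] by (simp add: mult.left_commute)
    qed
    have cover: "S 1 \<union> S (-1) = UNIV"
    proof -
      have "z \<in> S 1 \<union> S (-1)" for z
      proof -
        obtain c where c: "c \<in> A" "\<pi> z \<in> chart_dom c" using chart_at by blast
        have "jac (\<phi> c) z > 0 \<or> - jac (\<phi> c) z > 0" using jnz[OF c] by linarith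
        then show ?thesis using c by (auto simp: S_def)
      qed
      then show ?thesis by auto
    qed
    have "S 1 \<inter> S (-1) = {}"
    proof -
      have False if "z \<in> S 1" "z \<in> S (-1)" for z
      proof -
        obtain c where c: "c \<in> A" "\<pi> z \<in> chart_dom c" using chart_at by blast
        then show False using all[OF that(1) c] all[OF that(2) c] by simp
      qed
      then show ?thesis by auto
    qed
    then have "S 1 = {} \<or> S (-1) = {}"
      using connectedD[OF connected_UNIV oS[of 1] oS[of "-1"]] cover by auto
    then have "S 1 = UNIV \<or> S (-1) = UNIV" using cover by auto
    then show ?thesis
    proof
      assume "S 1 = UNIV"
      then show ?thesis using that[of 1] all[of _ 1] by auto
    next
      assume "S (-1) = UNIV"
      then show ?thesis using that[of "-1"] all[of _ "-1"] by auto
    qed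
  qed
  define ch where "ch z = (SOME c. c \<in> A \<and> \<pi> z \<in> chart_dom c)" for z
  have ch: "ch z \<in> A" "\<pi> z \<in> chart_dom (ch z)" for z
    using someI_ex[of "\<lambda>c. c \<in> A \<and> \<pi> z \<in> chart_dom c"] chart_at[of "\<pi> z"] unfolding ch_def by blast+
  define H where "H z = hopf (ch z) (\<phi> (ch z) z) * (pdx (\<phi> (ch z)) z)\<^sup>2" for z
  have H: "H z = hopf d (\<phi> d z) * (pdx (\<phi> d) z)\<^sup>2" if d: "d \<in> A" "\<pi> z \<in> chart_dom d" for d z
    unfolding H_def change(1)[OF ch(1) d(1) ch(2) d(2)] hopf_change[OF ch(1) d(1) ov[OF ch(1) d(1) ch(2) d(2)]]
      tr[OF ch(1) d(1) ch(2) d(2)] by (simp add: power_mult_distrib)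
  have smH: "smooth_on H UNIV"
  proof (rule smooth_on_local)
    fix z
    let ?N = "\<pi> -` chart_dom (ch z)"
    have "smooth_on (\<lambda>w. hopf (ch z) (\<phi> (ch z) w) * (pdx (\<phi> (ch z)) w)\<^sup>2) ?N"
      by (intro smooth_on_mult smooth_on_power smooth_on_pdx smp oN ch(1)
          smooth_on_holomorphic_compose[OF hopf_holomorphic[OF ch(1)] open_img[OF ch(1)] _ im])
    then have "smooth_on H ?N"
      by (rule smooth_on_cong[OF oN[OF ch(1)], rotated]) (use H[OF ch(1)] in auto)
    then show "\<exists>T. open T \<and> z \<in> T \<and> smooth_on H T" using oN[OF ch(1)] ch(2) by blast
  qed
  have per1: "H (z + a) = H z" if a: "Re a \<in> \<int>" "Im a \<in> \<int>" for z a
  proof -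
    have pa: "\<pi> (w + a) = \<pi> w" for w using fib[of "w + a" w] a by simp
    have d: "\<pi> (z + a) \<in> chart_dom (ch z)" using ch(2) pa by simp
    have ph: "\<phi> (ch z) (w + a) = \<phi> (ch z) w" for w by (simp add: \<phi>_def pa)
    have "pdx (\<phi> (ch z)) (z + a) = pdx (\<phi> (ch z)) z"
      using frechet_derivative_translate[OF ph dp[OF ch(1) d]] by (simp add: pdx_def)
    then show ?thesis using H[OF ch(1) d] H[OF ch(1) ch(2)] ph by simp
  qed
  have perH: "periodic H" unfolding periodic_def using per1[of 1] per1[of \<i>] by simp
  have Hnz: "H z \<noteq> 0" for z
  proof (rule periodic_zero_free[OF smH perH, of sg])
    fix z assume z: "H z = 0"
    let ?c = "ch z"
    let ?N = "\<pi> -` chart_dom ?c \<inter> ball z (1/2)"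
    show "eventually (\<lambda>w. sg * jac H w > 0) (at z)"
    proof (rule pullback_jac_sign[where N = ?N and \<phi> = "\<phi> ?c" and q = "hopf ?c" and W = "img ?c"])
      show "open ?N" "z \<in> ?N" using oN[OF ch(1)] ch(2) by auto
      show "smooth_on (\<phi> ?c) ?N" using smp[OF ch(1)] smooth_on_subset by blast
      show "open (img ?c)" "hopf ?c holomorphic_on img ?c" using open_img hopf_holomorphic ch(1) by auto
      show "\<phi> ?c ` ?N \<subseteq> img ?c" using im by blast
      show "inj_on (\<phi> ?c) ?N"
      proof
        fix u v assume u: "u \<in> ?N" and v: "v \<in> ?N" and eq: "\<phi> ?c u = \<phi> ?c v"
        have "\<pi> u = \<pi> v" using eq u v inv_map[OF ch(1)] by (metis \<phi>_def IntD1 comp_apply vimageE)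
        then have ints: "Re (u - v) \<in> \<int>" "Im (u - v) \<in> \<int>" using fib by auto
        have "norm (u - v) < 1"
          using u v dist_triangle_less_add[of z u "1/2" v "1/2"] dist_triangle2[of u v z]
          by (auto simp: dist_norm norm_minus_commute)
        then have "\<bar>Re (u - v)\<bar> < 1" "\<bar>Im (u - v)\<bar> < 1"
          using abs_Re_le_cmod[of "u - v"] abs_Im_le_cmod[of "u - v"] by linarith+
        then have "Re (u - v) = 0" "Im (u - v) = 0"
          using ints Ints_nonzero_abs_less1 by blast+
        then show "u = v" by (simp add: complex_eq_iff)
      qed
      show "H w = hopf ?c (\<phi> ?c w) * (pdx (\<phi> ?c) w)\<^sup>2" if "w \<in> ?N" for w using H[OF ch(1)] that by auto
      show "sg * jac (\<phi> ?c) z > 0" using sg ch by blast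
      have "\<phi> ?c z \<in> img ?c" using im ch(2) by blast
      then show "\<not> eventually (\<lambda>w. hopf ?c w = 0) (nhds (\<phi> ?c z))"
        by (rule hopf_not_locally_zero[OF ch(1)])
      have "pdx (\<phi> ?c) z \<noteq> 0" using jnz[OF ch(1) ch(2)[of z]] by (auto simp: jac_def)
      then show "hopf ?c (\<phi> ?c z) = 0" using z H[OF ch(1) ch(2)] by simp
    qed
  qed
  obtain z where z: "\<pi> z = chart_inv c w" using pi by (metis surjD)
  then have "\<pi> z \<in> chart_dom c" using inv_dom[OF c] by simp
  moreover have "\<phi> c z = w" using z map_inv[OF c] by (simp add: \<phi>_def)
  ultimately show ?thesis using Hnz[of z] H[OF c(1)] by auto
qed

end

section \<open>Global conserved quantities\<close>

lemma series_inner_nat: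
  "series_inner p q (- int n) x = (\<Sum>i\<le>n. lor (p (- int i) x) (q (- int (n - i)) x))"
proof -
  have *: "b = - int n - a" if "a + b = - int n" for a b :: int using that by simp
  show ?thesis unfolding series_inner_def
    by (rule sum.reindex_bij_witness[of _ "\<lambda>i. (- int i, - int (n - i))" "\<lambda>(i, j). nat (- i)"])
       (auto simp: of_nat_diff nat_le_iff dest!: *)
qed

lemma series_inner_pos:
  assumes "k > 0"
  shows "series_inner p q k x = 0"
proof -
  have "{(i, j). i \<le> 0 \<and> j \<le> 0 \<and> i + j = k} = {}" using assms by auto
  then show ?thesis unfolding series_inner_def by (simp only: sum.empty)
qed

context isothermic_surface
begin

abbreviation "chart_conserved c \<equiv> isothermic_patch.conserved (lft c) (tau1 c) (tau2 c)"

lemma eta_E: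
  assumes c: "c \<in> A" and x: "x \<in> chart_dom c"
  shows "blinfun_apply (blinfun_apply (\<eta> c x) v) w =
    Re v *\<^sub>R isothermic_patch.E1 (lft c) (tau1 c) (chart_map c x) w +
    Im v *\<^sub>R isothermic_patch.E2 (lft c) (tau2 c) (chart_map c x) w"
proof -
  interpret C: isothermic_patch "img c" "lft c" "tau1 c" "tau2 c" by (rule isothermic_patch_chart[OF c])
  have z: "chart_map c x \<in> img c" "chart_inv c (chart_map c x) = x" using x inv_map[OF c] by auto
  have "blinfun_apply (blinfun_apply (\<eta> c x) 1) w = C.E1 (chart_map c x) w"
    "blinfun_apply (blinfun_apply (\<eta> c x) \<i>) w = C.E2 (chart_map c x) w"
    using eta_form(1,2)[OF c z(1), of w] unfolding z(2) C.E1_def C.E2_def by auto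
  then show ?thesis by (subst eta_apply) (simp add: blinfun.add_left blinfun.scaleR_left)
qed

lemma conserved_of_formal:
  assumes p: "formal_conserved_quantity A \<eta> p" and r: "\<And>k x. series_inner p p k x = r k" and c: "c \<in> A"
  shows "chart_conserved c (img c) (\<lambda>n. r (- int n)) (\<lambda>k. p (- int k) \<circ> chart_inv c)"
proof -
  interpret C: isothermic_patch "img c" "lft c" "tau1 c" "tau2 c" by (rule isothermic_patch_chart[OF c])
  have eq: "dif c (p i) x v + blinfun_apply (blinfun_apply (\<eta> c x) v) (p (i - 1) x) = 0"
    if "x \<in> chart_dom c" for i x v using p c that unfolding formal_conserved_quantity_def by blast
  show ?thesis unfolding C.conserved_def
  proof (intro ballI conjI allI)
    fix z k assume z: "z \<in> img c"
    have x: "chart_inv c z \<in> chart_dom c" "chart_map c (chart_inv c z) = z"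
      using inv_dom[OF c z] map_inv[OF c z] by auto
    note E = eta_E[OF c x(1), unfolded x(2)]
    have "smooth_on (p (- int k) \<circ> chart_inv c) (img c)"
      using p c unfolding formal_conserved_quantity_def smooth_map_on_def by simp
    then show "(p (- int k) \<circ> chart_inv c) differentiable at z" using C.diffV z by blast
    have k: "- int k - 1 = - int (Suc k)" by simp
    show "pdx (p (- int k) \<circ> chart_inv c) z = - C.E1 z ((p (- int (Suc k)) \<circ> chart_inv c) z)"
      using eq[OF x(1), of "- int k" 1] unfolding E k
      by (simp add: dif_def pdx_def x(2) eq_neg_iff_add_eq_0)
    show "pdy (p (- int k) \<circ> chart_inv c) z = - C.E2 z ((p (- int (Suc k)) \<circ> chart_inv c) z)"
      using eq[OF x(1), of "- int k" \<i>] unfolding E k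
      by (simp add: dif_def pdy_def x(2) eq_neg_iff_add_eq_0)
    \<comment> \<open>The kernel condition on the leading coefficient is the equation at the first power of \<open>t\<close>.\<close>
    have "p 1 = (\<lambda>x. 0)" using p unfolding formal_conserved_quantity_def by auto
    then have "dif c (p 1) (chart_inv c z) v = 0" for v
      by (simp add: dif_def o_def)
    then show "C.E1 z ((p (- int 0) \<circ> chart_inv c) z) = 0" "C.E2 z ((p (- int 0) \<circ> chart_inv c) z) = 0"
      using eq[OF x(1), of 1 1] eq[OF x(1), of 1 \<i>] unfolding E by simp_all
    show "(\<Sum>i\<le>k. lor ((p (- int i) \<circ> chart_inv c) z) ((p (- int (k - i)) \<circ> chart_inv c) z)) = r (- int k)"
      using r[of "- int k" "chart_inv c z"] by (simp only: series_inner_nat o_apply)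
  qed
qed

lemma formal_of_conserved:
  assumes p0: "\<And>i x. i > 0 \<Longrightarrow> p i x = 0" and r0: "r 0 > 0" "\<And>i. i > 0 \<Longrightarrow> r i = 0"
    and sm: "\<And>c k. c \<in> A \<Longrightarrow> smooth_on (p (- int k) \<circ> chart_inv c) (img c)"
    and cons: "\<And>c. c \<in> A \<Longrightarrow> chart_conserved c (img c) (\<lambda>n. r (- int n)) (\<lambda>k. p (- int k) \<circ> chart_inv c)"
  shows "formal_conserved_quantity A \<eta> p" "series_inner p p k x = r k"
proof -
  have nonpos: "\<exists>k. i = - int k" if "i \<le> 0" for i :: int using that by (intro exI[of _ "nat (- i)"]) simp
  have pz: "p i = (\<lambda>x. 0)" if "i > 0" for i using p0 that by auto
  show si: "series_inner p p k x = r k" for k x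
  proof (cases "k > 0")
    case True
    then show ?thesis using series_inner_pos r0 by simp
  next
    case False
    then obtain n where n: "k = - int n" using nonpos[of k] by auto
    obtain c where c: "c \<in> A" "x \<in> chart_dom c" using chart_at by blast
    interpret C: isothermic_patch "img c" "lft c" "tau1 c" "tau2 c" by (rule isothermic_patch_chart[OF c(1)])
    have x: "chart_map c x \<in> img c" "chart_inv c (chart_map c x) = x" using c inv_map by auto
    have "(\<Sum>i\<le>n. lor ((p (- int i) \<circ> chart_inv c) (chart_map c x)) ((p (- int (n - i)) \<circ> chart_inv c) (chart_map c x))) = r (- int n)"
      using cons[OF c(1)] x(1) unfolding C.conserved_def by blast
    then show ?thesis unfolding n series_inner_nat o_apply x(2) .
  qed
  show "formal_conserved_quantity A \<eta> p"
    unfolding formal_conserved_quantity_def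
  proof (intro conjI allI ballI impI)
    show "p i x = 0" if "0 < i" for i x using p0 that .
    show "smooth_map_on A UNIV (p i)" for i
    proof (cases "i > 0")
      case True
      then show ?thesis using pz[OF True] by (simp add: smooth_map_on_def o_def smooth_on_const)
    next
      case False
      then obtain k where "i = - int k" using nonpos[of i] by auto
      then show ?thesis using sm by (simp add: smooth_map_on_def)
    qed
    obtain x :: 'a where True by blast
    have "lor (p 0 x) (p 0 x) = r 0" using si[of "- int 0" x] unfolding series_inner_nat by simp
    then have "p 0 x \<noteq> 0" using r0 by auto
    then show "\<exists>x. p 0 x \<noteq> 0" ..
    fix i :: int and c x v assume c: "c \<in> A" and x: "x \<in> chart_dom c"
    interpret C: isothermic_patch "img c" "lft c" "tau1 c" "tau2 c" by (rule isothermic_patch_chart[OF c])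
    have z: "chart_map c x \<in> img c" "chart_inv c (chart_map c x) = x" using c x inv_map by auto
    note cc = cons[OF c, unfolded C.conserved_def, rule_format, OF z(1)]
    consider "i > 1" | "i = 1" | "i \<le> 0" by linarith
    then show "dif c (p i) x v + blinfun_apply (blinfun_apply (\<eta> c x) v) (p (i - 1) x) = 0"
    proof cases
      case 1
      then show ?thesis using pz[of i] pz[of "i - 1"] by (simp add: dif_def o_def)
    next
      case 2
      have "dif c (p 1) x v = 0" using pz[of 1] by (simp add: dif_def o_def)
      moreover have "blinfun_apply (blinfun_apply (\<eta> c x) v) (p 0 x) = 0"
        unfolding eta_E[OF c x] using cc by (simp add: z(2))
      ultimately show ?thesis using 2 by simp
    next
      case 3
      then obtain k where k: "i = - int k" using nonpos by auto
      then have k': "i - 1 = - int (Suc k)" by simp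
      have "(p i \<circ> chart_inv c) differentiable (at (chart_map c x))" using cc unfolding k by blast
      then have "dif c (p i) x v = Re v *\<^sub>R pdx (p i \<circ> chart_inv c) (chart_map c x)
          + Im v *\<^sub>R pdy (p i \<circ> chart_inv c) (chart_map c x)"
        unfolding dif_def by (rule frechet_derivative_eq_pd)
      also have "\<dots> = - (Re v *\<^sub>R C.E1 (chart_map c x) (p (i - 1) x) + Im v *\<^sub>R C.E2 (chart_map c x) (p (i - 1) x))"
        unfolding k' unfolding k using cc by (simp add: z(2))
      finally show ?thesis unfolding eta_E[OF c x] by simp
    qed
  qed
qed

text \<open>The sets where \<open>g\<close> is positive and negative are open, and the surface is connected.\<close>

lemma constant_sign:
  fixes g :: "'a \<Rightarrow> real"
  assumes cont: "\<And>c. c \<in> A \<Longrightarrow> continuous_on (img c) (g \<circ> chart_inv c)" and sq: "\<And>x. g x \<noteq> 0"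
  shows "(\<forall>x. g x > 0) \<or> (\<forall>x. g x < 0)"
proof -
  have op: "open (g -` S)" if S: "open S" for S
  proof -
    have "g -` S = (\<Union>c\<in>A. chart_dom c \<inter> chart_map c -` (img c \<inter> (g \<circ> chart_inv c) -` S))"
      using chart_at inv_map by fastforce
    moreover have "open (img c \<inter> (g \<circ> chart_inv c) -` S)" if "c \<in> A" for c
      by (rule continuous_open_preimage[OF cont[OF that] open_img[OF that] S])
    then have "open (\<Union>c\<in>A. chart_dom c \<inter> chart_map c -` (img c \<inter> (g \<circ> chart_inv c) -` S))"
      by (intro open_UN ballI open_preimage)
    ultimately show ?thesis by (simp only:)
  qed
  have "g -` {0<..} \<union> g -` {..<0} = UNIV" using sq by (auto simp: linorder_neq_iff)
  moreover have "g -` {0<..} \<inter> g -` {..<0} = {}" by auto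
  ultimately have "g -` {0<..} = {} \<or> g -` {..<0} = {}"
    using connectedD[OF connected_UNIV_surface op[of "{0<..}"] op[of "{..<0}"]] by auto
  then show ?thesis using sq by (metis greaterThan_iff lessThan_iff linorder_neqE vimage_eq empty_iff)
qed

text \<open>In each chart the sign of the series is normalised by the product of the leading coefficient with the
  unit normal.  As the normals of different charts agree, uniqueness glues the local series.  For an
  arbitrary second solution this product has constant sign, since its square is \<open>r 0\<close>.\<close>

theorem exists_unique_conserved:
  assumes nz: "\<And>c z. c \<in> A \<Longrightarrow> z \<in> img c \<Longrightarrow> hopf c z \<noteq> 0" and r0: "r 0 > 0" "\<And>i. i > 0 \<Longrightarrow> r i = 0"
  shows "\<exists>p. formal_conserved_quantity A \<eta> p \<and> (\<forall>k x. series_inner p p k x = r k) \<and>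
           (\<forall>q. formal_conserved_quantity A \<eta> q \<and> (\<forall>k x. series_inner q q k x = r k) \<longrightarrow>
              q = p \<or> q = (\<lambda>i x. - p i x))"
proof -
  define rr where "rr = (\<lambda>n. r (- int n))"
  have rr0: "rr 0 > 0" using r0 by (simp add: rr_def)
  have reg: "regular_patch (img c) (lft c) (tau1 c) (tau2 c)" if c: "c \<in> A" for c
  proof -
    interpret C: isothermic_patch "img c" "lft c" "tau1 c" "tau2 c" by (rule isothermic_patch_chart[OF c])
    have "C.q = hopf c" by (auto simp: C.q_def C.qre_def C.qim_def hopf_def)
    then show ?thesis using nz[OF c] by unfold_locales simp
  qed
  have "\<exists>P. (\<forall>k. smooth_on (P k) (img c)) \<and> chart_conserved c (img c) rr P \<and>
     (\<forall>z\<in>img c. lor (P 0 z) (null_lift.normal (lft c) z) > 0)" if c: "c \<in> A" for c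
  proof -
    interpret C: regular_patch "img c" "lft c" "tau1 c" "tau2 c" by (rule reg[OF c])
    show ?thesis
      using C.smooth_conserved_series[of rr] C.conserved_series_conserved[of rr] C.conserved_series_positive[of rr] rr0
      by blast
  qed
  then have "\<exists>P. \<forall>c\<in>A. (\<forall>k. smooth_on (P c k) (img c)) \<and> chart_conserved c (img c) rr (P c) \<and>
     (\<forall>z\<in>img c. lor (P c 0 z) (null_lift.normal (lft c) z) > 0)"
    by (intro bchoice) blast
  then obtain P where P: "\<And>c k. c \<in> A \<Longrightarrow> smooth_on (P c k) (img c)"
    "\<And>c. c \<in> A \<Longrightarrow> chart_conserved c (img c) rr (P c)"
    "\<And>c z. c \<in> A \<Longrightarrow> z \<in> img c \<Longrightarrow> lor (P c 0 z) (null_lift.normal (lft c) z) > 0" by blast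
  have glue: "P c k (chart_map c x) = P d k (chart_map d x)"
    if c: "c \<in> A" "x \<in> chart_dom c" and d: "d \<in> A" "x \<in> chart_dom d" for c d k x
  proof -
    interpret C: regular_patch "img c" "lft c" "tau1 c" "tau2 c" by (rule reg[OF c(1)])
    have z: "chart_map c x \<in> overlap c d" using c d by blast
    have "P c k (chart_map c x) = P d k (transition c d (chart_map c x))"
    proof (rule C.conserved_unique[OF open_overlap[OF c(1) d(1)] _ _ conserved_change[OF c(1) d(1) P(2)[OF d(1)]] _ _ z])
      show "overlap c d \<subseteq> img c" by blast
      then show "C.conserved (overlap c d) rr (P c)" using C.conserved_mono P(2)[OF c(1)] by blast
      show "0 < lor (P c 0 z) (C.normal z)" if "z \<in> overlap c d" for z
        using P(3)[OF c(1)] that by blast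
      show "0 < lor (P d 0 (transition c d z)) (C.normal z)" if "z \<in> overlap c d" for z
        unfolding normal_change[OF c(1) d(1) that] using P(3)[OF d(1) transition_in[OF c(1) d(1) that]] .
    qed
    then show ?thesis using transition_map[OF c(1) d(1) c(2)] by simp
  qed
  define ch where "ch x = (SOME c. c \<in> A \<and> x \<in> chart_dom c)" for x
  have ch: "ch x \<in> A" "x \<in> chart_dom (ch x)" for x
    using someI_ex[of "\<lambda>c. c \<in> A \<and> x \<in> chart_dom c"] chart_at[of x] unfolding ch_def by blast+
  define p where "p i x = (if i > 0 then 0 else P (ch x) (nat (- i)) (chart_map (ch x) x))" for i x
  have pP: "(p (- int k) \<circ> chart_inv c) z = P c k z" if c: "c \<in> A" "z \<in> img c" for c k z
    using glue[OF c(1) inv_dom[OF c] ch] map_inv[OF c] by (simp add: p_def)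
  have psm: "smooth_on (p (- int k) \<circ> chart_inv c) (img c)" if c: "c \<in> A" for c k
    by (rule smooth_on_cong[OF open_img[OF c] _ P(1)[OF c]]) (simp only: pP[OF c])
  have pcons: "chart_conserved c (img c) rr (\<lambda>k. p (- int k) \<circ> chart_inv c)" if c: "c \<in> A" for c
  proof -
    interpret C: regular_patch "img c" "lft c" "tau1 c" "tau2 c" by (rule reg[OF c])
    have pd: "pdx (P c k) z = pdx (p (- int k) \<circ> chart_inv c) z" "pdy (P c k) z = pdy (p (- int k) \<circ> chart_inv c) z"
      "(p (- int k) \<circ> chart_inv c) differentiable (at z)" if z: "z \<in> img c" for z k
      using pd_cong[where f = "P c k" and g = "p (- int k) \<circ> chart_inv c", OF open_img[OF c] z]
        pP[OF c] C.diffV[OF P(1)[OF c] z] C.diffV[OF psm[OF c] z] by simp_all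
    show ?thesis unfolding C.conserved_def
    proof (intro ballI conjI allI)
      fix z k assume z: "z \<in> img c"
      note cP = P(2)[OF c, unfolded C.conserved_def, rule_format, OF z]
      show "C.E1 z ((p (- int 0) \<circ> chart_inv c) z) = 0" "C.E2 z ((p (- int 0) \<circ> chart_inv c) z) = 0"
        unfolding pP[OF c z] using cP by blast+
      show "(p (- int k) \<circ> chart_inv c) differentiable (at z)" by (rule pd(3)[OF z])
      show "pdx (p (- int k) \<circ> chart_inv c) z = - C.E1 z ((p (- int (Suc k)) \<circ> chart_inv c) z)"
        "pdy (p (- int k) \<circ> chart_inv c) z = - C.E2 z ((p (- int (Suc k)) \<circ> chart_inv c) z)"
        unfolding pP[OF c z] pd(1,2)[OF z, symmetric] using cP by blast+
      show "(\<Sum>i\<le>k. lor ((p (- int i) \<circ> chart_inv c) z) ((p (- int (k - i)) \<circ> chart_inv c) z)) = rr k"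
        unfolding pP[OF c z] using cP by blast
    qed
  qed
  have p: "formal_conserved_quantity A \<eta> p" "\<And>k x. series_inner p p k x = r k"
    using formal_of_conserved[of p r] pcons psm r0 by (auto simp: p_def rr_def)
  have ppos: "lor ((p (- int 0) \<circ> chart_inv c) z) (null_lift.normal (lft c) z) > 0" if "c \<in> A" "z \<in> img c" for c z
    unfolding pP[OF that] using P(3)[OF that] .
  have agree: "q = p" if q: "\<And>c. c \<in> A \<Longrightarrow> chart_conserved c (img c) rr (\<lambda>k. q (- int k) \<circ> chart_inv c)"
      and q0: "\<And>i x. i > 0 \<Longrightarrow> q i x = 0"
      and qpos: "\<And>c z. c \<in> A \<Longrightarrow> z \<in> img c \<Longrightarrow> lor ((q (- int 0) \<circ> chart_inv c) z) (null_lift.normal (lft c) z) > 0" for q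
  proof (intro ext)
    fix i x
    show "q i x = p i x"
    proof (cases "i > 0")
      case True
      then show ?thesis using q0 by (simp add: p_def)
    next
      case False
      then obtain k where k: "i = - int k" by (metis minus_equation_iff not_less nonneg_int_cases neg_0_le_iff_le)
      obtain c where c: "c \<in> A" "x \<in> chart_dom c" using chart_at by blast
      interpret C: regular_patch "img c" "lft c" "tau1 c" "tau2 c" by (rule reg[OF c(1)])
      have "(q (- int k) \<circ> chart_inv c) (chart_map c x) = (p (- int k) \<circ> chart_inv c) (chart_map c x)"
        using c by (intro C.conserved_unique[OF open_img[OF c(1)] subset_refl q[OF c(1)] pcons[OF c(1)] qpos[OF c(1)] ppos[OF c(1)]]) auto
      then show ?thesis using inv_map[OF c] by (simp add: k)
    qed
  qed
  have uniq: "q = p \<or> q = (\<lambda>i x. - p i x)"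
    if q: "formal_conserved_quantity A \<eta> q" "\<And>k x. series_inner q q k x = r k" for q
  proof -
    have qc: "chart_conserved c (img c) rr (\<lambda>k. q (- int k) \<circ> chart_inv c)" if "c \<in> A" for c
      unfolding rr_def by (rule conserved_of_formal[OF q that])
    have q0: "q i x = 0" if "i > 0" for i x using q that unfolding formal_conserved_quantity_def by blast
    have qsm: "smooth_on (q 0 \<circ> chart_inv c) (img c)" if "c \<in> A" for c
      using q(1) that unfolding formal_conserved_quantity_def smooth_map_on_def by simp
    define g where "g x = lor (q 0 x) (null_lift.normal (lft (ch x)) (chart_map (ch x) x))" for x
    have nrm: "null_lift.normal (lft (ch x)) (chart_map (ch x) x) = null_lift.normal (lft c) (chart_map c x)"
      if c: "c \<in> A" "x \<in> chart_dom c" for c x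
    proof -
      have "chart_map (ch x) x \<in> overlap (ch x) c" using c ch by blast
      from normal_change[OF ch(1) c(1) this] show ?thesis using transition_map[OF ch(1) c(1) ch(2)] by simp
    qed
    have g: "(g \<circ> chart_inv c) z = lor ((q 0 \<circ> chart_inv c) z) (null_lift.normal (lft c) z)"
      if c: "c \<in> A" "z \<in> img c" for c z
      using nrm[OF c(1) inv_dom[OF c]] map_inv[OF c] by (simp add: g_def)
    have "(\<forall>x. g x > 0) \<or> (\<forall>x. g x < 0)"
    proof (rule constant_sign)
      fix c assume c: "c \<in> A"
      interpret C: regular_patch "img c" "lft c" "tau1 c" "tau2 c" by (rule reg[OF c])
      have "continuous_on (img c) (\<lambda>z. lor ((q 0 \<circ> chart_inv c) z) (C.normal z))"
        by (intro smooth_on_imp_continuous_on smooth_on_lor qsm[OF c] C.smooth_gauss)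
      then show "continuous_on (img c) (g \<circ> chart_inv c)"
        by (rule continuous_on_eq) (rule g[OF c, symmetric])
    next
      fix x
      obtain c where c: "c \<in> A" "x \<in> chart_dom c" using chart_at by blast
      interpret C: regular_patch "img c" "lft c" "tau1 c" "tau2 c" by (rule reg[OF c(1)])
      have z: "chart_map c x \<in> img c" "chart_inv c (chart_map c x) = x" using c inv_map by auto
      have "((g \<circ> chart_inv c) (chart_map c x))\<^sup>2 = rr 0"
        using C.conserved_leading(2)[OF open_img[OF c(1)] subset_refl z(1) qc[OF c(1)]] unfolding g[OF c(1) z(1)] by simp
      then show "g x \<noteq> 0" using rr0 z by auto
    qed
    then show ?thesis
    proof
      assume pos: "\<forall>x. g x > 0"
      have "q = p"
      proof (rule agree[OF qc q0])
        fix c z assume c: "c \<in> A" "z \<in> img c"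
        show "lor ((q (- int 0) \<circ> chart_inv c) z) (null_lift.normal (lft c) z) > 0"
          using g[OF c] pos[rule_format, of "chart_inv c z"] by simp
      qed
      then show ?thesis ..
    next
      assume neg: "\<forall>x. g x < 0"
      have "(\<lambda>i x. - q i x) = p"
      proof (rule agree)
        fix c z assume c: "c \<in> A" "z \<in> img c"
        show "lor (((\<lambda>x. - q (- int 0) x) \<circ> chart_inv c) z) (null_lift.normal (lft c) z) > 0"
          using g[OF c] neg[rule_format, of "chart_inv c z"] by simp
      next
        fix c assume c: "c \<in> A"
        interpret C: regular_patch "img c" "lft c" "tau1 c" "tau2 c" by (rule reg[OF c])
        show "C.conserved (img c) rr (\<lambda>k. (\<lambda>x. - q (- int k) x) \<circ> chart_inv c)"
          using C.conserved_minus[OF qc[OF c]] by (simp only: o_def)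
      qed (simp add: q0)
      then have "p = (\<lambda>i x. - q i x)" by (rule sym)
      then have "q = (\<lambda>i x. - p i x)" by simp
      then show ?thesis ..
    qed
  qed
  show ?thesis using p uniq by blast
qed

end

theorem corollary2p8:
  fixes A :: "'a::t2_space chart set"
    and \<Lambda> :: "'a \<Rightarrow> R41 set"
    and \<eta> :: "'a form"
    and r :: "int \<Rightarrow> real"
  assumes "riemann_surface A"
    and "two_torus A"
    and "isothermic A \<Lambda> \<eta>"
    and "\<forall>i>0. r i = 0"
    and "r 0 > 0"
  shows "\<exists>p. formal_conserved_quantity A \<eta> p \<and> (\<forall>k x. series_inner p p k x = r k) \<and>
           (\<forall>q. formal_conserved_quantity A \<eta> q \<and> (\<forall>k x. series_inner q q k x = r k) \<longrightarrow>
              q = p \<or> q = (\<lambda>i x. - p i x))"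
proof -
  interpret isothermic_surface A \<Lambda> \<eta>
    using assms(1,3) by unfold_locales
  show ?thesis
    by (rule exists_unique_conserved) (use hopf_nonzero_on_torus[OF assms(2)] assms(4,5) in auto)
qed

end
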